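(* Let $\alpha\ge-\frac12$, $\gamma>0$, $0<\beta<d_\alpha$, $1<p<\infty$, and let $s\ge1$ satisfy $\frac{d_\alpha}{d_\alpha+\gamma-\beta}<s<\frac{d_\alpha}{d_\alpha-\beta}$. Assume that $\omega:\mathbb{R}^+\to\mathbb{R}^+$ satisfies the doubling condition and that there are constants $C',C''>0$ with $C'r^{\beta-d_\alpha}\le\omega(r)\le C''r^{-\beta}$ for every $r>0$. Let $\phi:\mathbb{R}^+\to\mathbb{R}^+$ be measurable, with $\phi$ almost decreasing and $r\mapsto r^{d_\alpha/p}\phi(r)$ almost increasing, and suppose that for some constant $C_0>0$, $\phi(r)\le C_0r^\nu$ for every $r>0$, where $\nu<-\beta<-d_\alpha-\nu$. Then there is a constant $C>0$ such that for all $f\in L^{p,\phi}(\mathbb{R},d\mu_\alpha)$, $$\|I_{\beta,\gamma}^\alpha f\|_{L^{q,\psi}(\mathbb{R},d\mu_\alpha)}\le C\,\|K_{\beta,\gamma}^\alpha\|_{L^{s,\omega}(\mathbb{R},d\mu_\alpha)}\,\|f\|_{L^{p,\phi}(\mathbb{R},d\mu_\alpha)},$$ where $q=\frac{\nu p}{\nu+d_\alpha-\beta}$ and $\psi(r)=(\phi(r))^{p/q}$.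
   Context: Notation: $\mathbb{R}^+=(0,\infty)$; $\alpha\ge-\frac12$ is a fixed real number; $d_\alpha=2\alpha+2$; $d\mu_\alpha(x)=A_\alpha|x|^{2\alpha+1}dx$ on $\mathbb{R}$ with $A_\alpha=(2^{\alpha+1}\Gamma(\alpha+1))^{-1}$; $B(0,r)=(-r,r)$. Dunkl translation: for $x,y\in\mathbb{R}$ and $\theta\in[0,\pi]$ put $(x,y)_\theta=\sqrt{x^2+y^2-2xy\cos\theta}$. For a function $g$ on $\mathbb{R}$ (continuous, or locally integrable with respect to $\mu_\alpha$, in which case the formula is understood for almost every $y$), $$\tau_x^\alpha g(y)=\frac{c_\alpha}{2}\int_0^\pi\Big\{g((x,y)_\theta)+g(-(x,y)_\theta)+\frac{x+y}{(x,y)_\theta}\big[g((x,y)_\theta)-g(-(x,y)_\theta)\big]\Big\}(1-\cos\theta)\sin^{2\alpha}\theta\,d\theta,$$ with $c_\alpha=\big(\int_0^\pi\sin^{2\alpha}\theta\,d\theta\big)^{-1}$; for $\alpha=-\frac12$ it is the ordinary translation $\tau_x^\alpha g(y)=g(x+y)$. The notation $\tau_x^\alpha|f|^p(y)$ means $(\tau_x^\alpha(|f|^p))(y)$. Generalized Dunkl-type Morrey space: for $1\le p<\infty$ and a function $\phi:\mathbb{R}^+\to\mathbb{R}^+$, $L^{p,\phi}(\mathbb{R},d\mu_\alpha)$ is the set of locally $p$-integrable $f$ on $\mathbb{R}$ with $$\|f\|_{L^{p,\phi}(\mathbb{R},d\mu_\alpha)}=\sup_{r>0,\,x\in\mathbb{R}}\frac1{\phi(r)}\Big(\frac1{r^{d_\alpha}}\int_{B(0,r)}\tau_x^\alpha|f|^p(y)\,d\mu_\alpha(y)\Big)^{1/p}<\infty$$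 ($L^{s,\omega}$ is the same with $s,\omega$ in place of $p,\phi$). Dunkl-type Bessel–Riesz operator: $I_{\beta,\gamma}^\alpha f(x)=\int_{\mathbb{R}}f(y)\,\tau_x^\alpha K_{\beta,\gamma}^\alpha(y)\,d\mu_\alpha(y)$, where $K_{\beta,\gamma}^\alpha(x)=\frac{|x|^{\beta-d_\alpha}}{(1+|x|)^\gamma}$. A function $\omega:\mathbb{R}^+\to\mathbb{R}^+$ satisfies the doubling condition if there is $C_1>0$ such that $\frac12\le\frac rs\le2$ implies $\frac1{C_1}\le\frac{\omega(r)}{\omega(s)}\le C_1$. A function $\theta:(0,\infty)\to(0,\infty)$ is almost increasing (resp. almost decreasing) if there is $C>0$ with $\theta(r)\le C\theta(s)$ (resp. $\theta(r)\ge C\theta(s)$) for all $r\le s$. *)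

theory Defs
  imports "HOL-Analysis.Analysis"
begin

definition dunkl_dim :: "real \<Rightarrow> real" where
  "dunkl_dim \<alpha> = 2 * \<alpha> + 2"

definition dunkl_measure :: "real \<Rightarrow> real measure" where
  "dunkl_measure \<alpha> =
     density lebesgue
       (\<lambda>x. ennreal (inverse (2 powr (\<alpha> + 1) * Gamma (\<alpha> + 1)) * \<bar>x\<bar> powr (2 * \<alpha> + 1)))"

definition dunkl_polar :: "real \<Rightarrow> real \<Rightarrow> real \<Rightarrow> real" where
  "dunkl_polar x y \<theta> = sqrt (x\<^sup>2 + y\<^sup>2 - 2 * x * y * cos \<theta>)"

definition dunkl_const :: "real \<Rightarrow> real" where
  "dunkl_const \<alpha> = inverse (LINT \<theta>:{0..pi}|lebesgue. sin \<theta> powr (2 * \<alpha>))"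

text \<open>
  The denominator \<open>dunkl_polar x y \<theta>\<close> vanishes for at most one \<open>\<theta>\<close>, unless \<open>x = y = 0\<close>, where the
  difference quotient is \<open>0\<close> by convention and \<open>dunkl_translation \<alpha> 0 g 0 = g 0\<close>.
  For locally integrable \<open>g\<close> the integral over \<open>\<theta>\<close> converges for almost every \<open>y\<close>.
\<close>

definition dunkl_translation :: "real \<Rightarrow> real \<Rightarrow> (real \<Rightarrow> real) \<Rightarrow> real \<Rightarrow> real" where
  "dunkl_translation \<alpha> x g y =
     (if \<alpha> = - 1 / 2 then g (x + y)
      else dunkl_const \<alpha> / 2 *
        (LINT \<theta>:{0..pi}|lebesgue.
           (g (dunkl_polar x y \<theta>) + g (- dunkl_polar x y \<theta>)
             + (x + y) / dunkl_polar x y \<theta>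
                 * (g (dunkl_polar x y \<theta>) - g (- dunkl_polar x y \<theta>)))
           * (1 - cos \<theta>) * sin \<theta> powr (2 * \<alpha>)))"

definition dunkl_locally_integrable ::
  "real \<Rightarrow> real \<Rightarrow> (real \<Rightarrow> 'a::real_normed_vector) \<Rightarrow> bool" where
  "dunkl_locally_integrable \<alpha> p f \<longleftrightarrow>
     f \<in> borel_measurable lebesgue \<and>
     (\<forall>S. compact S \<longrightarrow> set_integrable (dunkl_measure \<alpha>) S (\<lambda>x. norm (f x) powr p))"

text \<open>
  The translation is not a positive operator, so the inner integral is a Bochner integral of a
  possibly signed function. Its value is nonnegative: by duality it is the integral of \<open>|f|\<^sup>p\<close> against
  the translate of the indicator of \<open>ball 0 r\<close>, and translates of nonnegative even functions are
  nonnegative. The norm is \<open>\<infinity>\<close> when the supremum is not finite; it is only meaningful for locally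
  \<open>p\<close>-integrable \<open>f\<close>.
\<close>

definition dunkl_morrey_norm ::
  "real \<Rightarrow> real \<Rightarrow> (real \<Rightarrow> real) \<Rightarrow> (real \<Rightarrow> 'a::real_normed_vector) \<Rightarrow> ennreal" where
  "dunkl_morrey_norm \<alpha> p \<phi> f =
     (SUP (r, x) \<in> {0<..} \<times> UNIV.
        ennreal (1 / \<phi> r *
          (1 / r powr dunkl_dim \<alpha> *
            (LINT y:ball 0 r|dunkl_measure \<alpha>.
               dunkl_translation \<alpha> x (\<lambda>z. norm (f z) powr p) y)) powr (1 / p)))"

definition dunkl_morrey_space ::
  "real \<Rightarrow> real \<Rightarrow> (real \<Rightarrow> real) \<Rightarrow> (real \<Rightarrow> 'a::real_normed_vector) set" where
  "dunkl_morrey_space \<alpha> p \<phi> =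
     {f. dunkl_locally_integrable \<alpha> p f \<and> dunkl_morrey_norm \<alpha> p \<phi> f < \<infinity>}"

definition bessel_riesz_kernel :: "real \<Rightarrow> real \<Rightarrow> real \<Rightarrow> real \<Rightarrow> real" where
  "bessel_riesz_kernel \<alpha> \<beta> \<gamma> x = \<bar>x\<bar> powr (\<beta> - dunkl_dim \<alpha>) / (1 + \<bar>x\<bar>) powr \<gamma>"

definition bessel_riesz_integrand ::
  "real \<Rightarrow> real \<Rightarrow> real \<Rightarrow> (real \<Rightarrow> 'a::real_normed_vector) \<Rightarrow> real \<Rightarrow> real \<Rightarrow> 'a" where
  "bessel_riesz_integrand \<alpha> \<beta> \<gamma> f x y =
     dunkl_translation \<alpha> x (bessel_riesz_kernel \<alpha> \<beta> \<gamma>) y *\<^sub>R f y"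

definition bessel_riesz ::
  "real \<Rightarrow> real \<Rightarrow> real \<Rightarrow> (real \<Rightarrow> 'a::{banach, second_countable_topology}) \<Rightarrow> real \<Rightarrow> 'a" where
  "bessel_riesz \<alpha> \<beta> \<gamma> f x = (LINT y|dunkl_measure \<alpha>. bessel_riesz_integrand \<alpha> \<beta> \<gamma> f x y)"

text \<open>Functions on the open half-line are total functions whose values are only used at positive
  arguments.\<close>

definition doubling :: "(real \<Rightarrow> real) \<Rightarrow> bool" where
  "doubling \<omega> \<longleftrightarrow>
     (\<exists>C>0. \<forall>r>0. \<forall>s>0. 1 / 2 \<le> r / s \<and> r / s \<le> 2 \<longrightarrow>
        1 / C \<le> \<omega> r / \<omega> s \<and> \<omega> r / \<omega> s \<le> C)"

definition almost_increasing :: "(real \<Rightarrow> real) \<Rightarrow> bool" where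
  "almost_increasing h \<longleftrightarrow> (\<exists>C>0. \<forall>r>0. \<forall>s\<ge>r. h r \<le> C * h s)"

definition almost_decreasing :: "(real \<Rightarrow> real) \<Rightarrow> bool" where
  "almost_decreasing h \<longleftrightarrow> (\<exists>C>0. \<forall>r>0. \<forall>s\<ge>r. h r \<ge> C * h s)"

end

theory Submission
  imports Defs "HOL-Real_Asymp.Real_Asymp"
begin

text \<open>
Write \<open>d = 2 * \<alpha> + 2\<close>, let \<open>\<mu>\<close> be the weighted measure, \<open>\<tau>\<^sub>x\<close> the translation and \<open>K\<close> the
kernel. Letting \<open>r\<close> tend to \<open>0\<close> and to \<open>\<infinity>\<close> in \<open>C' r\<^bsup>\<beta> - d\<^esup> \<le> \<omega>(r) \<le> C'' r\<^bsup>- \<beta>\<^esup>\<close> forces \<open>d = 2 \<beta>\<close>, so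
that \<open>p / q = 1 + \<beta> / \<nu>\<close> lies strictly between \<open>0\<close> and \<open>1\<close>. This is the exponent of Adams' theorem, and
the proof is Hedberg's: the potential is bounded pointwise by a power of a maximal function, and the
maximal function is bounded on the Morrey space. Three points need work.

\<^emph>\<open>The Morrey norm is that of a doubling space.\<close> The translation is not positive in general, but by duality
the integral of \<open>\<tau>\<^sub>x g\<close> over \<open>(-r, r)\<close> is the integral of \<open>g\<close> against the translate by \<open>- x\<close> of
the indicator of \<open>(-r, r)\<close>, which is nonnegative (\<open>integral_ball_dunkl_translation\<close>). That
translate is at least a constant times \<open>r\<^sup>d / V(x, r)\<close> on the ball of radius \<open>r / 2\<close> around \<open>x\<close>, at most a
constant times it everywhere, and zero off the balls of radius \<open>r\<close> around \<open>x\<close> and \<open>- x\<close>. Here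
\<open>V(x, r)\<close> is \<open>r (\<bar>x\<bar> + r)\<^bsup>d - 1\<^esup>\<close> up to a constant; it bounds the measure of the ball and is doubling.
So, for almost decreasing \<open>\<phi>\<close>, the Dunkl-Morrey norm of \<open>f\<close> is comparable to the least \<open>N\<close> such that
\<open>\<bar>f\<bar>\<^sup>p\<close> has integral at most \<open>V(x, r) (\<phi>(r) N)\<^sup>p\<close> over every ball (\<open>dunkl_morrey_norm_imp_ball_bound\<close>,
\<open>ball_bound_imp_dunkl_morrey_norm\<close>). The duality is plane geometry: if \<open>(y, \<theta>)\<close> are polar
coordinates in the upper half plane, then \<open>\<bar>y\<bar>\<^bsup>2\<alpha> + 1\<^esup> sin\<^bsup>2\<alpha>\<^esup> \<theta> dy d\<theta>\<close> is \<open>v\<^bsup>2\<alpha>\<^esup> du dv\<close>, which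
\<open>u \<mapsto> x - u\<close> preserves, and \<open>(x, y)\<^sub>\<theta>\<close> is the distance to the point \<open>(x, 0)\<close>, that is, the radius
after this reflection (\<open>nn_integral_dunkl_polar_exchange\<close>).

\<^emph>\<open>The pointwise bound\<close> (\<open>riesz_majorant_hedberg\<close>). The power \<open>\<bar>x\<bar>\<^bsup>\<beta> - d\<^esup>\<close>, which dominates
\<open>K\<close>, is a superposition of indicators of balls, so the potential at \<open>x\<close> is at most a constant times the integral of
\<open>t\<^bsup>\<beta> - 1\<^esup>\<close> times the average of \<open>\<bar>f(y)\<bar> + \<bar>f(- y)\<bar>\<close> over the ball of radius \<open>t\<close> around \<open>x\<close>. If all averages are
at most \<open>m\<close>, then, as the Morrey bound makes them at most a constant times \<open>N t\<^sup>\<nu>\<close>, splitting at the radius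
where the two bounds agree gives \<open>m\<^bsup>p / q\<^esup> N\<^bsup>1 - p / q\<^esup>\<close> up to a constant.

\<^emph>\<open>The maximal bound\<close> (\<open>riesz_majorant_local_bound\<close>). Where the potential exceeds that value,
some average exceeds \<open>m\<close>. On the ball of radius \<open>r\<close> around \<open>x\<^sub>0\<close>, and for \<open>m\<close> above a multiple of \<open>\<phi>(r) N\<close>, it
must have radius less than \<open>r\<close>, so it only sees the function on the ball of radius \<open>2 r\<close>.
Vitali's covering lemma then bounds the measure of such points (\<open>dunkl_weak_type\<close>), and
integration over \<open>m\<close> gives the \<open>q\<close>-th power of the potential (\<open>weak_type_imp_strong_type\<close>).

Since \<open>C\<close> may depend on everything but \<open>f\<close>, it remains to know that the norm of the kernel, finite or
not, is positive (\<open>dunkl_morrey_norm_kernel_pos\<close>).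
\<close>

section \<open>Polar coordinates in the upper half plane\<close>

text \<open>
For fixed height \<open>v\<close> the angle determines the point \<open>(v cot \<theta>, v)\<close>. The function under the integral is
an arbitrary Borel function, so the substitution is made on compact subintervals of \<open>(0, \<pi>)\<close> and
passed to the limit by monotone convergence.
\<close>

lemma nn_integral_cot_substitution:
  fixes f :: "real \<Rightarrow> ennreal"
  assumes [measurable]: "f \<in> borel_measurable borel" and v: "v > 0"
  shows "(\<integral>\<^sup>+u. f u \<partial>lborel)
    = (\<integral>\<^sup>+\<theta>. f (v * cot \<theta>) * ennreal (v / (sin \<theta>)\<^sup>2) * indicator {0<..<pi} \<theta> \<partial>lborel)"
proof -
  define g where "g \<theta> = - v * cot \<theta>" for \<theta>
  define a where "a n = pi / (2 * real n + 4)" for n :: nat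
  \<comment> \<open>The substitution rule is for increasing functions, so \<open>- v cot \<theta>\<close> is used and \<open>f\<close> reflected.\<close>
  define h where "h u = f (- u)" for u
  have [measurable]: "h \<in> borel_measurable borel" unfolding h_def by measurable
  have [measurable]: "(\<lambda>\<theta>::real. cot \<theta>) \<in> borel_measurable borel" unfolding cot_def by measurable
  have a_pos: "0 < a n" and a_small: "a n < pi / 2" for n
    unfolding a_def by (auto simp: field_simps add_pos_nonneg)
  have a_lim: "a \<longlonglongrightarrow> 0"
    unfolding a_def by real_asymp
  have a_dec: "a n \<le> a m" if "m \<le> n" for m n
    unfolding a_def using that by (auto simp: field_simps)
  have g_refl: "g (pi - \<theta>) = - g \<theta>" for \<theta>
    unfolding g_def by (simp add: cot_def sin_diff cos_diff)
  have sin_pos: "sin \<theta> > 0" if "\<theta> \<in> {a n..pi - a n}" for n \<theta>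
    using that a_pos[of n] by (intro sin_gt_zero) auto
  have step: "(\<integral>\<^sup>+u. h u * indicator {g (a n)..g (pi - a n)} u \<partial>lborel) =
     (\<integral>\<^sup>+\<theta>. h (g \<theta>) * ennreal (v / (sin \<theta>)\<^sup>2) * indicator {a n..pi - a n} \<theta> \<partial>lborel)" for n
  proof (rule nn_integral_substitution_aux)
    show "(g has_real_derivative v / (sin \<theta>)\<^sup>2) (at \<theta>)" if "\<theta> \<in> {a n..pi - a n}" for \<theta>
      unfolding g_def using sin_pos[OF that]
      by (auto intro!: derivative_eq_intros DERIV_cot simp: field_simps)
    show "continuous_on {a n..pi - a n} (\<lambda>\<theta>. v / (sin \<theta>)\<^sup>2)"
      using sin_pos by (intro continuous_intros) fastforce
    show "a n < pi - a n" using a_small[of n] by simp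
  qed (use v in auto)
  have grow: "filterlim (\<lambda>n. - g (a n)) at_top sequentially"
  proof -
    have "filterlim (\<lambda>x::real. v * cot x) at_top (at_right 0)"
      using v unfolding cot_def by real_asymp
    moreover have "filterlim a (at_right 0) sequentially"
      using a_lim a_pos by (intro tendsto_imp_filterlim_at_right) auto
    ultimately show ?thesis unfolding g_def
      using filterlim_compose[of "\<lambda>x. v * cot x" at_top "at_right 0" a] by simp
  qed
  have cotmono: "g x \<le> g y" if "0 < x" "x \<le> y" "y < pi" for x y
  proof (rule DERIV_nonneg_imp_nondecreasing[OF that(2)])
    fix t assume "x \<le> t" "t \<le> y"
    then have "sin t > 0" using that by (intro sin_gt_zero) auto
    then have "(g has_real_derivative v / (sin t)\<^sup>2) (at t)"
      unfolding g_def by (auto intro!: derivative_eq_intros DERIV_cot simp: field_simps)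
    then show "\<exists>d. (g has_real_derivative d) (at t) \<and> 0 \<le> d"
      using v by (auto intro!: exI[of _ "v / (sin t)\<^sup>2"])
  qed
  have lim1: "(SUP n. (\<integral>\<^sup>+u. h u * indicator {g (a n)..g (pi - a n)} u \<partial>lborel)) = (\<integral>\<^sup>+u. h u \<partial>lborel)"
  proof -
    have inc: "incseq (\<lambda>n u. h u * indicator {g (a n)..g (pi - a n)} u)"
    proof (rule incseq_SucI, rule le_funI, rule mult_left_mono)
      fix n u
      have "g (a (Suc n)) \<le> g (a n)"
        using a_small[of n] a_pos[of "Suc n"] a_dec[of n "Suc n"] pi_gt_zero by (intro cotmono) auto
      then show "indicator {g (a n)..g (pi - a n)} u \<le> (indicator {g (a (Suc n))..g (pi - a (Suc n))} u :: ennreal)"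
        by (auto simp: g_refl split: split_indicator)
    qed simp
    have "(SUP n. h u * indicator {g (a n)..g (pi - a n)} u) = h u" for u
    proof -
      obtain n where "\<bar>u\<bar> \<le> - g (a n)"
        using grow unfolding filterlim_at_top eventually_sequentially by blast
      then have "h u \<le> (SUP n. h u * indicator {g (a n)..g (pi - a n)} u)"
        by (intro SUP_upper2[of n]) (auto simp: g_refl abs_le_iff split: split_indicator)
      moreover have "(SUP n. h u * indicator {g (a n)..g (pi - a n)} u) \<le> h u"
        by (intro SUP_least) (auto split: split_indicator)
      ultimately show ?thesis by (rule antisym[rotated])
    qed
    then show ?thesis
      using nn_integral_monotone_convergence_SUP[OF inc, of lborel] by simp
  qed
  have lim2: "(SUP n. (\<integral>\<^sup>+\<theta>. h (g \<theta>) * ennreal (v / (sin \<theta>)\<^sup>2) * indicator {a n..pi - a n} \<theta> \<partial>lborel))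
     = (\<integral>\<^sup>+\<theta>. h (g \<theta>) * ennreal (v / (sin \<theta>)\<^sup>2) * indicator {0<..<pi} \<theta> \<partial>lborel)"
  proof -
    let ?k = "\<lambda>\<theta>. h (g \<theta>) * ennreal (v / (sin \<theta>)\<^sup>2)"
    have inc: "incseq (\<lambda>n \<theta>. ?k \<theta> * indicator {a n..pi - a n} \<theta>)"
    proof (rule incseq_SucI, rule le_funI, rule mult_left_mono)
      fix n \<theta>
      show "indicator {a n..pi - a n} \<theta> \<le> (indicator {a (Suc n)..pi - a (Suc n)} \<theta> :: ennreal)"
        using a_dec[of n "Suc n"] by (auto split: split_indicator)
    qed simp
    have "(SUP n. ?k \<theta> * indicator {a n..pi - a n} \<theta>) = ?k \<theta> * indicator {0<..<pi} \<theta>" for \<theta>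
    proof (cases "\<theta> \<in> {0<..<pi}")
      case True
      then have "eventually (\<lambda>n. a n < min \<theta> (pi - \<theta>)) sequentially"
        by (intro order_tendstoD(2)[OF a_lim]) auto
      then obtain n where n: "a n < min \<theta> (pi - \<theta>)" by (auto simp: eventually_sequentially)
      then have "?k \<theta> \<le> (SUP n. ?k \<theta> * indicator {a n..pi - a n} \<theta>)"
        by (intro SUP_upper2[of n]) (auto split: split_indicator)
      moreover have "(SUP n. ?k \<theta> * indicator {a n..pi - a n} \<theta>) \<le> ?k \<theta>"
        by (intro SUP_least) (auto split: split_indicator)
      ultimately show ?thesis using True by (auto intro: antisym)
    next
      case False
      then have "\<theta> \<notin> {a n..pi - a n}" for n using a_pos[of n] by auto
      then show ?thesis using False by simp
    qed
    moreover have "(\<lambda>\<theta>. ?k \<theta> * indicator {a n..pi - a n} \<theta>) \<in> borel_measurable lborel" for n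
      unfolding g_def by measurable
    ultimately show ?thesis
      using nn_integral_monotone_convergence_SUP[OF inc, of lborel] by simp
  qed
  have "(\<integral>\<^sup>+u. f u \<partial>lborel) = (\<integral>\<^sup>+u. h u \<partial>lborel)"
    using nn_integral_real_affine[of f "-1" 0] by (simp add: h_def)
  also have "\<dots> = (\<integral>\<^sup>+\<theta>. h (g \<theta>) * ennreal (v / (sin \<theta>)\<^sup>2) * indicator {0<..<pi} \<theta> \<partial>lborel)"
    unfolding lim1[symmetric] lim2[symmetric] step ..
  finally show ?thesis by (simp add: h_def g_def)
qed

text \<open>
Two one-dimensional substitutions replace the Jacobian in the plane: at fixed height \<open>v\<close> from \<open>u\<close> to the
angle, and then at fixed angle from \<open>v\<close> to the radius \<open>y = v / sin \<theta>\<close>.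
\<close>

lemma nn_integral_polar_half_plane:
  fixes G :: "real \<times> real \<Rightarrow> ennreal"
  assumes [measurable]: "G \<in> borel_measurable (borel \<Otimes>\<^sub>M borel)"
  shows "(\<integral>\<^sup>+\<theta>. (\<integral>\<^sup>+y. G (y * cos \<theta>, y * sin \<theta>) * ennreal y * indicator {0<..} y \<partial>lborel)
              * indicator {0<..<pi} \<theta> \<partial>lborel)
    = (\<integral>\<^sup>+v. (\<integral>\<^sup>+u. G (u, v) \<partial>lborel) * indicator {0<..} v \<partial>lborel)"
proof -
  have [measurable]: "(\<lambda>\<theta>::real. cot \<theta>) \<in> borel_measurable borel" unfolding cot_def by measurable
  let ?k = "\<lambda>v \<theta>. G (v * cot \<theta>, v) * ennreal (v / (sin \<theta>)\<^sup>2) * indicator {0<..<pi} \<theta> * indicator {0<..} v"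
  have "(\<integral>\<^sup>+v. (\<integral>\<^sup>+u. G (u, v) \<partial>lborel) * indicator {0<..} v \<partial>lborel) = (\<integral>\<^sup>+v. (\<integral>\<^sup>+\<theta>. ?k v \<theta> \<partial>lborel) \<partial>lborel)"
  proof (intro nn_integral_cong)
    fix v :: real
    show "(\<integral>\<^sup>+u. G (u, v) \<partial>lborel) * indicator {0<..} v = (\<integral>\<^sup>+\<theta>. ?k v \<theta> \<partial>lborel)"
      using nn_integral_cot_substitution[of "\<lambda>u. G (u, v)" v] by (auto split: split_indicator)
  qed
  also have "\<dots> = (\<integral>\<^sup>+\<theta>. (\<integral>\<^sup>+v. ?k v \<theta> \<partial>lborel) \<partial>lborel)"
    by (rule lborel_pair.Fubini') measurable
  also have "\<dots> = (\<integral>\<^sup>+\<theta>. (\<integral>\<^sup>+y. G (y * cos \<theta>, y * sin \<theta>) * ennreal y * indicator {0<..} y \<partial>lborel)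
              * indicator {0<..<pi} \<theta> \<partial>lborel)"
  proof (intro nn_integral_cong)
    fix \<theta> :: real
    show "(\<integral>\<^sup>+v. ?k v \<theta> \<partial>lborel)
      = (\<integral>\<^sup>+y. G (y * cos \<theta>, y * sin \<theta>) * ennreal y * indicator {0<..} y \<partial>lborel) * indicator {0<..<pi} \<theta>"
    proof (cases "\<theta> \<in> {0<..<pi}")
      case True
      then have s: "sin \<theta> > 0" by (intro sin_gt_zero) auto
      have "(\<integral>\<^sup>+v. G (v * cot \<theta>, v) * ennreal (v / (sin \<theta>)\<^sup>2) * indicator {0<..} v \<partial>lborel)
        = ennreal (sin \<theta>) * (\<integral>\<^sup>+y. G (sin \<theta> * y * cot \<theta>, sin \<theta> * y) * ennreal (sin \<theta> * y / (sin \<theta>)\<^sup>2) * indicator {0<..} (sin \<theta> * y) \<partial>lborel)"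
        using nn_integral_real_affine[of "\<lambda>v. G (v * cot \<theta>, v) * ennreal (v / (sin \<theta>)\<^sup>2) * indicator {0<..} v" "sin \<theta>" 0] s
        by simp
      also have "\<dots> = (\<integral>\<^sup>+y. ennreal (sin \<theta>) * (G (sin \<theta> * y * cot \<theta>, sin \<theta> * y) * ennreal (sin \<theta> * y / (sin \<theta>)\<^sup>2) * indicator {0<..} (sin \<theta> * y)) \<partial>lborel)"
        by (rule nn_integral_cmult[symmetric]) measurable
      also have "\<dots> = (\<integral>\<^sup>+y. G (y * cos \<theta>, y * sin \<theta>) * ennreal y * indicator {0<..} y \<partial>lborel)"
      proof (intro nn_integral_cong)
        fix y :: real
        have e: "ennreal (sin \<theta>) * ennreal (sin \<theta> * y / (sin \<theta>)\<^sup>2) = ennreal y" if "y > 0"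
          using s that by (subst ennreal_mult[symmetric]) (auto simp: power2_eq_square)
        have c: "sin \<theta> * y * cot \<theta> = y * cos \<theta>" using s by (simp add: cot_def)
        show "ennreal (sin \<theta>) * (G (sin \<theta> * y * cot \<theta>, sin \<theta> * y) * ennreal (sin \<theta> * y / (sin \<theta>)\<^sup>2) * indicator {0<..} (sin \<theta> * y))
          = G (y * cos \<theta>, y * sin \<theta>) * ennreal y * indicator {0<..} y"
        proof (cases "y > 0")
          case True
          then have "ennreal (sin \<theta>) * (G (sin \<theta> * y * cot \<theta>, sin \<theta> * y) * ennreal (sin \<theta> * y / (sin \<theta>)\<^sup>2))
             = G (y * cos \<theta>, y * sin \<theta>) * (ennreal (sin \<theta>) * ennreal (sin \<theta> * y / (sin \<theta>)\<^sup>2))"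
            unfolding c by (simp add: mult_ac)
          then show ?thesis using True s e by (simp add: zero_less_mult_iff)
        qed (use s in \<open>simp add: zero_less_mult_iff\<close>)
      qed
      finally show ?thesis using True by simp
    qed simp
  qed
  finally show ?thesis by simp
qed

definition dunkl_weight :: "real \<Rightarrow> real \<Rightarrow> real" where
  "dunkl_weight \<alpha> x = inverse (2 powr (\<alpha> + 1) * Gamma (\<alpha> + 1)) * \<bar>x\<bar> powr (2 * \<alpha> + 1)"

text \<open>
The weighted measure on Borel sets. It has the same integrals of Borel functions as
\<open>dunkl_measure\<close>, whose sets are the Lebesgue sets; products and Fubini's theorem are taken
with the Borel version.
\<close>

definition dunkl_borel :: "real \<Rightarrow> real measure" where
  "dunkl_borel \<alpha> = density lborel (\<lambda>x. ennreal (dunkl_weight \<alpha> x))"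

abbreviation ball_integral :: "real \<Rightarrow> (real \<Rightarrow> real) \<Rightarrow> real \<Rightarrow> real \<Rightarrow> ennreal" where
  "ball_integral \<alpha> h x r \<equiv> (\<integral>\<^sup>+y. ennreal (h y) * indicator (ball x r) y \<partial>dunkl_borel \<alpha>)"

text \<open>
The measure \<open>sin\<^bsup>2\<alpha>\<^esup> \<theta> d\<theta>\<close> over which the translation averages. The end points are left out
so that \<open>sin \<theta>\<close> is positive on the whole support.
\<close>

definition angle_measure :: "real \<Rightarrow> real measure" where
  "angle_measure \<alpha> = density lborel (\<lambda>\<theta>. ennreal (sin \<theta> powr (2 * \<alpha>)) * indicator {0<..<pi} \<theta>)"

lemma ball_real_measurable [measurable]: "ball (c::real) R \<in> sets borel"
  by simp

lemma dunkl_weight_measurable [measurable]: "dunkl_weight \<alpha> \<in> borel_measurable borel"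
  unfolding dunkl_weight_def by measurable

lemma sets_dunkl_borel [measurable_cong, simp]: "sets (dunkl_borel \<alpha>) = sets borel"
  by (simp add: dunkl_borel_def)

lemma sets_angle_measure [measurable_cong, simp]: "sets (angle_measure \<alpha>) = sets borel"
  by (simp add: angle_measure_def)

lemma space_dunkl_borel [simp]: "space (dunkl_borel \<alpha>) = UNIV"
  by (simp add: dunkl_borel_def)

lemma space_angle_measure [simp]: "space (angle_measure \<alpha>) = UNIV"
  by (simp add: angle_measure_def)

lemma dunkl_weight_nonneg: "\<alpha> \<ge> -1/2 \<Longrightarrow> dunkl_weight \<alpha> x \<ge> 0"
  unfolding dunkl_weight_def using Gamma_real_pos[of "\<alpha> + 1"] by auto

lemma sigma_finite_dunkl_borel: "sigma_finite_measure (dunkl_borel \<alpha>)"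
  unfolding dunkl_borel_def by (subst sigma_finite_measure.sigma_finite_iff_density_finite[OF lborel.sigma_finite_measure_axioms]) auto

lemma sigma_finite_angle_measure: "sigma_finite_measure (angle_measure \<alpha>)"
proof -
  have "angle_measure \<alpha> = density lborel (\<lambda>\<theta>. ennreal (sin \<theta> powr (2 * \<alpha>) * indicator {0<..<pi} \<theta>))"
    unfolding angle_measure_def by (intro arg_cong2[where f=density] refl ext) (auto split: split_indicator)
  then show ?thesis by (subst \<open>angle_measure \<alpha> = _\<close>, subst sigma_finite_measure.sigma_finite_iff_density_finite[OF lborel.sigma_finite_measure_axioms]) auto
qed

lemma nn_integral_dunkl_borel:
  assumes [measurable]: "f \<in> borel_measurable borel"
  shows "(\<integral>\<^sup>+x. f x \<partial>dunkl_borel \<alpha>) = (\<integral>\<^sup>+x. ennreal (dunkl_weight \<alpha> x) * f x \<partial>lborel)"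
  unfolding dunkl_borel_def by (subst nn_integral_density) auto

lemma nn_integral_angle_measure:
  assumes [measurable]: "f \<in> borel_measurable borel"
  shows "(\<integral>\<^sup>+\<theta>. f \<theta> \<partial>angle_measure \<alpha>)
    = (\<integral>\<^sup>+\<theta>. ennreal (sin \<theta> powr (2 * \<alpha>)) * indicator {0<..<pi} \<theta> * f \<theta> \<partial>lborel)"
  unfolding angle_measure_def by (subst nn_integral_density) auto

text \<open>
The product of the radial and the angular weight is, up to the factor \<open>y\<close> of polar coordinates, a power of the height
\<open>y sin \<theta>\<close> alone.
\<close>

lemma nn_integral_polar_weighted:
  fixes H :: "real \<times> real \<Rightarrow> ennreal"
  assumes [measurable]: "H \<in> borel_measurable (borel \<Otimes>\<^sub>M borel)" and "\<alpha> \<ge> -1/2"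
  shows "(\<integral>\<^sup>+\<theta>. (\<integral>\<^sup>+y. H (y * cos \<theta>, y * sin \<theta>) * indicator {0<..} y \<partial>dunkl_borel \<alpha>) \<partial>angle_measure \<alpha>)
    = ennreal (dunkl_weight \<alpha> 1) * (\<integral>\<^sup>+v. (\<integral>\<^sup>+u. H (u, v) \<partial>lborel) * ennreal (v powr (2 * \<alpha>)) * indicator {0<..} v \<partial>lborel)"
proof -
  interpret D: sigma_finite_measure "dunkl_borel \<alpha>" by (rule sigma_finite_dunkl_borel)
  let ?G = "\<lambda>p. H p * ennreal (snd p powr (2 * \<alpha>)) * ennreal (dunkl_weight \<alpha> 1)"
  have w: "dunkl_weight \<alpha> y = dunkl_weight \<alpha> 1 * y powr (2 * \<alpha> + 1)" if "y > 0" for y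
    using that by (simp add: dunkl_weight_def)
  have "(\<integral>\<^sup>+\<theta>. (\<integral>\<^sup>+y. H (y * cos \<theta>, y * sin \<theta>) * indicator {0<..} y \<partial>dunkl_borel \<alpha>) \<partial>angle_measure \<alpha>)
    = (\<integral>\<^sup>+\<theta>. ennreal (sin \<theta> powr (2 * \<alpha>)) * indicator {0<..<pi} \<theta> *
        (\<integral>\<^sup>+y. ennreal (dunkl_weight \<alpha> y) * (H (y * cos \<theta>, y * sin \<theta>) * indicator {0<..} y) \<partial>lborel) \<partial>lborel)"
    by (subst nn_integral_angle_measure) (measurable, simp add: nn_integral_dunkl_borel)
  also have "\<dots> = (\<integral>\<^sup>+\<theta>. (\<integral>\<^sup>+y. ?G (y * cos \<theta>, y * sin \<theta>) * ennreal y * indicator {0<..} y \<partial>lborel)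
              * indicator {0<..<pi} \<theta> \<partial>lborel)"
  proof (intro nn_integral_cong)
    fix \<theta> :: real
    show "ennreal (sin \<theta> powr (2 * \<alpha>)) * indicator {0<..<pi} \<theta> *
        (\<integral>\<^sup>+y. ennreal (dunkl_weight \<alpha> y) * (H (y * cos \<theta>, y * sin \<theta>) * indicator {0<..} y) \<partial>lborel)
      = (\<integral>\<^sup>+y. ?G (y * cos \<theta>, y * sin \<theta>) * ennreal y * indicator {0<..} y \<partial>lborel)
              * indicator {0<..<pi} \<theta>"
    proof (cases "\<theta> \<in> {0<..<pi}")
      case True
      then have s: "sin \<theta> > 0" by (intro sin_gt_zero) auto
      have "ennreal (sin \<theta> powr (2 * \<alpha>)) *
        (\<integral>\<^sup>+y. ennreal (dunkl_weight \<alpha> y) * (H (y * cos \<theta>, y * sin \<theta>) * indicator {0<..} y) \<partial>lborel)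
        = (\<integral>\<^sup>+y. ennreal (sin \<theta> powr (2 * \<alpha>)) * (ennreal (dunkl_weight \<alpha> y) * (H (y * cos \<theta>, y * sin \<theta>) * indicator {0<..} y)) \<partial>lborel)"
        by (rule nn_integral_cmult[symmetric]) measurable
      also have "\<dots> = (\<integral>\<^sup>+y. ?G (y * cos \<theta>, y * sin \<theta>) * ennreal y * indicator {0<..} y \<partial>lborel)"
      proof (intro nn_integral_cong)
        fix y :: real
        have "ennreal (sin \<theta> powr (2 * \<alpha>)) * ennreal (dunkl_weight \<alpha> y)
            = ennreal ((y * sin \<theta>) powr (2 * \<alpha>)) * ennreal (dunkl_weight \<alpha> 1) * ennreal y" if "y > 0"
        proof -
          have "(y * sin \<theta>) powr (2 * \<alpha>) * dunkl_weight \<alpha> 1 * y = sin \<theta> powr (2 * \<alpha>) * dunkl_weight \<alpha> y"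
            using that s unfolding w[OF that] by (simp add: powr_add powr_mult)
          moreover have "dunkl_weight \<alpha> 1 \<ge> 0" "dunkl_weight \<alpha> y \<ge> 0"
            using dunkl_weight_nonneg[OF assms(2)] by blast+
          ultimately show ?thesis
            using that by (metis ennreal_mult ennreal_mult' less_imp_le mult_nonneg_nonneg powr_ge_zero)
        qed
        note e = this
        show "ennreal (sin \<theta> powr (2 * \<alpha>)) * (ennreal (dunkl_weight \<alpha> y) * (H (y * cos \<theta>, y * sin \<theta>) * indicator {0<..} y))
          = ?G (y * cos \<theta>, y * sin \<theta>) * ennreal y * indicator {0<..} y"
        proof (cases "y > 0")
          case True
          have "ennreal (sin \<theta> powr (2 * \<alpha>)) * (ennreal (dunkl_weight \<alpha> y) * H (y * cos \<theta>, y * sin \<theta>))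
            = (ennreal (sin \<theta> powr (2 * \<alpha>)) * ennreal (dunkl_weight \<alpha> y)) * H (y * cos \<theta>, y * sin \<theta>)"
            by (simp only: mult.assoc)
          also have "\<dots> = ?G (y * cos \<theta>, y * sin \<theta>) * ennreal y"
            unfolding e[OF True] by (simp add: mult_ac)
          finally show ?thesis using True by simp
        qed simp
      qed
      finally show ?thesis using True by simp
    qed simp
  qed
  also have "\<dots> = (\<integral>\<^sup>+v. (\<integral>\<^sup>+u. ?G (u, v) \<partial>lborel) * indicator {0<..} v \<partial>lborel)"
    by (rule nn_integral_polar_half_plane) measurable
  also have "\<dots> = (\<integral>\<^sup>+v. ennreal (dunkl_weight \<alpha> 1) * ((\<integral>\<^sup>+u. H (u, v) \<partial>lborel) * ennreal (v powr (2 * \<alpha>)) * indicator {0<..} v) \<partial>lborel)"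
    by (intro nn_integral_cong) (simp add: nn_integral_multc mult.assoc, simp add: mult_ac)
  also have "\<dots> = ennreal (dunkl_weight \<alpha> 1) * (\<integral>\<^sup>+v. (\<integral>\<^sup>+u. H (u, v) \<partial>lborel) * ennreal (v powr (2 * \<alpha>)) * indicator {0<..} v \<partial>lborel)"
    by (rule nn_integral_cmult) measurable
  finally show ?thesis .
qed

lemma dunkl_polar_sq: "(dunkl_polar x y \<theta>)\<^sup>2 = (x - y * cos \<theta>)\<^sup>2 + (y * sin \<theta>)\<^sup>2"
  and dunkl_polar_eq: "dunkl_polar x y \<theta> = sqrt ((x - y * cos \<theta>)\<^sup>2 + (y * sin \<theta>)\<^sup>2)"
proof -
  have "(y * sin \<theta>)\<^sup>2 + (y * cos \<theta>)\<^sup>2 = y\<^sup>2"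
    by (simp add: power_mult_distrib flip: distrib_left)
  then have "x\<^sup>2 + y\<^sup>2 - 2 * x * y * cos \<theta> = (x - y * cos \<theta>)\<^sup>2 + (y * sin \<theta>)\<^sup>2"
    by (simp add: power2_diff)
  then show "dunkl_polar x y \<theta> = sqrt ((x - y * cos \<theta>)\<^sup>2 + (y * sin \<theta>)\<^sup>2)"
    by (simp add: dunkl_polar_def)
  then show "(dunkl_polar x y \<theta>)\<^sup>2 = (x - y * cos \<theta>)\<^sup>2 + (y * sin \<theta>)\<^sup>2" by simp
qed

lemma dunkl_polar_nonneg: "dunkl_polar x y \<theta> \<ge> 0"
  by (simp add: dunkl_polar_eq)

lemma dunkl_polar_measurable [measurable]:
  assumes [measurable]: "f \<in> borel_measurable M" "g \<in> borel_measurable M" "h \<in> borel_measurable M"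
  shows "(\<lambda>w. dunkl_polar (f w) (g w) (h w)) \<in> borel_measurable M"
  unfolding dunkl_polar_def by measurable

text \<open>
This is the symmetry behind the duality of translations. The weight \<open>v\<^bsup>2\<alpha>\<^esup> du dv\<close> is invariant
under \<open>u \<mapsto> x - u\<close>. This map exchanges the origin with \<open>(x, 0)\<close>, so it turns the radius \<open>y\<close> into
\<open>(x, y)\<^sub>\<theta>\<close>, and the cosine of the angle at \<open>(x, 0)\<close> into the cosine of the polar angle.
\<close>

lemma nn_integral_dunkl_polar_exchange:
  fixes h :: "real \<times> real \<Rightarrow> ennreal"
  assumes [measurable]: "h \<in> borel_measurable (borel \<Otimes>\<^sub>M borel)" and \<alpha>: "\<alpha> \<ge> -1/2"
  shows "(\<integral>\<^sup>+\<theta>. (\<integral>\<^sup>+y. h (dunkl_polar x y \<theta>, (x - y * cos \<theta>) / dunkl_polar x y \<theta>) * indicator {0<..<r} y \<partial>dunkl_borel \<alpha>) \<partial>angle_measure \<alpha>)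
    = (\<integral>\<^sup>+\<theta>. (\<integral>\<^sup>+z. h (z, cos \<theta>) * indicator {..<r} (dunkl_polar x z \<theta>) * indicator {0<..} z \<partial>dunkl_borel \<alpha>) \<partial>angle_measure \<alpha>)"
proof -
  define H :: "real \<times> real \<Rightarrow> ennreal"
    where "H = (\<lambda>(u, v). indicator {..<r} (sqrt (u\<^sup>2 + v\<^sup>2)) * h (sqrt ((x - u)\<^sup>2 + v\<^sup>2), (x - u) / sqrt ((x - u)\<^sup>2 + v\<^sup>2)))"
  have [measurable]: "H \<in> borel_measurable (borel \<Otimes>\<^sub>M borel)" unfolding H_def by measurable
  define H' where "H' p = H (x - fst p, snd p)" for p
  have [measurable]: "H' \<in> borel_measurable (borel \<Otimes>\<^sub>M borel)" unfolding H'_def by measurable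
  have rad: "sqrt ((y * cos \<theta>)\<^sup>2 + (y * sin \<theta>)\<^sup>2) = y" if "y > 0" for y \<theta> :: real
    using that by (simp add: power_mult_distrib flip: distrib_left)
  have "(\<integral>\<^sup>+\<theta>. (\<integral>\<^sup>+y. h (dunkl_polar x y \<theta>, (x - y * cos \<theta>) / dunkl_polar x y \<theta>) * indicator {0<..<r} y \<partial>dunkl_borel \<alpha>) \<partial>angle_measure \<alpha>)
    = (\<integral>\<^sup>+\<theta>. (\<integral>\<^sup>+y. H (y * cos \<theta>, y * sin \<theta>) * indicator {0<..} y \<partial>dunkl_borel \<alpha>) \<partial>angle_measure \<alpha>)"
    by (intro nn_integral_cong) (auto simp: H_def rad dunkl_polar_eq split: split_indicator)
  also have "\<dots> = ennreal (dunkl_weight \<alpha> 1) * (\<integral>\<^sup>+v. (\<integral>\<^sup>+u. H (u, v) \<partial>lborel) * ennreal (v powr (2 * \<alpha>)) * indicator {0<..} v \<partial>lborel)"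
    by (rule nn_integral_polar_weighted) (use \<alpha> in measurable)
  also have "\<dots> = ennreal (dunkl_weight \<alpha> 1) * (\<integral>\<^sup>+v. (\<integral>\<^sup>+u. H' (u, v) \<partial>lborel) * ennreal (v powr (2 * \<alpha>)) * indicator {0<..} v \<partial>lborel)"
    using nn_integral_real_affine[of "\<lambda>u. H (u, v)" "-1" x for v] by (simp add: H'_def)
  also have "\<dots> = (\<integral>\<^sup>+\<theta>. (\<integral>\<^sup>+y. H' (y * cos \<theta>, y * sin \<theta>) * indicator {0<..} y \<partial>dunkl_borel \<alpha>) \<partial>angle_measure \<alpha>)"
    by (rule nn_integral_polar_weighted[symmetric]) (use \<alpha> in measurable)
  also have "\<dots> = (\<integral>\<^sup>+\<theta>. (\<integral>\<^sup>+z. h (z, cos \<theta>) * indicator {..<r} (dunkl_polar x z \<theta>) * indicator {0<..} z \<partial>dunkl_borel \<alpha>) \<partial>angle_measure \<alpha>)"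
    by (intro nn_integral_cong) (auto simp: H'_def H_def rad dunkl_polar_eq split: split_indicator)
  finally show ?thesis .
qed

section \<open>The measure of a spherical cap\<close>

lemma square_powr: "((s::real)\<^sup>2) powr b = s powr (2 * b)" if "s > 0"
proof -
  have "s\<^sup>2 = s powr 2" using that by (simp add: powr_numeral)
  then show ?thesis by (simp add: powr_powr)
qed

text \<open>
The factor \<open>cos \<theta>\<close> gives \<open>sin\<^bsup>2\<alpha>\<^esup>\<close> an elementary primitive. For negative \<open>\<alpha>\<close> the primitive is
not differentiable at \<open>0\<close>, so the fundamental theorem is used with continuity only at the end points.
\<close>

lemma nn_integral_sin_powr_cos:
  assumes \<alpha>: "\<alpha> > -1/2" and a: "0 < a" "a \<le> pi / 2"
  shows "(\<integral>\<^sup>+\<theta>. ennreal (sin \<theta> powr (2 * \<alpha>) * cos \<theta>) * indicator {0..a} \<theta> \<partial>lborel)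
    = ennreal (sin a powr (2 * \<alpha> + 1) / (2 * \<alpha> + 1))"
proof (rule nn_integral_has_integral_lebesgue')
  show "0 \<le> sin \<theta> powr (2 * \<alpha>) * cos \<theta>" if "\<theta> \<in> {0..a}" for \<theta>
    using that a by (auto intro!: mult_nonneg_nonneg cos_ge_zero)
  let ?F = "\<lambda>\<theta>. sin \<theta> powr (2 * \<alpha> + 1) / (2 * \<alpha> + 1)"
  have "((\<lambda>\<theta>. sin \<theta> powr (2 * \<alpha>) * cos \<theta>) has_integral (?F a - ?F 0)) {0..a}"
  proof (rule fundamental_theorem_of_calculus_interior)
    show "0 \<le> a" using a by simp
    show "continuous_on {0..a} ?F"
      using \<alpha> a by (intro continuous_intros continuous_on_powr') (auto intro!: sin_ge_zero)
    fix \<theta> assume \<theta>: "\<theta> \<in> {0<..<a}"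
    then have "sin \<theta> > 0" using a by (intro sin_gt_zero) auto
    then show "(?F has_vector_derivative sin \<theta> powr (2 * \<alpha>) * cos \<theta>) (at \<theta>)"
      unfolding has_real_derivative_iff_has_vector_derivative[symmetric]
      using \<alpha> by (auto intro!: derivative_eq_intros)
  qed
  then show "((\<lambda>\<theta>. sin \<theta> powr (2 * \<alpha>) * cos \<theta>) has_integral ?F a) {0..a}" by simp
qed

lemma nn_integral_angle_measure_reflect:
  assumes [measurable]: "f \<in> borel_measurable borel"
  shows "(\<integral>\<^sup>+\<theta>. f (pi - \<theta>) \<partial>angle_measure \<alpha>) = (\<integral>\<^sup>+\<theta>. f \<theta> \<partial>angle_measure \<alpha>)"
proof -
  have "(\<integral>\<^sup>+\<theta>. f \<theta> \<partial>angle_measure \<alpha>)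
    = (\<integral>\<^sup>+\<theta>. ennreal (sin \<theta> powr (2 * \<alpha>)) * indicator {0<..<pi} \<theta> * f \<theta> \<partial>lborel)"
    by (rule nn_integral_angle_measure) measurable
  also have "\<dots> = (\<integral>\<^sup>+\<theta>. ennreal (sin (pi - \<theta>) powr (2 * \<alpha>)) * indicator {0<..<pi} (pi - \<theta>) * f (pi - \<theta>) \<partial>lborel)"
    using nn_integral_real_affine[of "\<lambda>\<theta>. ennreal (sin \<theta> powr (2 * \<alpha>)) * indicator {0<..<pi} \<theta> * f \<theta>" "-1" pi] by simp
  also have "\<dots> = (\<integral>\<^sup>+\<theta>. ennreal (sin \<theta> powr (2 * \<alpha>)) * indicator {0<..<pi} \<theta> * f (pi - \<theta>) \<partial>lborel)"
    by (intro nn_integral_cong) (auto split: split_indicator)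
  also have "\<dots> = (\<integral>\<^sup>+\<theta>. f (pi - \<theta>) \<partial>angle_measure \<alpha>)"
    by (rule nn_integral_angle_measure[symmetric]) measurable
  finally show ?thesis ..
qed

lemma emeasure_angle_cap:
  fixes e :: real
  shows "emeasure (angle_measure \<alpha>) {\<theta>. 1 - cos \<theta> < e}
    = (\<integral>\<^sup>+\<theta>. ennreal (sin \<theta> powr (2 * \<alpha>)) * indicator {0<..<pi} \<theta> * indicator {..<e} (1 - cos \<theta>) \<partial>lborel)"
proof -
  have "emeasure (angle_measure \<alpha>) {\<theta>. 1 - cos \<theta> < e}
    = (\<integral>\<^sup>+\<theta>. indicator {\<theta>. 1 - cos \<theta> < e} \<theta> \<partial>angle_measure \<alpha>)"
    by (intro nn_integral_indicator[symmetric]) simp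
  also have "\<dots> = (\<integral>\<^sup>+\<theta>. indicator {..<e} (1 - cos \<theta>) \<partial>angle_measure \<alpha>)"
    by (intro nn_integral_cong) (auto split: split_indicator)
  also have "\<dots> = (\<integral>\<^sup>+\<theta>. ennreal (sin \<theta> powr (2 * \<alpha>)) * indicator {0<..<pi} \<theta> * indicator {..<e} (1 - cos \<theta>) \<partial>lborel)"
    by (rule nn_integral_angle_measure) measurable
  finally show ?thesis .
qed

lemma sin_arccos_one_minus:
  assumes "0 < e" "e \<le> 1"
  shows "0 < arccos (1 - e)" "arccos (1 - e) \<le> pi / 2" "cos (arccos (1 - e)) = 1 - e"
    "sin (arccos (1 - e)) > 0" "(sin (arccos (1 - e)))\<^sup>2 = e * (2 - e)"
proof -
  show "0 < arccos (1 - e)"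
    using arccos_less_arccos[of "1 - e" 1] assms by simp
  show "arccos (1 - e) \<le> pi / 2"
    using arccos_le_arccos[of 0 "1 - e"] assms by simp
  show "cos (arccos (1 - e)) = 1 - e" using assms by (intro cos_arccos) auto
  have "sin (arccos (1 - e)) = sqrt (e * (2 - e))"
    using assms by (subst sin_arccos) (auto simp: power2_eq_square algebra_simps)
  then show "sin (arccos (1 - e)) > 0" "(sin (arccos (1 - e)))\<^sup>2 = e * (2 - e)"
    using assms by auto
qed

text \<open>
On a cap of height at most \<open>1/2\<close> the cosine is at least \<open>1/2\<close>, so inserting \<open>cos \<theta>\<close> into the integral
costs a factor \<open>2\<close> and makes it elementary.
\<close>

lemma emeasure_angle_cap_le:
  assumes \<alpha>: "\<alpha> > -1/2" and e: "0 < e" "e \<le> 1/2"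
  shows "emeasure (angle_measure \<alpha>) {\<theta>. 1 - cos \<theta> < e} \<le> ennreal (2 * (2 * e) powr (\<alpha> + 1/2) / (2 * \<alpha> + 1))"
proof -
  define a where "a = arccos (1 - e)"
  note a = sin_arccos_one_minus[of e, folded a_def]
  have "emeasure (angle_measure \<alpha>) {\<theta>. 1 - cos \<theta> < e}
     \<le> (\<integral>\<^sup>+\<theta>. 2 * (ennreal (sin \<theta> powr (2 * \<alpha>) * cos \<theta>) * indicator {0..a} \<theta>) \<partial>lborel)"
    unfolding emeasure_angle_cap
  proof (rule nn_integral_mono)
    fix \<theta> :: real
    show "ennreal (sin \<theta> powr (2 * \<alpha>)) * indicator {0<..<pi} \<theta> * indicator {..<e} (1 - cos \<theta>)
      \<le> 2 * (ennreal (sin \<theta> powr (2 * \<alpha>) * cos \<theta>) * indicator {0..a} \<theta>)"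
    proof (cases "\<theta> \<in> {0<..<pi} \<and> 1 - cos \<theta> < e")
      case True
      then have "cos \<theta> > cos a" using a e by simp
      moreover have "\<not> a < \<theta>"
        using cos_monotone_0_pi[of a \<theta>] a e True \<open>cos \<theta> > cos a\<close> by auto
      ultimately have "\<theta> \<le> a" by simp
      have "sin \<theta> powr (2 * \<alpha>) * 1 \<le> sin \<theta> powr (2 * \<alpha>) * (2 * cos \<theta>)"
        using True e by (intro mult_left_mono) auto
      then have "ennreal (sin \<theta> powr (2 * \<alpha>)) \<le> ennreal (2 * (sin \<theta> powr (2 * \<alpha>) * cos \<theta>))"
        by (intro ennreal_leI) (simp add: mult_ac)
      moreover have "0 \<le> sin \<theta> powr (2 * \<alpha>) * cos \<theta>" using True e by (intro mult_nonneg_nonneg) auto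
      ultimately show ?thesis using True \<open>\<theta> \<le> a\<close> by (simp add: numeral_mult_ennreal)
    qed (auto split: split_indicator)
  qed
  also have "\<dots> = 2 * ennreal (sin a powr (2 * \<alpha> + 1) / (2 * \<alpha> + 1))"
    using a e nn_integral_sin_powr_cos[OF \<alpha>, of a] by (subst nn_integral_cmult) auto
  also have "\<dots> = ennreal (2 * sin a powr (2 * \<alpha> + 1) / (2 * \<alpha> + 1))"
    using \<alpha> by (subst numeral_mult_ennreal) auto
  also have "\<dots> \<le> ennreal (2 * (2 * e) powr (\<alpha> + 1/2) / (2 * \<alpha> + 1))"
  proof -
    have "sin a powr (2 * \<alpha> + 1) = ((sin a)\<^sup>2) powr (\<alpha> + 1/2)"
      using square_powr[OF a(4), of "\<alpha> + 1/2"] e by simp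
    also have "\<dots> \<le> (2 * e) powr (\<alpha> + 1/2)"
      using a(5) e \<alpha> by (intro powr_mono2) (auto simp: right_diff_distrib)
    finally show ?thesis using \<alpha> by (intro ennreal_leI divide_right_mono mult_left_mono) auto
  qed
  finally show ?thesis .
qed

lemma emeasure_angle_cap_ge:
  assumes \<alpha>: "\<alpha> > -1/2" and e: "0 < e" "e \<le> 1"
  shows "emeasure (angle_measure \<alpha>) {\<theta>. 1 - cos \<theta> < e} \<ge> ennreal (e powr (\<alpha> + 1/2) / (2 * \<alpha> + 1))"
proof -
  define a where "a = arccos (1 - e)"
  note a = sin_arccos_one_minus[OF e, folded a_def]
  have "ennreal (e powr (\<alpha> + 1/2) / (2 * \<alpha> + 1)) \<le> ennreal (sin a powr (2 * \<alpha> + 1) / (2 * \<alpha> + 1))"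
  proof -
    have "e powr (\<alpha> + 1/2) \<le> ((sin a)\<^sup>2) powr (\<alpha> + 1/2)"
      unfolding a(5) using e \<alpha> mult_left_mono[of 1 "2 - e" e] by (intro powr_mono2) auto
    also have "\<dots> = sin a powr (2 * \<alpha> + 1)"
      using square_powr[OF a(4), of "\<alpha> + 1/2"] by simp
    finally show ?thesis using \<alpha> by (intro ennreal_leI divide_right_mono) auto
  qed
  also have "\<dots> = (\<integral>\<^sup>+\<theta>. ennreal (sin \<theta> powr (2 * \<alpha>) * cos \<theta>) * indicator {0..a} \<theta> \<partial>lborel)"
    using a nn_integral_sin_powr_cos[OF \<alpha>, of a] by simp
  also have "\<dots> \<le> emeasure (angle_measure \<alpha>) {\<theta>. 1 - cos \<theta> < e}"
    unfolding emeasure_angle_cap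
  proof (rule nn_integral_mono_AE)
    have "AE \<theta> in lborel. \<theta> \<noteq> 0 \<and> \<theta> \<noteq> a"
      by (auto intro: AE_lborel_singleton)
    then show "AE \<theta> in lborel. ennreal (sin \<theta> powr (2 * \<alpha>) * cos \<theta>) * indicator {0..a} \<theta>
      \<le> ennreal (sin \<theta> powr (2 * \<alpha>)) * indicator {0<..<pi} \<theta> * indicator {..<e} (1 - cos \<theta>)"
    proof eventually_elim
      fix \<theta> :: real assume n: "\<theta> \<noteq> 0 \<and> \<theta> \<noteq> a"
      show "ennreal (sin \<theta> powr (2 * \<alpha>) * cos \<theta>) * indicator {0..a} \<theta>
        \<le> ennreal (sin \<theta> powr (2 * \<alpha>)) * indicator {0<..<pi} \<theta> * indicator {..<e} (1 - cos \<theta>)"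
      proof (cases "\<theta> \<in> {0..a}")
        case True
        then have r: "0 < \<theta>" "\<theta> < a" "\<theta> < pi" using n a(1,2) pi_gt_zero by auto
        have "cos a < cos \<theta>" using r a(2) pi_gt_zero by (intro cos_monotone_0_pi) auto
        then have "1 - cos \<theta> < e" using a by simp
        moreover have "sin \<theta> powr (2 * \<alpha>) * cos \<theta> \<le> sin \<theta> powr (2 * \<alpha>) * 1"
          by (intro mult_left_mono) auto
        ultimately show ?thesis using r True by (simp add: ennreal_leI)
      qed simp
    qed
  qed
  finally show ?thesis .
qed

text \<open>
Near the poles the measure is that of two caps; away from them \<open>sin \<theta> \<ge> 1/2\<close>, so that \<open>sin\<^bsup>2\<alpha>\<^esup> \<theta>\<close> is
bounded whatever the sign of \<open>\<alpha>\<close>.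
\<close>

lemma emeasure_angle_finite:
  assumes \<alpha>: "\<alpha> > -1/2"
  shows "emeasure (angle_measure \<alpha>) UNIV < \<infinity>"
proof -
  let ?A = "{\<theta>::real. 1 - cos \<theta> < 1/2}" and ?B = "{\<theta>::real. 1 - cos (pi - \<theta>) < 1/2}"
  have [measurable]: "?A \<in> sets borel" "?B \<in> sets borel" by measurable
  have A: "emeasure (angle_measure \<alpha>) ?A < \<infinity>"
    using emeasure_angle_cap_le[OF \<alpha>, of "1/2"] by (auto intro: le_less_trans)
  have "emeasure (angle_measure \<alpha>) ?B = (\<integral>\<^sup>+\<theta>. indicator ?A (pi - \<theta>) \<partial>angle_measure \<alpha>)"
  proof -
    have "emeasure (angle_measure \<alpha>) ?B = (\<integral>\<^sup>+\<theta>. indicator ?B \<theta> \<partial>angle_measure \<alpha>)"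
      by (rule nn_integral_indicator[symmetric]) simp
    also have "\<dots> = (\<integral>\<^sup>+\<theta>. indicator ?A (pi - \<theta>) \<partial>angle_measure \<alpha>)"
      by (intro nn_integral_cong) (simp only: indicator_def mem_Collect_eq)
    finally show ?thesis .
  qed
  also have "\<dots> = (\<integral>\<^sup>+\<theta>. indicator ?A \<theta> \<partial>angle_measure \<alpha>)"
    by (rule nn_integral_angle_measure_reflect) measurable
  also have "\<dots> = emeasure (angle_measure \<alpha>) ?A" by simp
  finally have B: "emeasure (angle_measure \<alpha>) ?B < \<infinity>" using A by simp
  have "emeasure (angle_measure \<alpha>) (- (?A \<union> ?B))
    = (\<integral>\<^sup>+\<theta>. ennreal (sin \<theta> powr (2 * \<alpha>)) * indicator {0<..<pi} \<theta> * indicator (- (?A \<union> ?B)) \<theta> \<partial>lborel)"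
    by (subst nn_integral_angle_measure[symmetric]) auto
  also have "\<dots> \<le> (\<integral>\<^sup>+\<theta>. 2 * indicator {0<..<pi} \<theta> \<partial>lborel)"
  proof (rule nn_integral_mono)
    fix \<theta> :: real
    have "sin \<theta> powr (2 * \<alpha>) \<le> 2" if \<theta>: "\<theta> \<in> {0<..<pi}" "\<theta> \<notin> ?A \<union> ?B"
    proof -
      have s: "sin \<theta> > 0" using \<theta> by (intro sin_gt_zero) auto
      have "cos \<theta> \<le> 1/2" "- (1/2) \<le> cos \<theta>" using \<theta> by (auto simp: cos_diff)
      then have "(cos \<theta>)\<^sup>2 \<le> (1/2)\<^sup>2"
        by (intro abs_le_square_iff[THEN iffD1]) auto
      then have "(sin \<theta>)\<^sup>2 \<ge> (1/2)\<^sup>2" using sin_cos_squared_add[of \<theta>] by (simp add: power2_eq_square)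
      then have half: "sin \<theta> \<ge> 1/2" using s by (intro power2_le_imp_le[of "1/2"]) auto
      show ?thesis
      proof (cases "\<alpha> \<ge> 0")
        case True
        then have "sin \<theta> powr (2 * \<alpha>) \<le> 1 powr (2 * \<alpha>)" using s by (intro powr_mono2) auto
        then show ?thesis by simp
      next
        case False
        have "sin \<theta> powr (2 * \<alpha>) \<le> (1/2) powr (2 * \<alpha>)"
          using False half by (intro powr_mono2') auto
        also have "\<dots> \<le> (1/2) powr (-1)" using \<alpha> by (intro powr_mono') auto
        finally show ?thesis by (simp add: powr_minus)
      qed
    qed
    then show "ennreal (sin \<theta> powr (2 * \<alpha>)) * indicator {0<..<pi} \<theta> * indicator (- (?A \<union> ?B)) \<theta> \<le> 2 * indicator {0<..<pi} \<theta>"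
      by (auto split: split_indicator simp: ennreal_le_iff2 simp flip: ennreal_numeral)
  qed
  also have "\<dots> < \<infinity>"
    by (subst nn_integral_cmult) (auto simp: ennreal_mult_less_top)
  finally have C: "emeasure (angle_measure \<alpha>) (- (?A \<union> ?B)) < \<infinity>" .
  have "UNIV = (?A \<union> ?B) \<union> - (?A \<union> ?B)" by blast
  then have "emeasure (angle_measure \<alpha>) UNIV \<le> emeasure (angle_measure \<alpha>) (?A \<union> ?B) + emeasure (angle_measure \<alpha>) (- (?A \<union> ?B))"
    using emeasure_subadditive[of "?A \<union> ?B" "angle_measure \<alpha>" "- (?A \<union> ?B)"] by simp
  also have "\<dots> \<le> emeasure (angle_measure \<alpha>) ?A + emeasure (angle_measure \<alpha>) ?B + emeasure (angle_measure \<alpha>) (- (?A \<union> ?B))"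
    by (intro add_right_mono emeasure_subadditive) auto
  also have "\<dots> < \<infinity>" using A B C by simp
  finally show ?thesis .
qed

lemma dunkl_const_mult_angle:
  assumes \<alpha>: "\<alpha> > -1/2"
  shows "dunkl_const \<alpha> > 0" "ennreal (dunkl_const \<alpha>) * emeasure (angle_measure \<alpha>) UNIV = 1"
proof -
  have [measurable]: "(\<lambda>\<theta>. indicator {0..pi} \<theta> *\<^sub>R sin \<theta> powr (2 * \<alpha>)) \<in> borel_measurable borel"
    by measurable
  have "(LINT \<theta>:{0..pi}|lebesgue. sin \<theta> powr (2 * \<alpha>)) = (LINT \<theta>|lborel. indicator {0..pi} \<theta> *\<^sub>R sin \<theta> powr (2 * \<alpha>))"
    unfolding set_lebesgue_integral_def by (rule integral_completion) measurable
  also have "\<dots> = enn2real (\<integral>\<^sup>+\<theta>. ennreal (indicator {0..pi} \<theta> *\<^sub>R sin \<theta> powr (2 * \<alpha>)) \<partial>lborel)"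
    by (rule integral_eq_nn_integral) auto
  also have "(\<integral>\<^sup>+\<theta>. ennreal (indicator {0..pi} \<theta> *\<^sub>R sin \<theta> powr (2 * \<alpha>)) \<partial>lborel)
    = (\<integral>\<^sup>+\<theta>. ennreal (sin \<theta> powr (2 * \<alpha>)) * indicator {0<..<pi} \<theta> * 1 \<partial>lborel)"
    by (intro nn_integral_cong) (auto split: split_indicator simp: less_le)
  also have "\<dots> = emeasure (angle_measure \<alpha>) UNIV"
    by (subst nn_integral_angle_measure[symmetric]) auto
  finally have c: "dunkl_const \<alpha> = inverse (enn2real (emeasure (angle_measure \<alpha>) UNIV))"
    by (simp add: dunkl_const_def)
  have "0 < ennreal (1 / (2 * \<alpha> + 1))" using \<alpha> by simp
  also have "\<dots> \<le> emeasure (angle_measure \<alpha>) {\<theta>. 1 - cos \<theta> < 1}"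
    using emeasure_angle_cap_ge[OF \<alpha>, of 1] by simp
  also have "\<dots> \<le> emeasure (angle_measure \<alpha>) UNIV" by (intro emeasure_mono) auto
  finally have p: "0 < emeasure (angle_measure \<alpha>) UNIV" .
  then obtain w where w: "emeasure (angle_measure \<alpha>) UNIV = ennreal w" "w > 0"
    using emeasure_angle_finite[OF \<alpha>] by (cases "emeasure (angle_measure \<alpha>) UNIV") auto
  show "dunkl_const \<alpha> > 0" using w unfolding c by simp
  show "ennreal (dunkl_const \<alpha>) * emeasure (angle_measure \<alpha>) UNIV = 1"
    using w unfolding c by (simp add: ennreal_mult[symmetric])
qed

section \<open>Translates of even functions and of balls\<close>

text \<open>
For even \<open>h\<close> the part of the translation formula with the difference \<open>h(z) - h(- z)\<close> vanishes, and what remains is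
positive; it makes sense for functions with values in \<open>[0, \<infinity>]\<close>, where Tonelli's theorem
applies. Only the values of \<open>h\<close> on \<open>[0, \<infinity>)\<close> enter.
\<close>

definition even_translation :: "real \<Rightarrow> real \<Rightarrow> (real \<Rightarrow> ennreal) \<Rightarrow> real \<Rightarrow> ennreal" where
  "even_translation \<alpha> x h y = (if \<alpha> = -1/2 then h \<bar>x + y\<bar>
     else ennreal (dunkl_const \<alpha>) * (\<integral>\<^sup>+\<theta>. h (dunkl_polar x y \<theta>) * ennreal (1 - cos \<theta>) \<partial>angle_measure \<alpha>))"

abbreviation ball_translation :: "real \<Rightarrow> real \<Rightarrow> real \<Rightarrow> real \<Rightarrow> ennreal" where
  "ball_translation \<alpha> x r \<equiv> even_translation \<alpha> x (indicator {..<r})"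

lemma even_translation_measurable:
  assumes h: "(\<lambda>(w, t). h w t) \<in> borel_measurable (M \<Otimes>\<^sub>M borel)"
    and [measurable]: "f \<in> borel_measurable M" "g \<in> borel_measurable M"
  shows "(\<lambda>w. even_translation \<alpha> (f w) (h w) (g w)) \<in> borel_measurable M"
proof -
  interpret A: sigma_finite_measure "angle_measure \<alpha>" by (rule sigma_finite_angle_measure)
  have 1: "(\<lambda>w. h w \<bar>f w + g w\<bar>) \<in> borel_measurable M"
    using measurable_compose[OF _ h, of "\<lambda>w. (w, \<bar>f w + g w\<bar>)" M] by simp
  have 2: "(\<lambda>(w, \<theta>). h w (dunkl_polar (f w) (g w) \<theta>)) \<in> borel_measurable (M \<Otimes>\<^sub>M angle_measure \<alpha>)"
    using measurable_compose[OF _ h, of "\<lambda>(w, \<theta>). (w, dunkl_polar (f w) (g w) \<theta>)" "M \<Otimes>\<^sub>M angle_measure \<alpha>"]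
    by (simp add: case_prod_beta')
  have 3: "(\<lambda>(w, \<theta>). h w (dunkl_polar (f w) (g w) \<theta>) * ennreal (1 - cos \<theta>)) \<in> borel_measurable (M \<Otimes>\<^sub>M angle_measure \<alpha>)"
    using 2 unfolding case_prod_beta' by measurable
  show ?thesis
    unfolding even_translation_def
    using 1 A.borel_measurable_nn_integral[OF 3] by (cases "\<alpha> = -1/2") auto
qed

lemma even_translation_mono:
  assumes "\<And>t. t \<ge> 0 \<Longrightarrow> h t \<le> k t"
  shows "even_translation \<alpha> x h y \<le> even_translation \<alpha> x k y"
  unfolding even_translation_def using assms
  by (auto intro!: mult_left_mono nn_integral_mono mult_right_mono dunkl_polar_nonneg)

text \<open>
Translation commutes with superposition. This reduces the translates of radial functions to those of balls.
\<close>

lemma even_translation_nn_integral: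
  assumes k: "(\<lambda>(s, t). k s t) \<in> borel_measurable (M \<Otimes>\<^sub>M borel)" and M: "sigma_finite_measure M"
  shows "even_translation \<alpha> x (\<lambda>t. \<integral>\<^sup>+s. k s t \<partial>M) y = (\<integral>\<^sup>+s. even_translation \<alpha> x (k s) y \<partial>M)"
proof (cases "\<alpha> = -1/2")
  case False
  interpret M: sigma_finite_measure M by (rule M)
  interpret A: sigma_finite_measure "angle_measure \<alpha>" by (rule sigma_finite_angle_measure)
  interpret P: pair_sigma_finite M "angle_measure \<alpha>" ..
  have 2: "(\<lambda>(s, \<theta>). k s (dunkl_polar x y \<theta>)) \<in> borel_measurable (M \<Otimes>\<^sub>M angle_measure \<alpha>)"
    using measurable_compose[OF _ k, of "\<lambda>(s, \<theta>). (s, dunkl_polar x y \<theta>)" "M \<Otimes>\<^sub>M angle_measure \<alpha>"]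
    by (simp add: case_prod_beta')
  have 3: "(\<lambda>(s, \<theta>). k s (dunkl_polar x y \<theta>) * ennreal (1 - cos \<theta>)) \<in> borel_measurable (M \<Otimes>\<^sub>M angle_measure \<alpha>)"
    using 2 unfolding case_prod_beta' by measurable
  have 4: "(\<lambda>s. k s t) \<in> borel_measurable M" for t
    using measurable_compose[OF _ k, of "\<lambda>s. (s, t)" M] by simp
  have "(\<integral>\<^sup>+\<theta>. (\<integral>\<^sup>+s. k s (dunkl_polar x y \<theta>) \<partial>M) * ennreal (1 - cos \<theta>) \<partial>angle_measure \<alpha>)
    = (\<integral>\<^sup>+\<theta>. (\<integral>\<^sup>+s. k s (dunkl_polar x y \<theta>) * ennreal (1 - cos \<theta>) \<partial>M) \<partial>angle_measure \<alpha>)"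
    by (intro nn_integral_cong nn_integral_multc[symmetric] 4)
  also have "\<dots> = (\<integral>\<^sup>+s. (\<integral>\<^sup>+\<theta>. k s (dunkl_polar x y \<theta>) * ennreal (1 - cos \<theta>) \<partial>angle_measure \<alpha>) \<partial>M)"
    using P.Fubini'[OF 3] by simp
  finally show ?thesis
    using False A.borel_measurable_nn_integral[OF 3]
    by (simp add: even_translation_def nn_integral_cmult)
qed (simp add: even_translation_def)

lemma dunkl_polar_sq_diff: "(dunkl_polar x y \<theta>)\<^sup>2 = (x - y)\<^sup>2 + 2 * (x * y) * (1 - cos \<theta>)"
  "(dunkl_polar x y \<theta>)\<^sup>2 = (x + y)\<^sup>2 - 2 * (x * y) * (1 + cos \<theta>)"
proof -
  have "(y * sin \<theta>)\<^sup>2 + (y * cos \<theta>)\<^sup>2 = y\<^sup>2"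
    by (simp add: power_mult_distrib flip: distrib_left)
  then have "(dunkl_polar x y \<theta>)\<^sup>2 = x\<^sup>2 + y\<^sup>2 - 2 * x * y * cos \<theta>"
    unfolding dunkl_polar_sq by (simp add: power2_diff)
  then show "(dunkl_polar x y \<theta>)\<^sup>2 = (x - y)\<^sup>2 + 2 * (x * y) * (1 - cos \<theta>)"
    "(dunkl_polar x y \<theta>)\<^sup>2 = (x + y)\<^sup>2 - 2 * (x * y) * (1 + cos \<theta>)"
    by (auto simp: power2_eq_square algebra_simps)
qed

lemma dunkl_polar_ge: "\<bar>\<bar>x\<bar> - \<bar>y\<bar>\<bar> \<le> dunkl_polar x y \<theta>"
proof (rule power2_le_imp_le[OF _ dunkl_polar_nonneg])
  have "(\<bar>\<bar>x\<bar> - \<bar>y\<bar>\<bar>)\<^sup>2 = x\<^sup>2 + y\<^sup>2 - 2 * \<bar>x * y\<bar>"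
    by (simp add: power2_eq_square algebra_simps abs_mult)
  also have "\<dots> \<le> (dunkl_polar x y \<theta>)\<^sup>2"
  proof (cases "x * y \<ge> 0")
    case True
    then have "2 * (x * y) * (1 - cos \<theta>) \<ge> 0"
      using cos_le_one[of \<theta>] by (intro mult_nonneg_nonneg[of "2 * (x * y)"]) linarith+
    then show ?thesis unfolding dunkl_polar_sq_diff(1) using True by (simp only: abs_of_nonneg power2_diff)
  next
    case False
    then have "2 * (x * y) * (1 + cos \<theta>) \<le> 0"
      using cos_ge_minus_one[of \<theta>] False by (intro mult_nonpos_nonneg[of "2 * (x * y)"]) linarith+
    moreover have "\<bar>x * y\<bar> = - (x * y)" using False by simp
    ultimately show ?thesis unfolding dunkl_polar_sq_diff(2) by (simp only: power2_sum)
  qed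
  finally show "(\<bar>\<bar>x\<bar> - \<bar>y\<bar>\<bar>)\<^sup>2 \<le> (dunkl_polar x y \<theta>)\<^sup>2" .
qed

lemma ball_translation_eq_0:
  assumes "r \<le> \<bar>\<bar>x\<bar> - \<bar>y\<bar>\<bar>"
  shows "ball_translation \<alpha> x r y = 0"
proof -
  have "indicator {..<r} (dunkl_polar x y \<theta>) = (0::ennreal)" for \<theta>
    using dunkl_polar_ge[of x y \<theta>] assms by simp
  moreover have "r \<le> \<bar>x + y\<bar>" using assms by linarith
  ultimately show ?thesis by (simp add: even_translation_def)
qed

text \<open>
The factor \<open>1 - cos \<theta>\<close> is at most \<open>2\<close>, and the normalized angle measure has mass \<open>1\<close>.
\<close>

lemma ball_translation_le_2:
  assumes "\<alpha> \<ge> -1/2" shows "ball_translation \<alpha> x r y \<le> 2"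
proof (cases "\<alpha> = -1/2")
  case False
  then have \<alpha>: "\<alpha> > -1/2" using assms by simp
  have "(\<integral>\<^sup>+\<theta>. indicator {..<r} (dunkl_polar x y \<theta>) * ennreal (1 - cos \<theta>) \<partial>angle_measure \<alpha>)
      \<le> (\<integral>\<^sup>+\<theta>. 2 \<partial>angle_measure \<alpha>)"
    using cos_ge_minus_one by (intro nn_integral_mono) (auto split: split_indicator simp: ennreal_le_iff2 simp flip: ennreal_numeral)
  also have "\<dots> = 2 * emeasure (angle_measure \<alpha>) UNIV" by simp
  finally have "ball_translation \<alpha> x r y \<le> ennreal (dunkl_const \<alpha>) * (2 * emeasure (angle_measure \<alpha>) UNIV)"
    using False by (simp add: even_translation_def mult_left_mono)
  also have "\<dots> = 2 * (ennreal (dunkl_const \<alpha>) * emeasure (angle_measure \<alpha>) UNIV)"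
    by (simp only: mult_ac)
  also have "\<dots> = 2" using dunkl_const_mult_angle(2)[OF \<alpha>] by simp
  finally show ?thesis .
qed (auto simp: even_translation_def split: split_indicator)

text \<open>
If \<open>r\<close> is small against \<open>\<bar>x\<bar>\<close>, then \<open>(x, y)\<^sub>\<theta> < r\<close> confines \<open>\<theta>\<close> to a cap of height \<open>(r / \<bar>x\<bar>)\<^sup>2\<close> around
\<open>0\<close> or \<open>\<pi>\<close>, according to the sign of \<open>x y\<close>, and such a cap has measure of order
\<open>(r / \<bar>x\<bar>)\<^bsup>2\<alpha> + 1\<^esup>\<close>. For other \<open>r\<close> the bound by \<open>2\<close> is enough.
\<close>

lemma ball_translation_upper:
  assumes "\<alpha> \<ge> -1/2"
  obtains C where "C > 0" "\<And>x r y. r > 0 \<Longrightarrow> ball_translation \<alpha> x r y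
     \<le> ennreal (C * (r / (\<bar>x\<bar> + r)) powr (2 * \<alpha> + 1)) * indicator {y. \<bar>\<bar>x\<bar> - \<bar>y\<bar>\<bar> < r} y"
proof (cases "\<alpha> = -1/2")
  case True
  have "ball_translation \<alpha> x r y
     \<le> ennreal (1 * (r / (\<bar>x\<bar> + r)) powr (2 * \<alpha> + 1)) * indicator {y. \<bar>\<bar>x\<bar> - \<bar>y\<bar>\<bar> < r} y" if "r > 0" for x r y
    using True that by (auto simp: even_translation_def powr_zero_eq_one split: split_indicator)
  then show ?thesis by (intro that[of 1]) auto
next
  case False
  then have \<alpha>: "\<alpha> > -1/2" using assms by simp
  define k where "k = 2 * \<alpha> + 1"
  have k: "k > 0" using \<alpha> by (simp add: k_def)
  \<comment> \<open>The first entry serves \<open>\<bar>x\<bar> \<le> 2 r\<close>, where \<open>r / (\<bar>x\<bar> + r) \<ge> 1/3\<close>; the second comes from the cap, where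
    \<open>r / \<bar>x\<bar> \<le> 2 r / (\<bar>x\<bar> + r)\<close>.\<close>
  define C where "C = max (2 * 3 powr k) (dunkl_const \<alpha> * (4 * (2 powr (k/2) / k)) * 2 powr k)"
  have C: "C > 0" unfolding C_def by (simp add: less_max_iff_disj)
  have "ball_translation \<alpha> x r y \<le> ennreal (C * (r / (\<bar>x\<bar> + r)) powr k) * indicator {y. \<bar>\<bar>x\<bar> - \<bar>y\<bar>\<bar> < r} y"
    if r: "r > 0" for x r y
  proof (cases "\<bar>\<bar>x\<bar> - \<bar>y\<bar>\<bar> < r")
    case near: True
    show ?thesis
    proof (cases "r \<ge> \<bar>x\<bar> / 2")
      case True
      then have "1/3 \<le> r / (\<bar>x\<bar> + r)" using r by (simp add: field_simps)
      then have "(1/3) powr k \<le> (r / (\<bar>x\<bar> + r)) powr k" using k by (intro powr_mono2) auto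
      then have "(2 * 3 powr k) * (1/3) powr k \<le> C * (r / (\<bar>x\<bar> + r)) powr k"
        using C by (intro mult_mono) (auto simp: C_def)
      then have "2 \<le> C * (r / (\<bar>x\<bar> + r)) powr k" by (simp add: powr_divide)
      then have "ennreal 2 \<le> ennreal (C * (r / (\<bar>x\<bar> + r)) powr k)" by (rule ennreal_leI)
      then show ?thesis using order_trans[OF ball_translation_le_2[OF assms, of x r y]] near by simp
    next
      case False
      define e where "e = (r / \<bar>x\<bar>)\<^sup>2"
      have x: "\<bar>x\<bar> > 0" using False r by auto
      have lt: "r / \<bar>x\<bar> < 1/2" using False x by (simp add: field_simps)
      have gt: "r / \<bar>x\<bar> > 0" using r x by simp
      have "(r / \<bar>x\<bar>)\<^sup>2 \<le> (1/2)\<^sup>2" by (rule power_mono) (use lt gt in linarith)+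
      moreover have "(1/2::real)\<^sup>2 \<le> 1/2" by (simp add: power2_eq_square)
      ultimately have e: "e \<le> 1/2" unfolding e_def by linarith
      have "e > 0" unfolding e_def using gt by (rule zero_less_power)
      note e = this e
      have y: "\<bar>y\<bar> > \<bar>x\<bar> / 2" using near False by linarith
      have xy: "x\<^sup>2 \<le> 2 * \<bar>x * y\<bar>"
        using mult_left_mono[of "\<bar>x\<bar>" "2 * \<bar>y\<bar>" "\<bar>x\<bar>"] y by (simp add: power2_eq_square abs_mult)
      let ?A = "{\<theta>. 1 - cos \<theta> < e}"
      have cap: "1 - sgn (x * y) * cos \<theta> < e" if "dunkl_polar x y \<theta> < r" for \<theta>
      proof -
        have "(dunkl_polar x y \<theta>)\<^sup>2 < r\<^sup>2"
          using that dunkl_polar_nonneg r by (intro power_strict_mono) auto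
        moreover have "2 * \<bar>x * y\<bar> * (1 - sgn (x * y) * cos \<theta>) \<le> (dunkl_polar x y \<theta>)\<^sup>2"
        proof (cases "x * y > 0")
          case True then show ?thesis unfolding dunkl_polar_sq_diff(1) by simp
        next
          case False
          moreover have "x * y \<noteq> 0" using x y by auto
          ultimately have "x * y < 0" by linarith
          then show ?thesis unfolding dunkl_polar_sq_diff(2) by (simp add: algebra_simps)
        qed
        moreover have "x\<^sup>2 * (1 - sgn (x * y) * cos \<theta>) \<le> 2 * \<bar>x * y\<bar> * (1 - sgn (x * y) * cos \<theta>)"
          using xy cos_ge_minus_one[of \<theta>] cos_le_one[of \<theta>]
          by (intro mult_right_mono) (auto simp: sgn_if simp del: cos_ge_minus_one cos_le_one)
        ultimately have "x\<^sup>2 * (1 - sgn (x * y) * cos \<theta>) < r\<^sup>2" by linarith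
        then show ?thesis unfolding e_def using x by (simp add: field_simps power_divide)
      qed
      have xy0: "x * y \<noteq> 0" using x y by auto
      have "(\<integral>\<^sup>+\<theta>. indicator {..<r} (dunkl_polar x y \<theta>) * ennreal (1 - cos \<theta>) \<partial>angle_measure \<alpha>)
        \<le> (\<integral>\<^sup>+\<theta>. 2 * indicator {..<e} (1 - sgn (x * y) * cos \<theta>) \<partial>angle_measure \<alpha>)"
        using cap cos_ge_minus_one by (intro nn_integral_mono) (auto split: split_indicator simp: ennreal_le_iff2 simp flip: ennreal_numeral)
      also have "\<dots> = 2 * (\<integral>\<^sup>+\<theta>. indicator {..<e} (1 - sgn (x * y) * cos \<theta>) \<partial>angle_measure \<alpha>)"
        by (rule nn_integral_cmult) measurable
      also have "(\<integral>\<^sup>+\<theta>. indicator {..<e} (1 - sgn (x * y) * cos \<theta>) \<partial>angle_measure \<alpha>)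
         = (\<integral>\<^sup>+\<theta>. indicator {..<e} (1 - cos \<theta>) \<partial>angle_measure \<alpha>)"
      proof (cases "x * y > 0")
        case False
        then have "sgn (x * y) = -1" using xy0 by (intro sgn_neg) linarith
        then show ?thesis
          using nn_integral_angle_measure_reflect[of "\<lambda>\<theta>. indicator {..<e} (1 - cos \<theta>)" \<alpha>] by simp
      qed simp
      also have "(\<integral>\<^sup>+\<theta>. indicator {..<e} (1 - cos \<theta>) \<partial>angle_measure \<alpha>) = (\<integral>\<^sup>+\<theta>. indicator ?A \<theta> \<partial>angle_measure \<alpha>)"
        by (intro nn_integral_cong) (auto split: split_indicator)
      also have "\<dots> = emeasure (angle_measure \<alpha>) ?A" by simp
      also have "2 * emeasure (angle_measure \<alpha>) ?A \<le> 2 * ennreal (2 * (2 * e) powr (\<alpha> + 1/2) / (2 * \<alpha> + 1))"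
        by (intro mult_left_mono emeasure_angle_cap_le \<alpha> e) auto
      also have "\<dots> = ennreal (4 * (2 * e) powr (\<alpha> + 1/2) / (2 * \<alpha> + 1))"
        using \<alpha> by (subst numeral_mult_ennreal) auto
      also have "4 * (2 * e) powr (\<alpha> + 1/2) / (2 * \<alpha> + 1) = (4 * (2 powr (k/2) / k)) * (r / \<bar>x\<bar>) powr k"
      proof -
        have h: "\<alpha> + 1/2 = k/2" by (simp add: k_def field_simps)
        have "e powr (k/2) = (r / \<bar>x\<bar>) powr k"
          unfolding e_def using square_powr[of "r / \<bar>x\<bar>" "k/2"] r x by simp
        then have "(2 * e) powr (k/2) = 2 powr (k/2) * (r / \<bar>x\<bar>) powr k"
          using e by (simp add: powr_mult)
        then show ?thesis unfolding h k_def[symmetric] by simp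
      qed
      finally have "ball_translation \<alpha> x r y \<le> ennreal (dunkl_const \<alpha>) * ennreal ((4 * (2 powr (k/2) / k)) * (r / \<bar>x\<bar>) powr k)"
        using \<open>\<alpha> \<noteq> -1/2\<close> by (simp add: even_translation_def mult_left_mono)
      also have "\<dots> = ennreal (dunkl_const \<alpha> * (4 * (2 powr (k/2) / k)) * (r / \<bar>x\<bar>) powr k)"
        using dunkl_const_mult_angle(1)[OF \<alpha>] by (subst ennreal_mult'[symmetric]) (auto simp: mult_ac)
      also have "\<dots> \<le> ennreal (C * (r / (\<bar>x\<bar> + r)) powr k)"
      proof (rule ennreal_leI)
        have "r / \<bar>x\<bar> \<le> 2 * (r / (\<bar>x\<bar> + r))" using False r x by (simp add: field_simps)
        then have "(r / \<bar>x\<bar>) powr k \<le> (2 * (r / (\<bar>x\<bar> + r))) powr k"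
          using r x k by (intro powr_mono2) auto
        also have "\<dots> = 2 powr k * (r / (\<bar>x\<bar> + r)) powr k" using r x by (subst powr_mult) auto
        finally have "dunkl_const \<alpha> * (4 * (2 powr (k/2) / k)) * (r / \<bar>x\<bar>) powr k
          \<le> dunkl_const \<alpha> * (4 * (2 powr (k/2) / k)) * (2 powr k * (r / (\<bar>x\<bar> + r)) powr k)"
          using dunkl_const_mult_angle(1)[OF \<alpha>] k by (intro mult_left_mono) auto
        also have "\<dots> = dunkl_const \<alpha> * (4 * (2 powr (k/2) / k)) * 2 powr k * (r / (\<bar>x\<bar> + r)) powr k"
          by (simp only: mult_ac)
        also have "\<dots> \<le> C * (r / (\<bar>x\<bar> + r)) powr k"
          by (intro mult_right_mono) (simp_all add: C_def)
        finally show "dunkl_const \<alpha> * (4 * (2 powr (k/2) / k)) * (r / \<bar>x\<bar>) powr k \<le> C * (r / (\<bar>x\<bar> + r)) powr k" .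
      qed
      finally show ?thesis using near by simp
    qed
  next
    case False
    then show ?thesis using ball_translation_eq_0[of r x y \<alpha>] by simp
  qed
  then show ?thesis using C that[of C] by (simp add: k_def)
qed

text \<open>
For \<open>y\<close> near \<open>x\<close> the translate by \<open>- x\<close> collects its mass near \<open>\<theta> = \<pi>\<close>. A whole cap of height
comparable to \<open>(r / (\<bar>x\<bar> + r))\<^sup>2\<close> lies in the region of integration there, and the factor \<open>1 - cos \<theta>\<close> is at
least \<open>1\<close> on it.
\<close>

lemma ball_translation_lower:
  assumes "\<alpha> \<ge> -1/2"
  obtains c where "c > 0" "\<And>x r y. r > 0 \<Longrightarrow> \<bar>x - y\<bar> < r / 2 \<Longrightarrow>
     ennreal (c * (r / (\<bar>x\<bar> + r)) powr (2 * \<alpha> + 1)) \<le> ball_translation \<alpha> (- x) r y"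
proof (cases "\<alpha> = -1/2")
  case True
  have "ennreal (1 * (r / (\<bar>x\<bar> + r)) powr (2 * \<alpha> + 1)) \<le> ball_translation \<alpha> (- x) r y"
    if "r > 0" "\<bar>x - y\<bar> < r / 2" for x r y :: real
  proof -
    have "\<bar>- x + y\<bar> < r" using that by linarith
    then show ?thesis using True by (simp add: even_translation_def)
  qed
  then show ?thesis by (intro that[of 1]) auto
next
  case False
  then have \<alpha>: "\<alpha> > -1/2" using assms by simp
  define k where "k = 2 * \<alpha> + 1"
  have k: "k > 0" using \<alpha> by (simp add: k_def)
  define c where "c = dunkl_const \<alpha> * ((3/8) powr (k/2) / k)"
  have c: "c > 0" unfolding c_def using dunkl_const_mult_angle(1)[OF \<alpha>] k by simp
  have "ennreal (c * (r / (\<bar>x\<bar> + r)) powr k) \<le> ball_translation \<alpha> (- x) r y"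
    if r: "r > 0" and near: "\<bar>x - y\<bar> < r / 2" for x r y
  proof -
    define \<eta> where "\<eta> = r / (\<bar>x\<bar> + r)"
    have \<eta>: "0 < \<eta>" "\<eta> \<le> 1" using r by (auto simp: \<eta>_def)
    \<comment> \<open>The square of the distance is \<open>(x - y)\<^sup>2 < r\<^sup>2 / 4\<close> plus \<open>2 x y\<close> times the height of the cap, and \<open>x y \<le> (\<bar>x\<bar> + r)\<^sup>2\<close>;
      this height makes the second part at most \<open>3/4 r\<^sup>2\<close>.\<close>
    define e where "e = 3/8 * \<eta>\<^sup>2"
    have "\<eta>\<^sup>2 \<le> 1\<^sup>2" using \<eta> by (intro power_mono) auto
    then have e: "0 < e" "e \<le> 3/8" using \<eta> by (auto simp: e_def)
    have key: "dunkl_polar (- x) y (pi - \<theta>) < r" if \<theta>: "1 - cos \<theta> < e" for \<theta>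
    proof -
      have "(dunkl_polar (- x) y (pi - \<theta>))\<^sup>2 = (x - y)\<^sup>2 + 2 * (x * y) * (1 - cos \<theta>)"
        unfolding dunkl_polar_sq_diff(2) by (simp add: power2_eq_square algebra_simps)
      moreover have "(x - y)\<^sup>2 < r\<^sup>2 / 4"
      proof -
        have "\<bar>x - y\<bar>\<^sup>2 < (r/2)\<^sup>2" using near by (intro power_strict_mono) auto
        then show ?thesis by (simp add: power_divide)
      qed
      moreover have "2 * (x * y) * (1 - cos \<theta>) \<le> 3/4 * r\<^sup>2"
      proof (cases "x * y \<le> 0")
        case True
        then have "2 * (x * y) * (1 - cos \<theta>) \<le> 0"
          using cos_le_one[of \<theta>] by (intro mult_nonpos_nonneg[of "2 * (x * y)"]) linarith+
        also have "0 \<le> 3/4 * r\<^sup>2" by simp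
        finally show ?thesis .
      next
        case False
        have "\<bar>y\<bar> \<le> \<bar>x\<bar> + r" using near by linarith
        then have "\<bar>x\<bar> * \<bar>y\<bar> \<le> (\<bar>x\<bar> + r) * (\<bar>x\<bar> + r)" using r by (intro mult_mono) auto
        moreover have "\<bar>x\<bar> * \<bar>y\<bar> = x * y" using False by (simp add: abs_mult[symmetric])
        ultimately have "x * y \<le> (\<bar>x\<bar> + r)\<^sup>2" by (simp add: power2_eq_square)
        then have "2 * (x * y) * (1 - cos \<theta>) \<le> 2 * (\<bar>x\<bar> + r)\<^sup>2 * e"
          using \<theta> False by (intro mult_mono) auto
        also have "\<dots> = 3/4 * ((\<bar>x\<bar> + r) * \<eta>)\<^sup>2" by (simp add: e_def power_mult_distrib)
        also have "(\<bar>x\<bar> + r) * \<eta> = r" using r by (simp add: \<eta>_def add_nonneg_pos less_imp_neq[symmetric])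
        finally show ?thesis .
      qed
      ultimately have "(dunkl_polar (- x) y (pi - \<theta>))\<^sup>2 < r\<^sup>2" by linarith
      then show ?thesis by (rule power2_less_imp_less) (use r in simp)
    qed
    let ?A = "{\<theta>. 1 - cos \<theta> < e}"
    have "c * \<eta> powr k = dunkl_const \<alpha> * (e powr (\<alpha> + 1/2) / (2 * \<alpha> + 1))"
    proof -
      have h: "\<alpha> + 1/2 = k/2" by (simp add: k_def field_simps)
      have "(\<eta>\<^sup>2) powr (k/2) = \<eta> powr k"
        using square_powr[OF \<eta>(1), of "k/2"] by simp
      then have "e powr (k/2) = (3/8) powr (k/2) * \<eta> powr k"
        unfolding e_def by (subst powr_mult) auto
      then show ?thesis unfolding h k_def[symmetric] c_def by simp
    qed
    then have "ennreal (c * \<eta> powr k) = ennreal (dunkl_const \<alpha> * (e powr (\<alpha> + 1/2) / (2 * \<alpha> + 1)))"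
      by (rule arg_cong)
    also have "\<dots> = ennreal (dunkl_const \<alpha>) * ennreal (e powr (\<alpha> + 1/2) / (2 * \<alpha> + 1))"
      by (rule ennreal_mult'[OF less_imp_le[OF dunkl_const_mult_angle(1)[OF \<alpha>]]])
    also have "\<dots> \<le> ennreal (dunkl_const \<alpha>) * emeasure (angle_measure \<alpha>) ?A"
      using e by (intro mult_left_mono emeasure_angle_cap_ge \<alpha>) auto
    also have "emeasure (angle_measure \<alpha>) ?A = (\<integral>\<^sup>+\<theta>. indicator ?A \<theta> \<partial>angle_measure \<alpha>)" by simp
    also have "\<dots> \<le> (\<integral>\<^sup>+\<theta>. indicator {..<r} (dunkl_polar (- x) y (pi - \<theta>)) * ennreal (1 - cos (pi - \<theta>)) \<partial>angle_measure \<alpha>)"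
    proof (rule nn_integral_mono)
      fix \<theta> :: real
      show "indicator ?A \<theta> \<le> indicator {..<r} (dunkl_polar (- x) y (pi - \<theta>)) * ennreal (1 - cos (pi - \<theta>))"
        using key[of \<theta>] e by (auto split: split_indicator simp: cos_diff)
    qed
    also have "\<dots> = (\<integral>\<^sup>+\<theta>. indicator {..<r} (dunkl_polar (- x) y \<theta>) * ennreal (1 - cos \<theta>) \<partial>angle_measure \<alpha>)"
      by (rule nn_integral_angle_measure_reflect) measurable
    finally show ?thesis
      using \<open>\<alpha> \<noteq> -1/2\<close> by (simp add: even_translation_def \<eta>_def mult_left_mono)
  qed
  then show ?thesis using c that[of c] by (simp add: k_def)
qed

section \<open>The translation as an integral over angles\<close>

text \<open>
The quotient \<open>(x + y) / (x, y)\<^sub>\<theta>\<close> is unbounded near \<open>\<theta> = 0\<close>, but the factor \<open>1 - cos \<theta>\<close> compensates, because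
\<open>2 (x, y)\<^sub>\<theta>\<^sup>2 = (x + y)\<^sup>2 (1 - cos \<theta>) + (x - y)\<^sup>2 (1 + cos \<theta>)\<close>. This makes the translation absolutely
convergent although it is not positive.
\<close>

lemma dunkl_polar_factor_le_2: "\<bar>(x + y) / dunkl_polar x y \<theta>\<bar> * (1 - cos \<theta>) \<le> 2"
proof -
  let ?z = "dunkl_polar x y \<theta>" and ?c = "cos \<theta>"
  have "((x + y) * (1 - ?c))\<^sup>2 \<le> (2 * ?z)\<^sup>2"
  proof -
    have c: "0 \<le> 1 - ?c" "0 \<le> 1 + ?c" "1 - ?c \<le> 2"
      using cos_ge_minus_one[of \<theta>] cos_le_one[of \<theta>] by linarith+
    have "(2 * ?z)\<^sup>2 = 2 * (x + y)\<^sup>2 * (1 - ?c) + 2 * (x - y)\<^sup>2 * (1 + ?c)"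
      unfolding power_mult_distrib dunkl_polar_sq_diff(1) by (simp add: power2_eq_square algebra_simps)
    moreover have "0 \<le> 2 * (x - y)\<^sup>2 * (1 + ?c)" by (intro mult_nonneg_nonneg c) auto
    ultimately have "2 * (x + y)\<^sup>2 * (1 - ?c) \<le> (2 * ?z)\<^sup>2" by linarith
    moreover have "(x + y)\<^sup>2 * (1 - ?c) * (1 - ?c) \<le> (x + y)\<^sup>2 * (1 - ?c) * 2"
      by (intro mult_left_mono c mult_nonneg_nonneg) auto
    ultimately have "(x + y)\<^sup>2 * (1 - ?c) * (1 - ?c) \<le> (2 * ?z)\<^sup>2" by (simp add: mult_ac)
    then show ?thesis by (simp add: power_mult_distrib power2_eq_square mult_ac)
  qed
  then have "\<bar>(x + y) * (1 - ?c)\<bar> \<le> 2 * ?z"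
    using abs_le_square_iff[of "(x + y) * (1 - ?c)" "2 * ?z"] dunkl_polar_nonneg[of x y \<theta>] by simp
  then show ?thesis
    using dunkl_polar_nonneg[of x y \<theta>]
    by (cases "?z = 0") (auto simp: abs_mult pos_divide_le_eq)
qed

definition dunkl_integrand :: "real \<Rightarrow> (real \<Rightarrow> real) \<Rightarrow> real \<Rightarrow> real \<Rightarrow> real" where
  "dunkl_integrand x g y \<theta> = (g (dunkl_polar x y \<theta>) + g (- dunkl_polar x y \<theta>)
     + (x + y) / dunkl_polar x y \<theta> * (g (dunkl_polar x y \<theta>) - g (- dunkl_polar x y \<theta>))) * (1 - cos \<theta>)"

lemma dunkl_integrand_measurable [measurable]:
  assumes [measurable]: "g \<in> borel_measurable borel" "f \<in> borel_measurable M" "k \<in> borel_measurable M" "l \<in> borel_measurable M"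
  shows "(\<lambda>w. dunkl_integrand (l w) g (f w) (k w)) \<in> borel_measurable M"
  unfolding dunkl_integrand_def by measurable

lemma abs_dunkl_integrand_le:
  assumes "\<And>z. g z \<ge> 0"
  shows "\<bar>dunkl_integrand x g y \<theta>\<bar> \<le> 4 * (g (dunkl_polar x y \<theta>) + g (- dunkl_polar x y \<theta>))"
proof -
  let ?z = "dunkl_polar x y \<theta>" and ?c = "cos \<theta>"
  have c: "0 \<le> 1 - ?c" "1 - ?c \<le> 2"
    using cos_ge_minus_one[of \<theta>] cos_le_one[of \<theta>] by linarith+
  have g: "g ?z \<ge> 0" "g (- ?z) \<ge> 0" using assms by auto
  have "dunkl_integrand x g y \<theta> = (g ?z + g (- ?z)) * (1 - ?c) + ((x + y) / ?z * (1 - ?c)) * (g ?z - g (- ?z))"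
  proof -
    have "(A + B + q * (A - B)) * w = (A + B) * w + (q * w) * (A - B)" for A B q w :: real
      by (simp add: algebra_simps)
    then show ?thesis unfolding dunkl_integrand_def .
  qed
  also have "\<bar>\<dots>\<bar> \<le> \<bar>(g ?z + g (- ?z)) * (1 - ?c)\<bar> + \<bar>((x + y) / ?z * (1 - ?c)) * (g ?z - g (- ?z))\<bar>"
    by (rule abs_triangle_ineq)
  also have "\<bar>(g ?z + g (- ?z)) * (1 - ?c)\<bar> \<le> (g ?z + g (- ?z)) * 2"
    unfolding abs_of_nonneg[OF mult_nonneg_nonneg[OF add_nonneg_nonneg[OF g] c(1)]]
    by (intro mult_left_mono c) (use g in simp)
  also have "\<bar>((x + y) / ?z * (1 - ?c)) * (g ?z - g (- ?z))\<bar> \<le> 2 * (g ?z + g (- ?z))"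
    unfolding abs_mult[of "(x + y) / ?z * (1 - ?c)"]
    using dunkl_polar_factor_le_2[of x y \<theta>] g c by (intro mult_mono) (auto simp: abs_mult)
  finally show ?thesis by (simp add: algebra_simps)
qed

text \<open>
The points \<open>(y, \<theta>)\<close> and \<open>(- y, \<pi> - \<theta>)\<close> have the same distance \<open>(x, y)\<^sub>\<theta>\<close>. The signed terms of
the translation combine, over such a pair, to nonnegative coefficients; this is why integrals of
translates over balls centred at \<open>0\<close> are positive. The quotient \<open>(x - y cos \<theta>) / (x, y)\<^sub>\<theta>\<close> is
the cosine of the angle at the vertex \<open>(x, 0)\<close>.
\<close>

lemma dunkl_integrand_pair:
  "dunkl_integrand x g y \<theta> + dunkl_integrand x g (- y) (pi - \<theta>)
    = 2 * ((1 + (x - y * cos \<theta>) / dunkl_polar x y \<theta>) * g (dunkl_polar x y \<theta>)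
         + (1 - (x - y * cos \<theta>) / dunkl_polar x y \<theta>) * g (- dunkl_polar x y \<theta>))"
proof -
  have "dunkl_polar x (- y) (pi - \<theta>) = dunkl_polar x y \<theta>" by (simp add: dunkl_polar_def)
  then show ?thesis
    unfolding dunkl_integrand_def
    by (cases "dunkl_polar x y \<theta> = 0") (auto simp: field_simps)
qed

lemma cos_at_vertex_le_1: "\<bar>(x - y * cos \<theta>) / dunkl_polar x y \<theta>\<bar> \<le> 1"
proof -
  have "\<bar>x - y * cos \<theta>\<bar> \<le> dunkl_polar x y \<theta>"
    unfolding dunkl_polar_eq by (rule real_sqrt_ge_abs1)
  then show ?thesis using dunkl_polar_nonneg[of x y \<theta>]
    by (cases "dunkl_polar x y \<theta> = 0") (auto simp: field_simps)
qed

lemma integral_dunkl_measure_eq: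
  fixes f :: "real \<Rightarrow> 'a::{banach, second_countable_topology}"
  assumes [measurable]: "f \<in> borel_measurable borel" and \<alpha>: "\<alpha> \<ge> -1/2"
  shows "(LINT y|dunkl_measure \<alpha>. f y) = (LINT y|dunkl_borel \<alpha>. f y)"
    and "integrable (dunkl_measure \<alpha>) f \<longleftrightarrow> integrable (dunkl_borel \<alpha>) f"
proof -
  have m: "dunkl_weight \<alpha> \<in> borel_measurable lebesgue" "f \<in> borel_measurable lebesgue"
    by (auto intro: measurable_completion)
  have d: "dunkl_measure \<alpha> = density lebesgue (\<lambda>x. ennreal (dunkl_weight \<alpha> x))"
    by (simp add: dunkl_measure_def dunkl_weight_def)
  have w: "AE x in M. 0 \<le> dunkl_weight \<alpha> x" for M using dunkl_weight_nonneg[OF \<alpha>] by simp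
  have [measurable]: "(\<lambda>y. dunkl_weight \<alpha> y *\<^sub>R f y) \<in> borel_measurable borel" by measurable
  show "(LINT y|dunkl_measure \<alpha>. f y) = (LINT y|dunkl_borel \<alpha>. f y)"
    unfolding d dunkl_borel_def
    by (simp add: integral_density[OF m(2) m(1) w] integral_density[OF _ _ w] integral_completion)
  show "integrable (dunkl_measure \<alpha>) f \<longleftrightarrow> integrable (dunkl_borel \<alpha>) f"
    unfolding d dunkl_borel_def
    by (simp add: integrable_density[OF m(2) m(1) w] integrable_density[OF _ _ w] integrable_completion)
qed

lemma nn_integral_dunkl_measure_eq:
  assumes [measurable]: "f \<in> borel_measurable borel"
  shows "(\<integral>\<^sup>+y. f y \<partial>dunkl_measure \<alpha>) = (\<integral>\<^sup>+y. f y \<partial>dunkl_borel \<alpha>)"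
proof -
  have m: "(\<lambda>x. ennreal (dunkl_weight \<alpha> x)) \<in> borel_measurable lebesgue" "f \<in> borel_measurable lebesgue"
    by (auto intro: measurable_completion)
  have d: "dunkl_measure \<alpha> = density lebesgue (\<lambda>x. ennreal (dunkl_weight \<alpha> x))"
    by (simp add: dunkl_measure_def dunkl_weight_def)
  show ?thesis unfolding d dunkl_borel_def
    by (simp add: nn_integral_density[OF m] nn_integral_density nn_integral_completion)
qed

lemma AE_dunkl_measure:
  assumes "AE x in lborel. P x" shows "AE x in dunkl_measure \<alpha>. P x" "AE x in dunkl_borel \<alpha>. P x"
proof -
  have d: "dunkl_measure \<alpha> = density lebesgue (\<lambda>x. ennreal (dunkl_weight \<alpha> x))"
    by (simp add: dunkl_measure_def dunkl_weight_def)
  have "AE x in lebesgue. P x" using assms by (rule AE_completion)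
  moreover have "(\<lambda>x. ennreal (dunkl_weight \<alpha> x)) \<in> borel_measurable lebesgue"
    by (auto intro: measurable_completion)
  ultimately show "AE x in dunkl_measure \<alpha>. P x" unfolding d
    by (subst AE_density) auto
  show "AE x in dunkl_borel \<alpha>. P x" unfolding dunkl_borel_def using assms
    by (subst AE_density) auto
qed

lemma dunkl_translation_eq_angle_integral:
  assumes [measurable]: "g \<in> borel_measurable borel" and \<alpha>: "\<alpha> \<noteq> -1/2"
  shows "dunkl_translation \<alpha> x g y = dunkl_const \<alpha> / 2 * (LINT \<theta>|angle_measure \<alpha>. dunkl_integrand x g y \<theta>)"
proof -
  have [measurable]: "(\<lambda>\<theta>. indicator {0..pi} \<theta> *\<^sub>R (dunkl_integrand x g y \<theta> * sin \<theta> powr (2 * \<alpha>))) \<in> borel_measurable borel"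
    by measurable
  have "(LINT \<theta>:{0..pi}|lebesgue. dunkl_integrand x g y \<theta> * sin \<theta> powr (2 * \<alpha>))
    = (LINT \<theta>|lborel. indicator {0..pi} \<theta> *\<^sub>R (dunkl_integrand x g y \<theta> * sin \<theta> powr (2 * \<alpha>)))"
    unfolding set_lebesgue_integral_def by (rule integral_completion) measurable
  also have "\<dots> = (LINT \<theta>|lborel. (sin \<theta> powr (2 * \<alpha>) * indicator {0<..<pi} \<theta>) *\<^sub>R dunkl_integrand x g y \<theta>)"
    by (intro Bochner_Integration.integral_cong) (auto split: split_indicator simp: less_le)
  also have "\<dots> = (LINT \<theta>|density lborel (\<lambda>\<theta>. ennreal (sin \<theta> powr (2 * \<alpha>) * indicator {0<..<pi} \<theta>)). dunkl_integrand x g y \<theta>)"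
    by (rule integral_density[symmetric]) auto
  also have "density lborel (\<lambda>\<theta>. ennreal (sin \<theta> powr (2 * \<alpha>) * indicator {0<..<pi} \<theta>)) = angle_measure \<alpha>"
    unfolding angle_measure_def by (intro arg_cong2[where f=density] refl ext) (auto split: split_indicator)
  finally show ?thesis using \<alpha> by (simp add: dunkl_translation_def dunkl_integrand_def)
qed

lemma dunkl_translation_measurable:
  assumes [measurable]: "g \<in> borel_measurable borel" "f \<in> borel_measurable M" "k \<in> borel_measurable M"
  shows "(\<lambda>w. dunkl_translation \<alpha> (f w) g (k w)) \<in> borel_measurable M"
proof (cases "\<alpha> = -1/2")
  case False
  interpret A: sigma_finite_measure "angle_measure \<alpha>" by (rule sigma_finite_angle_measure)
  have "(\<lambda>(w, \<theta>). dunkl_integrand (f w) g (k w) \<theta>) \<in> borel_measurable (M \<Otimes>\<^sub>M angle_measure \<alpha>)"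
    unfolding case_prod_beta' by measurable
  note A.borel_measurable_lebesgue_integral[OF this, measurable]
  show ?thesis
    unfolding dunkl_translation_eq_angle_integral[OF assms(1) False] by measurable
qed (simp add: dunkl_translation_def)

lemma dunkl_translation_even_le:
  assumes [measurable]: "g \<in> borel_measurable borel" and \<alpha>: "\<alpha> \<ge> -1/2"
    and g: "\<And>z. g z \<ge> 0" "\<And>z. g (- z) = g z"
  shows "dunkl_translation \<alpha> x g y \<ge> 0"
    "ennreal (dunkl_translation \<alpha> x g y) \<le> even_translation \<alpha> x (\<lambda>t. ennreal (g t)) y"
proof -
  have "dunkl_translation \<alpha> x g y \<ge> 0 \<and> ennreal (dunkl_translation \<alpha> x g y) \<le> even_translation \<alpha> x (\<lambda>t. ennreal (g t)) y"
  proof (cases "\<alpha> = -1/2")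
    case True
    have "g \<bar>x + y\<bar> = g (x + y)" using g(2)[of "x + y"] by (simp add: abs_if)
    then show ?thesis using True g by (simp add: dunkl_translation_def even_translation_def)
  next
    case False
    then have c: "dunkl_const \<alpha> > 0" using \<alpha> by (intro dunkl_const_mult_angle(1)) auto
    have e: "dunkl_integrand x g y \<theta> = 2 * (g (dunkl_polar x y \<theta>) * (1 - cos \<theta>))" for \<theta>
      by (simp add: dunkl_integrand_def g(2))
    have t: "dunkl_translation \<alpha> x g y = dunkl_const \<alpha> * (LINT \<theta>|angle_measure \<alpha>. g (dunkl_polar x y \<theta>) * (1 - cos \<theta>))"
      using False by (simp add: dunkl_translation_eq_angle_integral e)
    have n: "(LINT \<theta>|angle_measure \<alpha>. g (dunkl_polar x y \<theta>) * (1 - cos \<theta>)) \<ge> 0"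
      using g by (intro integral_nonneg_AE) auto
    have "ennreal (LINT \<theta>|angle_measure \<alpha>. g (dunkl_polar x y \<theta>) * (1 - cos \<theta>))
       = ennreal (enn2real (\<integral>\<^sup>+\<theta>. ennreal (g (dunkl_polar x y \<theta>) * (1 - cos \<theta>)) \<partial>angle_measure \<alpha>))"
      using g by (subst integral_eq_nn_integral) auto
    also have "\<dots> \<le> (\<integral>\<^sup>+\<theta>. ennreal (g (dunkl_polar x y \<theta>) * (1 - cos \<theta>)) \<partial>angle_measure \<alpha>)"
      by (cases "\<integral>\<^sup>+\<theta>. ennreal (g (dunkl_polar x y \<theta>) * (1 - cos \<theta>)) \<partial>angle_measure \<alpha>") auto
    also have "\<dots> = (\<integral>\<^sup>+\<theta>. ennreal (g (dunkl_polar x y \<theta>)) * ennreal (1 - cos \<theta>) \<partial>angle_measure \<alpha>)"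
      using g by (intro nn_integral_cong) (simp add: ennreal_mult)
    finally show ?thesis
      using False c n by (simp add: t even_translation_def ennreal_mult' mult_left_mono)
  qed
  then show "dunkl_translation \<alpha> x g y \<ge> 0"
    "ennreal (dunkl_translation \<alpha> x g y) \<le> even_translation \<alpha> x (\<lambda>t. ennreal (g t)) y" by auto
qed

section \<open>Duality of translation and balls\<close>

lemma nn_integral_dunkl_borel_reflect:
  assumes [measurable]: "f \<in> borel_measurable borel"
  shows "(\<integral>\<^sup>+y. f (- y) \<partial>dunkl_borel \<alpha>) = (\<integral>\<^sup>+y. f y \<partial>dunkl_borel \<alpha>)"
proof -
  have "dunkl_weight \<alpha> (- y) = dunkl_weight \<alpha> y" for y by (simp add: dunkl_weight_def)
  then show ?thesis
    using nn_integral_real_affine[of "\<lambda>y. ennreal (dunkl_weight \<alpha> y) * f y" "-1" 0]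
    by (simp add: nn_integral_dunkl_borel)
qed

lemma dunkl_borel_reflect: "distr (dunkl_borel \<alpha>) borel uminus = dunkl_borel \<alpha>"
proof (rule measure_eqI)
  fix A assume "A \<in> sets (distr (dunkl_borel \<alpha>) borel uminus)"
  then have [measurable]: "A \<in> sets borel" by simp
  have "emeasure (distr (dunkl_borel \<alpha>) borel uminus) A = (\<integral>\<^sup>+y. indicator A y \<partial>distr (dunkl_borel \<alpha>) borel uminus)"
    by simp
  also have "\<dots> = (\<integral>\<^sup>+y. indicator A (- y) \<partial>dunkl_borel \<alpha>)" by (rule nn_integral_distr) measurable
  also have "\<dots> = (\<integral>\<^sup>+y. indicator A y \<partial>dunkl_borel \<alpha>)" by (rule nn_integral_dunkl_borel_reflect) measurable
  finally show "emeasure (distr (dunkl_borel \<alpha>) borel uminus) A = emeasure (dunkl_borel \<alpha>) A" by simp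
qed simp

lemma AE_dunkl_borel_nonzero: "AE y in dunkl_borel \<alpha>. y \<noteq> 0"
  using AE_lborel_singleton[of 0] by (intro AE_dunkl_measure) auto

lemma nn_integral_dunkl_borel_fold:
  assumes [measurable]: "f \<in> borel_measurable borel"
  shows "(\<integral>\<^sup>+y. f y \<partial>dunkl_borel \<alpha>) = (\<integral>\<^sup>+y. (f y + f (- y)) * indicator {0<..} y \<partial>dunkl_borel \<alpha>)"
proof -
  have "(\<integral>\<^sup>+y. f y \<partial>dunkl_borel \<alpha>)
     = (\<integral>\<^sup>+y. f y * indicator {0<..} y + f y * indicator {0<..} (- y) \<partial>dunkl_borel \<alpha>)"
    using AE_dunkl_borel_nonzero[of \<alpha>]
    by (intro nn_integral_cong_AE) (auto split: split_indicator elim!: eventually_mono)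
  also have "\<dots> = (\<integral>\<^sup>+y. f y * indicator {0<..} y \<partial>dunkl_borel \<alpha>) + (\<integral>\<^sup>+y. f y * indicator {0<..} (- y) \<partial>dunkl_borel \<alpha>)"
    by (rule nn_integral_add) measurable
  also have "(\<integral>\<^sup>+y. f y * indicator {0<..} (- y) \<partial>dunkl_borel \<alpha>) = (\<integral>\<^sup>+y. f (- y) * indicator {0<..} y \<partial>dunkl_borel \<alpha>)"
    using nn_integral_dunkl_borel_reflect[of "\<lambda>y. f y * indicator {0<..} (- y)" \<alpha>] by simp
  also have "(\<integral>\<^sup>+y. f y * indicator {0<..} y \<partial>dunkl_borel \<alpha>) + (\<integral>\<^sup>+y. f (- y) * indicator {0<..} y \<partial>dunkl_borel \<alpha>)
    = (\<integral>\<^sup>+y. f y * indicator {0<..} y + f (- y) * indicator {0<..} y \<partial>dunkl_borel \<alpha>)"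
    by (rule nn_integral_add[symmetric]) measurable
  finally show ?thesis by (simp add: distrib_right)
qed

lemma integral_dunkl_borel_fold:
  fixes f :: "real \<Rightarrow> real"
  assumes f: "integrable (dunkl_borel \<alpha>) f"
  shows "integrable (dunkl_borel \<alpha>) (\<lambda>y. f (- y))"
    "(LINT y|dunkl_borel \<alpha>. f y) = (LINT y|dunkl_borel \<alpha>. indicator {0<..} y * (f y + f (- y)))"
proof -
  have [measurable]: "f \<in> borel_measurable borel" using borel_measurable_integrable[OF f] by simp
  have refl: "integrable (dunkl_borel \<alpha>) (\<lambda>y. h (- y)) \<longleftrightarrow> integrable (dunkl_borel \<alpha>) h"
    "(LINT y|dunkl_borel \<alpha>. h (- y)) = (LINT y|dunkl_borel \<alpha>. h y)" if "h \<in> borel_measurable borel" for h :: "real \<Rightarrow> real"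
    using integrable_distr_eq[of uminus "dunkl_borel \<alpha>" borel h] integral_distr[of uminus "dunkl_borel \<alpha>" borel h] that
    by (simp_all add: dunkl_borel_reflect)
  show i: "integrable (dunkl_borel \<alpha>) (\<lambda>y. f (- y))" using f by (subst refl) auto
  have ia: "integrable (dunkl_borel \<alpha>) (\<lambda>y. indicator {0<..} y * f y)" "integrable (dunkl_borel \<alpha>) (\<lambda>y. indicator {0<..} (- y) * f y)"
    "integrable (dunkl_borel \<alpha>) (\<lambda>y. indicator {0<..} y * f (- y))"
    using f i by (auto intro: Bochner_Integration.integrable_bound[OF f] Bochner_Integration.integrable_bound[OF i] split: split_indicator)
  have "(LINT y|dunkl_borel \<alpha>. f y) = (LINT y|dunkl_borel \<alpha>. indicator {0<..} y * f y + indicator {0<..} (- y) * f y)"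
    using AE_dunkl_borel_nonzero[of \<alpha>]
    by (intro integral_cong_AE) (auto split: split_indicator elim!: eventually_mono)
  also have "\<dots> = (LINT y|dunkl_borel \<alpha>. indicator {0<..} y * f y) + (LINT y|dunkl_borel \<alpha>. indicator {0<..} (- y) * f y)"
    by (rule Bochner_Integration.integral_add) (use ia in auto)
  also have "(LINT y|dunkl_borel \<alpha>. indicator {0<..} (- y) * f y) = (LINT y|dunkl_borel \<alpha>. indicator {0<..} y * f (- y))"
    using refl(2)[of "\<lambda>y. indicator {0<..} (- y) * f y"] by simp
  also have "(LINT y|dunkl_borel \<alpha>. indicator {0<..} y * f y) + (LINT y|dunkl_borel \<alpha>. indicator {0<..} y * f (- y))
    = (LINT y|dunkl_borel \<alpha>. indicator {0<..} y * (f y + f (- y)))"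
    using ia by (subst Bochner_Integration.integral_add[symmetric]) (auto simp: distrib_left)
  finally show "(LINT y|dunkl_borel \<alpha>. f y) = (LINT y|dunkl_borel \<alpha>. indicator {0<..} y * (f y + f (- y)))" .
qed

lemma angle_measure_reflect: "distr (angle_measure \<alpha>) borel (\<lambda>\<theta>. pi - \<theta>) = angle_measure \<alpha>"
proof (rule measure_eqI)
  fix A assume "A \<in> sets (distr (angle_measure \<alpha>) borel (\<lambda>\<theta>. pi - \<theta>))"
  then have [measurable]: "A \<in> sets borel" by simp
  have "emeasure (distr (angle_measure \<alpha>) borel (\<lambda>\<theta>. pi - \<theta>)) A = (\<integral>\<^sup>+y. indicator A y \<partial>distr (angle_measure \<alpha>) borel (\<lambda>\<theta>. pi - \<theta>))"
    by simp
  also have "\<dots> = (\<integral>\<^sup>+y. indicator A (pi - y) \<partial>angle_measure \<alpha>)" by (rule nn_integral_distr) measurable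
  also have "\<dots> = (\<integral>\<^sup>+y. indicator A y \<partial>angle_measure \<alpha>)" by (rule nn_integral_angle_measure_reflect) measurable
  finally show "emeasure (distr (angle_measure \<alpha>) borel (\<lambda>\<theta>. pi - \<theta>)) A = emeasure (angle_measure \<alpha>) A" by simp
qed simp

lemma integral_angle_measure_reflect:
  fixes h :: "real \<Rightarrow> real"
  assumes "h \<in> borel_measurable borel"
  shows "integrable (angle_measure \<alpha>) (\<lambda>\<theta>. h (pi - \<theta>)) \<longleftrightarrow> integrable (angle_measure \<alpha>) h"
    "(LINT \<theta>|angle_measure \<alpha>. h (pi - \<theta>)) = (LINT \<theta>|angle_measure \<alpha>. h \<theta>)"
  using integrable_distr_eq[of "\<lambda>\<theta>. pi - \<theta>" "angle_measure \<alpha>" borel h]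
    integral_distr[of "\<lambda>\<theta>. pi - \<theta>" "angle_measure \<alpha>" borel h] assms
  by (simp_all add: angle_measure_reflect)

text \<open>
An a priori bound that gives the absolute convergence of the double integrals over \<open>y\<close> and \<open>\<theta>\<close>: the points at distance less than \<open>r\<close>
from the origin are at distance less than \<open>\<bar>x\<bar> + r\<close> from \<open>(x, 0)\<close>.
\<close>

lemma nn_integral_polar_even_le:
  fixes h :: "real \<Rightarrow> ennreal"
  assumes [measurable]: "h \<in> borel_measurable borel" and \<alpha>: "\<alpha> \<ge> -1/2"
  shows "(\<integral>\<^sup>+\<theta>. (\<integral>\<^sup>+y. h (dunkl_polar x y \<theta>) * indicator {0<..<r} y \<partial>dunkl_borel \<alpha>) \<partial>angle_measure \<alpha>)
    \<le> emeasure (angle_measure \<alpha>) UNIV * (\<integral>\<^sup>+z. h z * indicator {0<..<\<bar>x\<bar> + r} z \<partial>dunkl_borel \<alpha>)"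
proof -
  have "(\<integral>\<^sup>+\<theta>. (\<integral>\<^sup>+y. h (dunkl_polar x y \<theta>) * indicator {0<..<r} y \<partial>dunkl_borel \<alpha>) \<partial>angle_measure \<alpha>)
    = (\<integral>\<^sup>+\<theta>. (\<integral>\<^sup>+z. h z * indicator {..<r} (dunkl_polar x z \<theta>) * indicator {0<..} z \<partial>dunkl_borel \<alpha>) \<partial>angle_measure \<alpha>)"
    using nn_integral_dunkl_polar_exchange[of "\<lambda>p. h (fst p)" \<alpha> x r] \<alpha> by simp
  also have "\<dots> \<le> (\<integral>\<^sup>+\<theta>. (\<integral>\<^sup>+z. h z * indicator {0<..<\<bar>x\<bar> + r} z \<partial>dunkl_borel \<alpha>) \<partial>angle_measure \<alpha>)"
  proof (intro nn_integral_mono)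
    fix \<theta> z :: real
    show "h z * indicator {..<r} (dunkl_polar x z \<theta>) * indicator {0<..} z \<le> h z * indicator {0<..<\<bar>x\<bar> + r} z"
      using dunkl_polar_ge[of x z \<theta>] by (auto split: split_indicator)
  qed
  also have "\<dots> = emeasure (angle_measure \<alpha>) UNIV * (\<integral>\<^sup>+z. h z * indicator {0<..<\<bar>x\<bar> + r} z \<partial>dunkl_borel \<alpha>)"
    by (simp add: mult.commute)
  finally show ?thesis .
qed

text \<open>
The double integral converges absolutely, so \<open>y\<close> and \<open>- y\<close> may be paired, with \<open>\<theta>\<close> reflected in the
second term. The result is a nonnegative integral over \<open>y > 0\<close>, to which the exchange of the two centres
applies; it turns the condition \<open>y < r\<close> into \<open>(x, z)\<^sub>\<theta> < r\<close>, and the coefficients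
\<open>1 + cos \<theta>\<close> and \<open>1 - cos \<theta>\<close> of \<open>g(z)\<close> and \<open>g(- z)\<close> are those in the translates of the ball.
\<close>

lemma integral_ball_dunkl_translation_borel:
  fixes g :: "real \<Rightarrow> real"
  assumes [measurable]: "g \<in> borel_measurable borel" and \<alpha>: "\<alpha> > -1/2"
    and g: "\<And>z. g z \<ge> 0" and loc: "\<And>R. ball_integral \<alpha> g 0 R < \<infinity>"
  shows "(LINT y|dunkl_borel \<alpha>. indicator (ball 0 r) y * dunkl_translation \<alpha> x g y)
    = enn2real (\<integral>\<^sup>+z. ennreal (g z) * ball_translation \<alpha> (- x) r z \<partial>dunkl_borel \<alpha>)"
proof -
  have \<alpha>': "\<alpha> \<ge> -1/2" "\<alpha> \<noteq> -1/2" using \<alpha> by auto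
  interpret A: sigma_finite_measure "angle_measure \<alpha>" by (rule sigma_finite_angle_measure)
  interpret D: sigma_finite_measure "dunkl_borel \<alpha>" by (rule sigma_finite_dunkl_borel)
  interpret P: pair_sigma_finite "dunkl_borel \<alpha>" "angle_measure \<alpha>" ..
  define c where "c = dunkl_const \<alpha>"
  have c: "c > 0" unfolding c_def by (rule dunkl_const_mult_angle(1)[OF \<alpha>])
  define \<Psi> where "\<Psi> y \<theta> = c / 2 * (indicator (ball 0 r) y * dunkl_integrand x g y \<theta>)" for y \<theta>
  have \<Psi>m: "(\<lambda>(y, \<theta>). \<Psi> y \<theta>) \<in> borel_measurable (dunkl_borel \<alpha> \<Otimes>\<^sub>M angle_measure \<alpha>)"
    unfolding \<Psi>_def case_prod_beta' by measurable
  define h where "h z = ennreal (g z) + ennreal (g (- z))" for z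
  have [measurable]: "h \<in> borel_measurable borel" unfolding h_def by measurable
  have heven: "h (- z) = h z" for z by (simp add: h_def add.commute)
  have hfin: "(\<integral>\<^sup>+z. h z * indicator {0<..<R} z \<partial>dunkl_borel \<alpha>) < \<infinity>" for R
  proof -
    have "(\<integral>\<^sup>+z. h z * indicator {0<..<R} z \<partial>dunkl_borel \<alpha>)
      = (\<integral>\<^sup>+z. (ennreal (g z) * indicator (ball 0 R) z + ennreal (g (- z)) * indicator (ball 0 R) (- z)) * indicator {0<..} z \<partial>dunkl_borel \<alpha>)"
      by (intro nn_integral_cong) (auto simp: h_def split: split_indicator)
    also have "\<dots> = ball_integral \<alpha> g 0 R"
      by (rule nn_integral_dunkl_borel_fold[symmetric]) measurable
    finally show ?thesis using loc by simp
  qed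
  have fin: "(\<integral>\<^sup>+y. (\<integral>\<^sup>+\<theta>. ennreal (norm (\<Psi> y \<theta>)) \<partial>angle_measure \<alpha>) \<partial>dunkl_borel \<alpha>) < \<infinity>"
  proof -
    let ?U = "\<lambda>x. (\<integral>\<^sup>+\<theta>. (\<integral>\<^sup>+y. h (dunkl_polar x y \<theta>) * indicator {0<..<r} y \<partial>dunkl_borel \<alpha>) \<partial>angle_measure \<alpha>)"
    have "(\<integral>\<^sup>+y. (\<integral>\<^sup>+\<theta>. ennreal (norm (\<Psi> y \<theta>)) \<partial>angle_measure \<alpha>) \<partial>dunkl_borel \<alpha>)
      \<le> (\<integral>\<^sup>+y. (\<integral>\<^sup>+\<theta>. ennreal (2 * c) * (h (dunkl_polar x y \<theta>) * indicator (ball 0 r) y) \<partial>angle_measure \<alpha>) \<partial>dunkl_borel \<alpha>)"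
    proof (intro nn_integral_mono)
      fix y \<theta>
      have "norm (\<Psi> y \<theta>) \<le> 2 * c * ((g (dunkl_polar x y \<theta>) + g (- dunkl_polar x y \<theta>)) * indicator (ball 0 r) y)"
        using abs_dunkl_integrand_le[of g x y \<theta>] g c unfolding \<Psi>_def
        by (auto simp: abs_mult split: split_indicator)
      then have "ennreal (norm (\<Psi> y \<theta>)) \<le> ennreal (2 * c * ((g (dunkl_polar x y \<theta>) + g (- dunkl_polar x y \<theta>)) * indicator (ball 0 r) y))"
        by (rule ennreal_leI)
      also have "\<dots> = ennreal (2 * c) * (h (dunkl_polar x y \<theta>) * indicator (ball 0 r) y)"
        using g c unfolding h_def by (subst ennreal_mult) (auto split: split_indicator simp: ennreal_plus)
      finally show "ennreal (norm (\<Psi> y \<theta>)) \<le> ennreal (2 * c) * (h (dunkl_polar x y \<theta>) * indicator (ball 0 r) y)" .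
    qed
    also have "\<dots> = ennreal (2 * c) * (\<integral>\<^sup>+y. (\<integral>\<^sup>+\<theta>. h (dunkl_polar x y \<theta>) * indicator (ball 0 r) y \<partial>angle_measure \<alpha>) \<partial>dunkl_borel \<alpha>)"
      by (simp add: nn_integral_cmult)
    also have "(\<integral>\<^sup>+y. (\<integral>\<^sup>+\<theta>. h (dunkl_polar x y \<theta>) * indicator (ball 0 r) y \<partial>angle_measure \<alpha>) \<partial>dunkl_borel \<alpha>)
      = (\<integral>\<^sup>+\<theta>. (\<integral>\<^sup>+y. h (dunkl_polar x y \<theta>) * indicator (ball 0 r) y \<partial>dunkl_borel \<alpha>) \<partial>angle_measure \<alpha>)"
      by (rule P.Fubini'[symmetric]) measurable
    also have "\<dots> = (\<integral>\<^sup>+\<theta>. (\<integral>\<^sup>+y. h (dunkl_polar x y \<theta>) * indicator {0<..<r} y + h (dunkl_polar (- x) y \<theta>) * indicator {0<..<r} y \<partial>dunkl_borel \<alpha>) \<partial>angle_measure \<alpha>)"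
    proof (rule nn_integral_cong)
      fix \<theta> :: real
      have "dunkl_polar x (- y) \<theta> = dunkl_polar (- x) y \<theta>" for y by (simp add: dunkl_polar_def)
      moreover have "(\<integral>\<^sup>+y. h (dunkl_polar x y \<theta>) * indicator (ball 0 r) y \<partial>dunkl_borel \<alpha>)
        = (\<integral>\<^sup>+y. (h (dunkl_polar x y \<theta>) * indicator (ball 0 r) y + h (dunkl_polar x (- y) \<theta>) * indicator (ball 0 r) (- y)) * indicator {0<..} y \<partial>dunkl_borel \<alpha>)"
        by (rule nn_integral_dunkl_borel_fold) measurable
      ultimately show "(\<integral>\<^sup>+y. h (dunkl_polar x y \<theta>) * indicator (ball 0 r) y \<partial>dunkl_borel \<alpha>)
        = (\<integral>\<^sup>+y. h (dunkl_polar x y \<theta>) * indicator {0<..<r} y + h (dunkl_polar (- x) y \<theta>) * indicator {0<..<r} y \<partial>dunkl_borel \<alpha>)"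
        by (auto intro!: nn_integral_cong split: split_indicator)
    qed
    also have "\<dots> = (\<integral>\<^sup>+\<theta>. (\<integral>\<^sup>+y. h (dunkl_polar x y \<theta>) * indicator {0<..<r} y \<partial>dunkl_borel \<alpha>) \<partial>angle_measure \<alpha>)
        + (\<integral>\<^sup>+\<theta>. (\<integral>\<^sup>+y. h (dunkl_polar (- x) y \<theta>) * indicator {0<..<r} y \<partial>dunkl_borel \<alpha>) \<partial>angle_measure \<alpha>)"
      by (simp add: nn_integral_add)
    finally have "(\<integral>\<^sup>+y. (\<integral>\<^sup>+\<theta>. ennreal (norm (\<Psi> y \<theta>)) \<partial>angle_measure \<alpha>) \<partial>dunkl_borel \<alpha>)
      \<le> ennreal (2 * c) * (?U x + ?U (- x))" .
    moreover have "?U x + ?U (- x) < \<infinity>"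
      using nn_integral_polar_even_le[of h \<alpha> x r] nn_integral_polar_even_le[of h \<alpha> "- x" r] \<alpha>'
        hfin[of "\<bar>x\<bar> + r"] emeasure_angle_finite[OF \<alpha>]
      by (simp add: ennreal_mult_less_top le_less_trans)
    ultimately show ?thesis by (elim le_less_trans) (simp add: ennreal_mult_less_top)
  qed
  have int: "integrable (dunkl_borel \<alpha> \<Otimes>\<^sub>M angle_measure \<alpha>) (\<lambda>(y, \<theta>). \<Psi> y \<theta>)"
  proof (rule integrableI_bounded[OF \<Psi>m])
    have "(\<integral>\<^sup>+p. ennreal (norm (case p of (y, \<theta>) \<Rightarrow> \<Psi> y \<theta>)) \<partial>(dunkl_borel \<alpha> \<Otimes>\<^sub>M angle_measure \<alpha>))
      = (\<integral>\<^sup>+y. (\<integral>\<^sup>+\<theta>. ennreal (norm (\<Psi> y \<theta>)) \<partial>angle_measure \<alpha>) \<partial>dunkl_borel \<alpha>)"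
      using A.nn_integral_fst[of "\<lambda>p. ennreal (norm (case p of (y, \<theta>) \<Rightarrow> \<Psi> y \<theta>))" "dunkl_borel \<alpha>"] \<Psi>m by simp
    then show "(\<integral>\<^sup>+p. ennreal (norm (case p of (y, \<theta>) \<Rightarrow> \<Psi> y \<theta>)) \<partial>(dunkl_borel \<alpha> \<Otimes>\<^sub>M angle_measure \<alpha>)) < \<infinity>"
      using fin by simp
  qed
  define \<Phi> where "\<Phi> y = (LINT \<theta>|angle_measure \<alpha>. \<Psi> y \<theta>)" for y
  have \<Phi>: "\<Phi> = (\<lambda>y. indicator (ball 0 r) y * dunkl_translation \<alpha> x g y)"
    unfolding \<Phi>_def \<Psi>_def dunkl_translation_eq_angle_integral[OF assms(1) \<alpha>'(2)] by (simp add: c_def mult_ac)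
  have \<Phi>int: "integrable (dunkl_borel \<alpha>) \<Phi>"
    unfolding \<Phi>_def using P.integrable_fst[OF int] by simp
  have AEint: "AE y in dunkl_borel \<alpha>. integrable (angle_measure \<alpha>) (\<Psi> y)"
    using P.AE_integrable_fst'[OF int] by simp
  have AEint': "AE y in dunkl_borel \<alpha>. integrable (angle_measure \<alpha>) (\<Psi> (- y))"
  proof -
    have "AE y in distr (dunkl_borel \<alpha>) borel uminus. integrable (angle_measure \<alpha>) (\<Psi> y)"
      unfolding dunkl_borel_reflect by (rule AEint)
    then show ?thesis by (rule AE_distrD[rotated]) simp
  qed
  \<comment> \<open>\<open>S\<close> is the nonnegative integrand after pairing \<open>(y, \<theta>)\<close> with \<open>(- y, \<pi> - \<theta>)\<close>.\<close>
  define S where "S y \<theta> = c * (indicator {0<..<r} y *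
       ((1 + (x - y * cos \<theta>) / dunkl_polar x y \<theta>) * g (dunkl_polar x y \<theta>)
         + (1 - (x - y * cos \<theta>) / dunkl_polar x y \<theta>) * g (- dunkl_polar x y \<theta>)))" for y \<theta>
  have Snn: "S y \<theta> \<ge> 0" for y \<theta>
  proof -
    have "0 \<le> 1 + (x - y * cos \<theta>) / dunkl_polar x y \<theta>" "0 \<le> 1 - (x - y * cos \<theta>) / dunkl_polar x y \<theta>"
      using abs_le_D1[OF cos_at_vertex_le_1[of x y \<theta>]] abs_le_D2[OF cos_at_vertex_le_1[of x y \<theta>]] by linarith+
    then show ?thesis
      unfolding S_def using c g
      by (intro mult_nonneg_nonneg[OF _ mult_nonneg_nonneg[OF _ add_nonneg_nonneg[OF mult_nonneg_nonneg mult_nonneg_nonneg]]]) auto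
  qed
  have Sm: "(\<lambda>(y, \<theta>). S y \<theta>) \<in> borel_measurable (dunkl_borel \<alpha> \<Otimes>\<^sub>M angle_measure \<alpha>)"
    unfolding S_def case_prod_beta' by measurable
  have [measurable]: "S y \<in> borel_measurable (angle_measure \<alpha>)" for y
    unfolding S_def by measurable
  have S_eq: "indicator {0<..} y * (\<Psi> y \<theta> + \<Psi> (- y) (pi - \<theta>)) = S y \<theta>" for y \<theta>
  proof -
    have "indicator {0<..} y * (\<Psi> y \<theta> + \<Psi> (- y) (pi - \<theta>))
      = c / 2 * (indicator {0<..<r} y * (dunkl_integrand x g y \<theta> + dunkl_integrand x g (- y) (pi - \<theta>)))"
      unfolding \<Psi>_def by (auto split: split_indicator simp: distrib_left)
    also have "\<dots> = S y \<theta>" unfolding dunkl_integrand_pair S_def by simp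
    finally show ?thesis .
  qed
  have Sfin: "(\<integral>\<^sup>+y. (\<integral>\<^sup>+\<theta>. ennreal (S y \<theta>) \<partial>angle_measure \<alpha>) \<partial>dunkl_borel \<alpha>)
    = (\<integral>\<^sup>+z. ennreal (g z) * ball_translation \<alpha> (- x) r z \<partial>dunkl_borel \<alpha>)"
  proof -
    define k where "k p = ennreal (c * ((1 + snd p) * g (fst p) + (1 - snd p) * g (- fst p)))" for p
    have [measurable]: "k \<in> borel_measurable (borel \<Otimes>\<^sub>M borel)" unfolding k_def by measurable
    have "(\<integral>\<^sup>+y. (\<integral>\<^sup>+\<theta>. ennreal (S y \<theta>) \<partial>angle_measure \<alpha>) \<partial>dunkl_borel \<alpha>)
      = (\<integral>\<^sup>+\<theta>. (\<integral>\<^sup>+y. ennreal (S y \<theta>) \<partial>dunkl_borel \<alpha>) \<partial>angle_measure \<alpha>)"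
      using P.Fubini'[of "\<lambda>y \<theta>. ennreal (S y \<theta>)"] Sm by simp
    also have "\<dots> = (\<integral>\<^sup>+\<theta>. (\<integral>\<^sup>+y. k (dunkl_polar x y \<theta>, (x - y * cos \<theta>) / dunkl_polar x y \<theta>) * indicator {0<..<r} y \<partial>dunkl_borel \<alpha>) \<partial>angle_measure \<alpha>)"
      by (intro nn_integral_cong) (auto simp: S_def k_def split: split_indicator)
    also have "\<dots> = (\<integral>\<^sup>+\<theta>. (\<integral>\<^sup>+z. k (z, cos \<theta>) * indicator {..<r} (dunkl_polar x z \<theta>) * indicator {0<..} z \<partial>dunkl_borel \<alpha>) \<partial>angle_measure \<alpha>)"
      by (rule nn_integral_dunkl_polar_exchange) (use \<alpha>' in auto)
    also have "\<dots> = (\<integral>\<^sup>+z. (\<integral>\<^sup>+\<theta>. k (z, cos \<theta>) * indicator {..<r} (dunkl_polar x z \<theta>) * indicator {0<..} z \<partial>angle_measure \<alpha>) \<partial>dunkl_borel \<alpha>)"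
      by (rule P.Fubini') measurable
    also have "\<dots> = (\<integral>\<^sup>+z. (ennreal (g z) * ball_translation \<alpha> (- x) r z + ennreal (g (- z)) * ball_translation \<alpha> (- x) r (- z)) * indicator {0<..} z \<partial>dunkl_borel \<alpha>)"
    proof (intro nn_integral_cong)
      fix z :: real
      have kz: "k (z, cos \<theta>) * indicator {..<r} (dunkl_polar x z \<theta>)
        = ennreal (g z) * (ennreal c * (indicator {..<r} (dunkl_polar x z \<theta>) * ennreal (1 + cos \<theta>)))
        + ennreal (g (- z)) * (ennreal c * (indicator {..<r} (dunkl_polar x z \<theta>) * ennreal (1 - cos \<theta>)))" for \<theta>
      proof -
        have cc: "0 \<le> 1 + cos \<theta>" "0 \<le> 1 - cos \<theta>"
          using cos_ge_minus_one[of \<theta>] cos_le_one[of \<theta>] by linarith+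
        have "k (z, cos \<theta>) = ennreal (g z * (c * (1 + cos \<theta>)) + g (- z) * (c * (1 - cos \<theta>)))"
          unfolding k_def by (simp add: algebra_simps)
        also have "\<dots> = ennreal (g z) * (ennreal c * ennreal (1 + cos \<theta>)) + ennreal (g (- z)) * (ennreal c * ennreal (1 - cos \<theta>))"
          using c cc g by (subst ennreal_plus) (auto simp: ennreal_mult mult_nonneg_nonneg)
        finally show ?thesis by (auto split: split_indicator)
      qed
      have "(\<integral>\<^sup>+\<theta>. k (z, cos \<theta>) * indicator {..<r} (dunkl_polar x z \<theta>) \<partial>angle_measure \<alpha>)
        = ennreal (g z) * (ennreal c * (\<integral>\<^sup>+\<theta>. indicator {..<r} (dunkl_polar x z \<theta>) * ennreal (1 + cos \<theta>) \<partial>angle_measure \<alpha>))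
        + ennreal (g (- z)) * (ennreal c * (\<integral>\<^sup>+\<theta>. indicator {..<r} (dunkl_polar x z \<theta>) * ennreal (1 - cos \<theta>) \<partial>angle_measure \<alpha>))"
        unfolding kz by (simp add: nn_integral_add nn_integral_cmult)
      also have "(\<integral>\<^sup>+\<theta>. indicator {..<r} (dunkl_polar x z \<theta>) * ennreal (1 + cos \<theta>) \<partial>angle_measure \<alpha>)
        = (\<integral>\<^sup>+\<theta>. indicator {..<r} (dunkl_polar (- x) z \<theta>) * ennreal (1 - cos \<theta>) \<partial>angle_measure \<alpha>)"
      proof -
        have "dunkl_polar x z (pi - \<theta>) = dunkl_polar (- x) z \<theta>" for \<theta> by (simp add: dunkl_polar_def)
        then show ?thesis
          using nn_integral_angle_measure_reflect[of "\<lambda>\<theta>. indicator {..<r} (dunkl_polar x z \<theta>) * ennreal (1 + cos \<theta>)" \<alpha>] by simp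
      qed
      finally have fin_eq: "(\<integral>\<^sup>+\<theta>. k (z, cos \<theta>) * indicator {..<r} (dunkl_polar x z \<theta>) \<partial>angle_measure \<alpha>)
        = ennreal (g z) * (ennreal c * (\<integral>\<^sup>+\<theta>. indicator {..<r} (dunkl_polar (- x) z \<theta>) * ennreal (1 - cos \<theta>) \<partial>angle_measure \<alpha>))
        + ennreal (g (- z)) * (ennreal c * (\<integral>\<^sup>+\<theta>. indicator {..<r} (dunkl_polar x z \<theta>) * ennreal (1 - cos \<theta>) \<partial>angle_measure \<alpha>))" .
      have "dunkl_polar (- x) (- z) \<theta> = dunkl_polar x z \<theta>" for \<theta> by (simp add: dunkl_polar_def)
      then show "(\<integral>\<^sup>+\<theta>. k (z, cos \<theta>) * indicator {..<r} (dunkl_polar x z \<theta>) * indicator {0<..} z \<partial>angle_measure \<alpha>)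
        = (ennreal (g z) * ball_translation \<alpha> (- x) r z + ennreal (g (- z)) * ball_translation \<alpha> (- x) r (- z)) * indicator {0<..} z"
        using \<alpha>' fin_eq by (simp add: nn_integral_multc even_translation_def c_def)
    qed
    also have "\<dots> = (\<integral>\<^sup>+z. ennreal (g z) * ball_translation \<alpha> (- x) r z \<partial>dunkl_borel \<alpha>)"
    proof -
      have "(\<lambda>z. ball_translation \<alpha> (- x) r z) \<in> borel_measurable borel"
        by (rule even_translation_measurable) measurable
      then show ?thesis by (subst nn_integral_dunkl_borel_fold[symmetric]) auto
    qed
    finally show ?thesis .
  qed
  have "(LINT y|dunkl_borel \<alpha>. \<Phi> y) = (LINT y|dunkl_borel \<alpha>. indicator {0<..} y * (\<Phi> y + \<Phi> (- y)))"
    by (rule integral_dunkl_borel_fold(2)[OF \<Phi>int])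
  also have "\<dots> = (LINT y|dunkl_borel \<alpha>. (LINT \<theta>|angle_measure \<alpha>. S y \<theta>))"
  proof (rule integral_cong_AE)
    have [measurable]: "\<Phi> \<in> borel_measurable borel" using borel_measurable_integrable[OF \<Phi>int] by simp
    show "(\<lambda>y. indicator {0<..} y * (\<Phi> y + \<Phi> (- y))) \<in> borel_measurable (dunkl_borel \<alpha>)" by measurable
    show "(\<lambda>y. LINT \<theta>|angle_measure \<alpha>. S y \<theta>) \<in> borel_measurable (dunkl_borel \<alpha>)"
      by (rule A.borel_measurable_lebesgue_integral[OF Sm])
    show "AE y in dunkl_borel \<alpha>. indicator {0<..} y * (\<Phi> y + \<Phi> (- y)) = (LINT \<theta>|angle_measure \<alpha>. S y \<theta>)"
      using AEint AEint'
    proof eventually_elim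
      fix y assume i: "integrable (angle_measure \<alpha>) (\<Psi> y)" "integrable (angle_measure \<alpha>) (\<Psi> (- y))"
      have [measurable]: "\<Psi> y \<in> borel_measurable borel" for y unfolding \<Psi>_def by measurable
      have i': "integrable (angle_measure \<alpha>) (\<lambda>\<theta>. \<Psi> (- y) (pi - \<theta>))"
        using i(2) by (subst integral_angle_measure_reflect(1)) auto
      have "\<Phi> y + \<Phi> (- y) = (LINT \<theta>|angle_measure \<alpha>. \<Psi> y \<theta>) + (LINT \<theta>|angle_measure \<alpha>. \<Psi> (- y) (pi - \<theta>))"
        unfolding \<Phi>_def by (subst integral_angle_measure_reflect(2)) auto
      also have "\<dots> = (LINT \<theta>|angle_measure \<alpha>. \<Psi> y \<theta> + \<Psi> (- y) (pi - \<theta>))"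
        by (rule Bochner_Integration.integral_add[symmetric]) (use i i' in auto)
      finally show "indicator {0<..} y * (\<Phi> y + \<Phi> (- y)) = (LINT \<theta>|angle_measure \<alpha>. S y \<theta>)"
        unfolding S_eq[symmetric] by simp
    qed
  qed
  also have "\<dots> = enn2real (\<integral>\<^sup>+y. (\<integral>\<^sup>+\<theta>. ennreal (S y \<theta>) \<partial>angle_measure \<alpha>) \<partial>dunkl_borel \<alpha>)"
  proof -
    have Sint: "integrable (angle_measure \<alpha>) (S y)" if "integrable (angle_measure \<alpha>) (\<Psi> y)" "integrable (angle_measure \<alpha>) (\<Psi> (- y))" for y
    proof -
      have [measurable]: "\<Psi> y \<in> borel_measurable borel" for y unfolding \<Psi>_def by measurable
      have "integrable (angle_measure \<alpha>) (\<lambda>\<theta>. \<Psi> (- y) (pi - \<theta>))"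
        using that(2) by (subst integral_angle_measure_reflect(1)) auto
      then have "integrable (angle_measure \<alpha>) (\<lambda>\<theta>. indicator {0<..} y * (\<Psi> y \<theta> + \<Psi> (- y) (pi - \<theta>)))"
        using that(1) by simp
      then show ?thesis by (simp add: S_eq)
    qed
    have "AE y in dunkl_borel \<alpha>. integrable (angle_measure \<alpha>) (S y)"
      using AEint AEint' by eventually_elim (rule Sint)
    then have "AE y in dunkl_borel \<alpha>. ennreal (LINT \<theta>|angle_measure \<alpha>. S y \<theta>) = (\<integral>\<^sup>+\<theta>. ennreal (S y \<theta>) \<partial>angle_measure \<alpha>)"
      by eventually_elim (auto intro!: nn_integral_eq_integral[symmetric] Snn)
    then have "(\<integral>\<^sup>+y. ennreal (LINT \<theta>|angle_measure \<alpha>. S y \<theta>) \<partial>dunkl_borel \<alpha>)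
       = (\<integral>\<^sup>+y. (\<integral>\<^sup>+\<theta>. ennreal (S y \<theta>) \<partial>angle_measure \<alpha>) \<partial>dunkl_borel \<alpha>)"
      by (rule nn_integral_cong_AE)
    moreover have "(LINT y|dunkl_borel \<alpha>. (LINT \<theta>|angle_measure \<alpha>. S y \<theta>))
      = enn2real (\<integral>\<^sup>+y. ennreal (LINT \<theta>|angle_measure \<alpha>. S y \<theta>) \<partial>dunkl_borel \<alpha>)"
      using A.borel_measurable_lebesgue_integral[OF Sm] Snn
      by (intro integral_eq_nn_integral) auto
    ultimately show ?thesis by simp
  qed
  finally show ?thesis unfolding \<Phi> Sfin .
qed

text \<open>
A null set of \<open>z\<close> is met by \<open>\<plusminus>(x, y)\<^sub>\<theta>\<close>, for almost every \<open>y\<close>, on a null set of \<open>\<theta>\<close> only. This too follows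
from the exchange of the centres, applied to the indicator of a Borel null set.
\<close>

lemma dunkl_translation_cong_AE:
  assumes [measurable]: "g' \<in> borel_measurable borel" and \<alpha>: "\<alpha> \<ge> -1/2"
    and eq: "AE z in lborel. g z = g' z"
  shows "AE y in lborel. dunkl_translation \<alpha> x g y = dunkl_translation \<alpha> x g' y"
proof (cases "\<alpha> = -1/2")
  case True
  obtain N where N: "N \<in> null_sets lborel" "\<And>z. z \<notin> N \<Longrightarrow> g z = g' z"
    by (rule AE_E3[OF eq]) (rule that, auto)
  have "{y. y - (- x) \<in> N} \<in> null_sets lborel" by (rule null_sets_translation[OF N(1)])
  from AE_not_in[OF this] show ?thesis
    by eventually_elim (use N(2) True in \<open>auto simp: dunkl_translation_def add.commute\<close>)
next
  case False
  then have \<alpha>': "\<alpha> > -1/2" using \<alpha> by auto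
  obtain N0 where N0: "N0 \<in> null_sets lborel" "\<And>z. z \<notin> N0 \<Longrightarrow> g z = g' z"
    by (rule AE_E3[OF eq]) (rule that, auto)
  then have [measurable]: "N0 \<in> sets borel" by (auto simp: null_sets_def)
  interpret A: sigma_finite_measure "angle_measure \<alpha>" by (rule sigma_finite_angle_measure)
  interpret D: sigma_finite_measure "dunkl_borel \<alpha>" by (rule sigma_finite_dunkl_borel)
  interpret P: pair_sigma_finite "dunkl_borel \<alpha>" "angle_measure \<alpha>" ..
  define h :: "real \<Rightarrow> ennreal" where "h z = indicator N0 z + indicator N0 (- z)" for z
  have [measurable]: "h \<in> borel_measurable borel" unfolding h_def by measurable
  have hz: "(\<integral>\<^sup>+z. h z * indicator {0<..<R} z \<partial>dunkl_borel \<alpha>) = 0" for R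
  proof -
    have "AE z in dunkl_borel \<alpha>. z \<notin> N0" using AE_not_in[OF N0(1)] by (rule AE_dunkl_measure(2))
    then have "(\<integral>\<^sup>+z. indicator N0 z \<partial>dunkl_borel \<alpha>) = 0"
      by (subst nn_integral_0_iff_AE) (auto elim!: eventually_mono)
    moreover have "(\<integral>\<^sup>+z. indicator N0 (- z) \<partial>dunkl_borel \<alpha>) = (\<integral>\<^sup>+z. indicator N0 z \<partial>dunkl_borel \<alpha>)"
      by (rule nn_integral_dunkl_borel_reflect) measurable
    moreover have "(\<integral>\<^sup>+z. h z * indicator {0<..<R} z \<partial>dunkl_borel \<alpha>) \<le> (\<integral>\<^sup>+z. indicator N0 z + indicator N0 (- z) \<partial>dunkl_borel \<alpha>)"
      unfolding h_def by (intro nn_integral_mono) (auto split: split_indicator)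
    moreover have "(\<integral>\<^sup>+z. indicator N0 z + indicator N0 (- z) \<partial>dunkl_borel \<alpha>)
      = (\<integral>\<^sup>+z. indicator N0 z \<partial>dunkl_borel \<alpha>) + (\<integral>\<^sup>+z. indicator N0 (- z) \<partial>dunkl_borel \<alpha>)"
      by (rule nn_integral_add) measurable
    ultimately show ?thesis by simp
  qed
  have half: "AE y in dunkl_borel \<alpha>. 0 < y \<longrightarrow> (\<forall>n::nat. y < real n \<longrightarrow> (AE \<theta> in angle_measure \<alpha>. h (dunkl_polar x y \<theta>) = 0))" for x
  proof -
    have "AE y in dunkl_borel \<alpha>. 0 < y \<longrightarrow> y < real n \<longrightarrow> (AE \<theta> in angle_measure \<alpha>. h (dunkl_polar x y \<theta>) = 0)" for n :: nat
    proof -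
      have "(\<integral>\<^sup>+y. (\<integral>\<^sup>+\<theta>. h (dunkl_polar x y \<theta>) * indicator {0<..<real n} y \<partial>angle_measure \<alpha>) \<partial>dunkl_borel \<alpha>)
        = (\<integral>\<^sup>+\<theta>. (\<integral>\<^sup>+y. h (dunkl_polar x y \<theta>) * indicator {0<..<real n} y \<partial>dunkl_borel \<alpha>) \<partial>angle_measure \<alpha>)"
        by (rule P.Fubini'[symmetric]) measurable
      also have "\<dots> \<le> emeasure (angle_measure \<alpha>) UNIV * (\<integral>\<^sup>+z. h z * indicator {0<..<\<bar>x\<bar> + real n} z \<partial>dunkl_borel \<alpha>)"
        by (rule nn_integral_polar_even_le) (use \<alpha> in auto)
      also have "\<dots> = 0" by (simp add: hz)
      finally have "(\<integral>\<^sup>+y. (\<integral>\<^sup>+\<theta>. h (dunkl_polar x y \<theta>) * indicator {0<..<real n} y \<partial>angle_measure \<alpha>) \<partial>dunkl_borel \<alpha>) = 0"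
        by simp
      then have "AE y in dunkl_borel \<alpha>. (\<integral>\<^sup>+\<theta>. h (dunkl_polar x y \<theta>) * indicator {0<..<real n} y \<partial>angle_measure \<alpha>) = 0"
        by (subst (asm) nn_integral_0_iff_AE) measurable
      then show ?thesis
      proof eventually_elim
        fix y assume "(\<integral>\<^sup>+\<theta>. h (dunkl_polar x y \<theta>) * indicator {0<..<real n} y \<partial>angle_measure \<alpha>) = 0"
        then have "AE \<theta> in angle_measure \<alpha>. h (dunkl_polar x y \<theta>) * indicator {0<..<real n} y = 0"
          by (subst (asm) nn_integral_0_iff_AE) measurable
        then show "0 < y \<longrightarrow> y < real n \<longrightarrow> (AE \<theta> in angle_measure \<alpha>. h (dunkl_polar x y \<theta>) = 0)"
          by (auto elim!: eventually_mono)
      qed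
    qed
    then have "AE y in dunkl_borel \<alpha>. \<forall>n::nat. 0 < y \<longrightarrow> y < real n \<longrightarrow> (AE \<theta> in angle_measure \<alpha>. h (dunkl_polar x y \<theta>) = 0)"
      by (subst AE_all_countable) blast
    then show ?thesis by eventually_elim blast
  qed
  have pos: "AE y in dunkl_borel \<alpha>. 0 < y \<longrightarrow> (AE \<theta> in angle_measure \<alpha>. h (dunkl_polar x y \<theta>) = 0)" for x
    using half[of x] by eventually_elim (meson reals_Archimedean2)
  have neg: "AE y in dunkl_borel \<alpha>. 0 < - y \<longrightarrow> (AE \<theta> in angle_measure \<alpha>. h (dunkl_polar x y \<theta>) = 0)"
  proof -
    have "AE y in distr (dunkl_borel \<alpha>) borel uminus. 0 < y \<longrightarrow> (AE \<theta> in angle_measure \<alpha>. h (dunkl_polar (- x) y \<theta>) = 0)"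
      unfolding dunkl_borel_reflect by (rule pos)
    then have "AE y in dunkl_borel \<alpha>. 0 < - y \<longrightarrow> (AE \<theta> in angle_measure \<alpha>. h (dunkl_polar (- x) (- y) \<theta>) = 0)"
      by (rule AE_distrD[rotated]) simp
    moreover have "dunkl_polar (- x) (- y) \<theta> = dunkl_polar x y \<theta>" for y \<theta> by (simp add: dunkl_polar_def)
    ultimately show ?thesis by simp
  qed
  have "AE y in dunkl_borel \<alpha>. AE \<theta> in angle_measure \<alpha>. h (dunkl_polar x y \<theta>) = 0"
    using pos[of x] neg AE_dunkl_borel_nonzero[of \<alpha>] by eventually_elim (metis neg_0_less_iff_less linorder_neqE_linordered_idom)
  then have "AE y in lborel. dunkl_weight \<alpha> y > 0 \<longrightarrow> (AE \<theta> in angle_measure \<alpha>. h (dunkl_polar x y \<theta>) = 0)"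
    unfolding dunkl_borel_def by (subst (asm) AE_density) auto
  then show ?thesis
    using AE_lborel_singleton[of 0]
  proof eventually_elim
    fix y :: real assume y: "dunkl_weight \<alpha> y > 0 \<longrightarrow> (AE \<theta> in angle_measure \<alpha>. h (dunkl_polar x y \<theta>) = 0)" "y \<noteq> 0"
    have "dunkl_weight \<alpha> y > 0" using y(2) \<alpha> Gamma_real_pos[of "\<alpha> + 1"] by (simp add: dunkl_weight_def)
    then have "AE \<theta> in angle_measure \<alpha>. h (dunkl_polar x y \<theta>) = 0" using y by blast
    then have "AE \<theta> in lborel. 0 < sin \<theta> powr (2 * \<alpha>) \<and> \<theta> \<in> {0<..<pi} \<longrightarrow> h (dunkl_polar x y \<theta>) = 0"
      unfolding angle_measure_def by (subst (asm) AE_density) (auto elim!: eventually_mono)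
    then have ae: "AE \<theta> in lborel. \<theta> \<in> {0<..<pi} \<longrightarrow> g (dunkl_polar x y \<theta>) = g' (dunkl_polar x y \<theta>) \<and> g (- dunkl_polar x y \<theta>) = g' (- dunkl_polar x y \<theta>)"
    proof eventually_elim
      fix \<theta> :: real assume h: "0 < sin \<theta> powr (2 * \<alpha>) \<and> \<theta> \<in> {0<..<pi} \<longrightarrow> h (dunkl_polar x y \<theta>) = 0"
      show "\<theta> \<in> {0<..<pi} \<longrightarrow> g (dunkl_polar x y \<theta>) = g' (dunkl_polar x y \<theta>) \<and> g (- dunkl_polar x y \<theta>) = g' (- dunkl_polar x y \<theta>)"
      proof
        assume t: "\<theta> \<in> {0<..<pi}"
        then have "sin \<theta> > 0" by (intro sin_gt_zero) auto
        then have "h (dunkl_polar x y \<theta>) = 0" using h t by simp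
        then have "dunkl_polar x y \<theta> \<notin> N0" "- dunkl_polar x y \<theta> \<notin> N0"
          unfolding h_def by (auto split: split_indicator_asm)
        then show "g (dunkl_polar x y \<theta>) = g' (dunkl_polar x y \<theta>) \<and> g (- dunkl_polar x y \<theta>) = g' (- dunkl_polar x y \<theta>)"
          using N0(2) by blast
      qed
    qed
    let ?I = "\<lambda>g \<theta>. indicator {0..pi} \<theta> *\<^sub>R (dunkl_integrand x g y \<theta> * sin \<theta> powr (2 * \<alpha>))"
    have "AE \<theta> in lborel. ?I g \<theta> = ?I g' \<theta>"
      using ae
    proof eventually_elim
      fix \<theta> :: real
      assume "\<theta> \<in> {0<..<pi} \<longrightarrow> g (dunkl_polar x y \<theta>) = g' (dunkl_polar x y \<theta>) \<and> g (- dunkl_polar x y \<theta>) = g' (- dunkl_polar x y \<theta>)"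
      then show "?I g \<theta> = ?I g' \<theta>"
        by (auto simp: dunkl_integrand_def less_le split: split_indicator)
    qed
    then have aeL: "AE \<theta> in lebesgue. ?I g \<theta> = ?I g' \<theta>" by (rule AE_completion)
    have m': "?I g' \<in> borel_measurable lebesgue"
      by (intro measurable_completion) measurable
    have m: "?I g \<in> borel_measurable lebesgue"
      using aeL by (intro borel_measurable_AE[OF m']) (auto elim!: eventually_mono)
    have "(LINT \<theta>|lebesgue. ?I g \<theta>) = (LINT \<theta>|lebesgue. ?I g' \<theta>)"
      by (rule integral_cong_AE[OF m m' aeL])
    then show "dunkl_translation \<alpha> x g y = dunkl_translation \<alpha> x g' y"
      using False by (simp add: dunkl_translation_def set_lebesgue_integral_def dunkl_integrand_def)
  qed
qed

text \<open>
The duality for a Lebesgue measurable \<open>g\<close>, stated with a Borel version \<open>g'\<close> of it. For \<open>\<alpha> = - 1/2\<close> the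
weight is constant and the identity is the invariance of Lebesgue measure.
\<close>

lemma integral_ball_dunkl_translation:
  fixes g g' :: "real \<Rightarrow> real"
  assumes [measurable]: "g' \<in> borel_measurable borel" and \<alpha>: "\<alpha> \<ge> -1/2"
    and eq: "AE z in lborel. g z = g' z" and g: "\<And>z. g' z \<ge> 0"
    and loc: "\<And>R. ball_integral \<alpha> g' 0 R < \<infinity>"
  shows "(LINT y:ball 0 r|dunkl_measure \<alpha>. dunkl_translation \<alpha> x g y)
    = enn2real (\<integral>\<^sup>+z. ennreal (g' z) * ball_translation \<alpha> (- x) r z \<partial>dunkl_borel \<alpha>)"
proof -
  have [measurable]: "(\<lambda>y. dunkl_translation \<alpha> x g' y) \<in> borel_measurable borel"
    by (rule dunkl_translation_measurable) measurable
  let ?I = "\<lambda>g y. indicator (ball 0 r) y *\<^sub>R dunkl_translation \<alpha> x g y"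
  have "AE y in lborel. ?I g y = ?I g' y"
    using dunkl_translation_cong_AE[OF assms(1) \<alpha> eq, of x] by eventually_elim simp
  then have aeL: "AE y in lebesgue. ?I g y = ?I g' y" by (rule AE_completion)
  have m': "?I g' \<in> borel_measurable lebesgue" by (intro measurable_completion) measurable
  have m: "?I g \<in> borel_measurable lebesgue"
    using aeL by (intro borel_measurable_AE[OF m']) (auto elim!: eventually_mono)
  have sd: "borel_measurable (dunkl_measure \<alpha>) = borel_measurable lebesgue"
    by (intro measurable_cong_sets) (auto simp: dunkl_measure_def)
  have "(LINT y:ball 0 r|dunkl_measure \<alpha>. dunkl_translation \<alpha> x g y) = (LINT y|dunkl_measure \<alpha>. ?I g y)"
    by (simp add: set_lebesgue_integral_def)
  also have "\<dots> = (LINT y|dunkl_measure \<alpha>. ?I g' y)"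
  proof (rule integral_cong_AE)
    show "AE y in dunkl_measure \<alpha>. ?I g y = ?I g' y"
      by (rule AE_dunkl_measure(1)) fact
  qed (use m m' sd in auto)
  also have "\<dots> = (LINT y|dunkl_borel \<alpha>. ?I g' y)"
    by (rule integral_dunkl_measure_eq(1)) (use \<alpha> in auto)
  also have "\<dots> = enn2real (\<integral>\<^sup>+z. ennreal (g' z) * ball_translation \<alpha> (- x) r z \<partial>dunkl_borel \<alpha>)"
  proof (cases "\<alpha> = -1/2")
    case False
    then have "\<alpha> > -1/2" using \<alpha> by auto
    from integral_ball_dunkl_translation_borel[OF assms(1) this g loc, of r x] show ?thesis by simp
  next
    case True
    have w: "dunkl_weight \<alpha> y = dunkl_weight \<alpha> 1" if "y \<noteq> 0" for y using True that by (simp add: dunkl_weight_def)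
    have inv: "(\<integral>\<^sup>+y. f (x + y) \<partial>dunkl_borel \<alpha>) = (\<integral>\<^sup>+y. f y \<partial>dunkl_borel \<alpha>)" if [measurable]: "f \<in> borel_measurable borel" for f
    proof -
      have c: "(\<integral>\<^sup>+y. k y \<partial>dunkl_borel \<alpha>) = (\<integral>\<^sup>+y. ennreal (dunkl_weight \<alpha> 1) * k y \<partial>lborel)" if [measurable]: "k \<in> borel_measurable borel" for k
      proof -
        have "AE y in lborel. ennreal (dunkl_weight \<alpha> y) * k y = ennreal (dunkl_weight \<alpha> 1) * k y"
          using AE_lborel_singleton[of 0] by eventually_elim (metis w)
        then show ?thesis by (simp add: nn_integral_dunkl_borel nn_integral_cong_AE)
      qed
      show ?thesis using nn_integral_real_affine[of "\<lambda>y. ennreal (dunkl_weight \<alpha> 1) * f y" 1 x] by (simp add: c)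
    qed
    have "(LINT y|dunkl_borel \<alpha>. ?I g' y) = enn2real (\<integral>\<^sup>+y. ennreal (?I g' y) \<partial>dunkl_borel \<alpha>)"
      using g True by (intro integral_eq_nn_integral) (auto simp: dunkl_translation_def)
    also have "(\<integral>\<^sup>+y. ennreal (?I g' y) \<partial>dunkl_borel \<alpha>) = (\<integral>\<^sup>+y. ennreal (g' (x + y)) * indicator (ball 0 r) (- x + (x + y)) \<partial>dunkl_borel \<alpha>)"
      using True by (intro nn_integral_cong) (auto simp: dunkl_translation_def split: split_indicator)
    also have "\<dots> = (\<integral>\<^sup>+y. ennreal (g' y) * indicator (ball 0 r) (- x + y) \<partial>dunkl_borel \<alpha>)"
      by (rule inv) measurable
    also have "\<dots> = (\<integral>\<^sup>+z. ennreal (g' z) * ball_translation \<alpha> (- x) r z \<partial>dunkl_borel \<alpha>)"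
      using True by (intro nn_integral_cong) (auto simp: even_translation_def split: split_indicator)
    finally show ?thesis .
  qed
  finally show ?thesis .
qed

section \<open>A weak type inequality for averages over balls\<close>

text \<open>
A doubling substitute for the measure of the ball of radius \<open>r\<close> around \<open>x\<close>. It bounds that measure, and
\<open>r\<^sup>d / dunkl_vol \<alpha> x r\<close> is, up to a constant, the size of the translate by \<open>x\<close> of the ball of radius \<open>r\<close> around \<open>0\<close>.
\<close>

definition dunkl_vol :: "real \<Rightarrow> real \<Rightarrow> real \<Rightarrow> real" where
  "dunkl_vol \<alpha> x r = 2 * dunkl_weight \<alpha> 1 * r * (\<bar>x\<bar> + r) powr (2 * \<alpha> + 1)"

text \<open>
The Morrey condition with constant \<open>N\<close> in the doubling space; \<open>dunkl_vol\<close> replaces the measure of the ball.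
\<close>

definition ball_morrey_bound :: "real \<Rightarrow> real \<Rightarrow> (real \<Rightarrow> real) \<Rightarrow> (real \<Rightarrow> real) \<Rightarrow> real \<Rightarrow> bool" where
  "ball_morrey_bound \<alpha> p \<phi> g N \<longleftrightarrow> (\<forall>x. \<forall>r>0.
     ball_integral \<alpha> (\<lambda>y. g y powr p) x r \<le> ennreal (dunkl_vol \<alpha> x r * (\<phi> r * N) powr p))"

lemma dunkl_weight_1_pos: "\<alpha> \<ge> -1/2 \<Longrightarrow> dunkl_weight \<alpha> 1 > 0"
  unfolding dunkl_weight_def using Gamma_real_pos[of "\<alpha> + 1"] by simp

lemma dunkl_vol_pos: "\<alpha> \<ge> -1/2 \<Longrightarrow> r > 0 \<Longrightarrow> dunkl_vol \<alpha> x r > 0"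
  unfolding dunkl_vol_def using dunkl_weight_1_pos[of \<alpha>] by (auto intro!: mult_pos_pos)

lemma dunkl_vol_uminus [simp]: "dunkl_vol \<alpha> (- x) r = dunkl_vol \<alpha> x r"
  by (simp add: dunkl_vol_def)

lemma emeasure_ball_le_dunkl_vol:
  assumes \<alpha>: "\<alpha> \<ge> -1/2" and r: "r > 0"
  shows "emeasure (dunkl_borel \<alpha>) (ball x r) \<le> ennreal (dunkl_vol \<alpha> x r)"
proof -
  let ?w = "dunkl_weight \<alpha> 1 * (\<bar>x\<bar> + r) powr (2 * \<alpha> + 1)"
  have w: "?w \<ge> 0" using dunkl_weight_1_pos[OF \<alpha>] by simp
  have "emeasure (dunkl_borel \<alpha>) (ball x r) = (\<integral>\<^sup>+y. indicator (ball x r) y \<partial>dunkl_borel \<alpha>)" by simp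
  also have "\<dots> = (\<integral>\<^sup>+y. ennreal (dunkl_weight \<alpha> y) * indicator (ball x r) y \<partial>lborel)"
    by (rule nn_integral_dunkl_borel) (intro borel_measurable_indicator, simp)
  also have "\<dots> \<le> (\<integral>\<^sup>+y. ennreal ?w * indicator {x - r..x + r} y \<partial>lborel)"
  proof (rule nn_integral_mono)
    fix y :: real
    have "dunkl_weight \<alpha> y \<le> ?w" if "y \<in> ball x r"
    proof -
      have "\<bar>y\<bar> powr (2 * \<alpha> + 1) \<le> (\<bar>x\<bar> + r) powr (2 * \<alpha> + 1)"
        using that \<alpha> by (intro powr_mono2) (auto simp: dist_real_def)
      then show ?thesis using dunkl_weight_1_pos[OF \<alpha>] by (simp add: dunkl_weight_def mult_left_mono)
    qed
    then show "ennreal (dunkl_weight \<alpha> y) * indicator (ball x r) y \<le> ennreal ?w * indicator {x - r..x + r} y"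
      by (auto split: split_indicator intro!: ennreal_leI simp: dist_real_def)
  qed
  also have "\<dots> = ennreal ?w * ennreal (2 * r)"
    using r by (subst nn_integral_cmult) auto
  also have "\<dots> = ennreal (dunkl_vol \<alpha> x r)"
    using w r by (subst ennreal_mult[symmetric]) (auto simp: dunkl_vol_def mult_ac)
  finally show ?thesis .
qed

lemma dunkl_vol_dilate:
  assumes \<alpha>: "\<alpha> \<ge> -1/2" and r: "r > 0" and a: "a \<ge> 1"
  shows "dunkl_vol \<alpha> x (a * r) \<le> a powr (2 * \<alpha> + 2) * dunkl_vol \<alpha> x r"
proof -
  have "(\<bar>x\<bar> + a * r) powr (2 * \<alpha> + 1) \<le> (a * (\<bar>x\<bar> + r)) powr (2 * \<alpha> + 1)"
    using assms mult_right_mono[OF a, of "\<bar>x\<bar>"] by (intro powr_mono2) (auto simp: distrib_left)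
  also have "\<dots> = a powr (2 * \<alpha> + 1) * (\<bar>x\<bar> + r) powr (2 * \<alpha> + 1)"
    by (simp add: powr_mult)
  finally have "2 * dunkl_weight \<alpha> 1 * (a * r) * (\<bar>x\<bar> + a * r) powr (2 * \<alpha> + 1)
    \<le> 2 * dunkl_weight \<alpha> 1 * (a * r) * (a powr (2 * \<alpha> + 1) * (\<bar>x\<bar> + r) powr (2 * \<alpha> + 1))"
    using dunkl_weight_1_pos[OF \<alpha>] r a by (intro mult_left_mono) auto
  also have "\<dots> = (a * a powr (2 * \<alpha> + 1)) * dunkl_vol \<alpha> x r" by (simp add: dunkl_vol_def)
  also have "a * a powr (2 * \<alpha> + 1) = a powr (2 * \<alpha> + 2)"
    using powr_add[of a 1 "2 * \<alpha> + 1"] a by (simp add: algebra_simps)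
  finally show ?thesis by (simp add: dunkl_vol_def)
qed

lemma powr_eq_dunkl_vol:
  assumes "r > 0" "\<alpha> \<ge> -1/2"
  shows "(r / (\<bar>x\<bar> + r)) powr (2 * \<alpha> + 1) * dunkl_vol \<alpha> x r = 2 * dunkl_weight \<alpha> 1 * r powr dunkl_dim \<alpha>"
proof -
  have "r * r powr (2 * \<alpha> + 1) = r powr (2 * \<alpha> + 2)"
    using powr_add[of r 1 "2 * \<alpha> + 1"] assms by (simp add: algebra_simps)
  then show ?thesis
    using assms by (simp add: powr_divide dunkl_vol_def dunkl_dim_def field_simps)
qed

text \<open>
Only the part of \<open>F\<close> above \<open>m / 2\<close> is needed on the right, since the rest contributes at most half of the
assumed excess over \<open>m * dunkl_vol \<alpha> x t\<close> on each ball. A disjoint subfamily of the balls whose fivefold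
enlargements cover \<open>E\<close> then gives the estimate.
\<close>

lemma dunkl_weak_type:
  fixes F :: "real \<Rightarrow> real"
  assumes \<alpha>: "\<alpha> \<ge> -1/2" and [measurable]: "F \<in> borel_measurable borel" and F: "\<And>z. F z \<ge> 0"
    and lam: "m > 0" and E: "E \<in> sets borel"
    and big: "\<And>x. x \<in> E \<Longrightarrow> \<exists>t. 0 < t \<and> t \<le> R \<and>
       ennreal (m * dunkl_vol \<alpha> x t) < ball_integral \<alpha> F x t"
  shows "emeasure (dunkl_borel \<alpha>) E
    \<le> ennreal (2 * 5 powr (2 * \<alpha> + 2) / m) * (\<integral>\<^sup>+z. ennreal (F z) * indicator {z. m / 2 < F z} z \<partial>dunkl_borel \<alpha>)"
proof -
  define G where "G z = ennreal (F z) * indicator {z. m / 2 < F z} z" for z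
  have [measurable]: "G \<in> borel_measurable borel" unfolding G_def by measurable
  obtain t where t: "\<And>x. x \<in> E \<Longrightarrow> 0 < t x \<and> t x \<le> R"
    and tb: "\<And>x. x \<in> E \<Longrightarrow> ennreal (m * dunkl_vol \<alpha> x (t x)) < ball_integral \<alpha> F x (t x)"
    using big by metis
  have vol: "ennreal (dunkl_vol \<alpha> x (t x)) \<le> ennreal (2 / m) * (\<integral>\<^sup>+z. G z * indicator (ball x (t x)) z \<partial>dunkl_borel \<alpha>)"
    if x: "x \<in> E" for x
  proof -
    let ?V = "dunkl_vol \<alpha> x (t x)"
    have V: "?V > 0" using t[OF x] \<alpha> by (intro dunkl_vol_pos) auto
    have "ennreal (m * ?V) < ball_integral \<alpha> F x (t x)" by (rule tb[OF x])
    also have "\<dots> \<le> (\<integral>\<^sup>+z. G z * indicator (ball x (t x)) z + ennreal (m / 2) * indicator (ball x (t x)) z \<partial>dunkl_borel \<alpha>)"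
      unfolding G_def by (intro nn_integral_mono) (auto split: split_indicator intro!: ennreal_leI)
    also have "\<dots> = (\<integral>\<^sup>+z. G z * indicator (ball x (t x)) z \<partial>dunkl_borel \<alpha>) + ennreal (m / 2) * emeasure (dunkl_borel \<alpha>) (ball x (t x))"
      by (simp add: nn_integral_add nn_integral_cmult)
    also have "\<dots> \<le> (\<integral>\<^sup>+z. G z * indicator (ball x (t x)) z \<partial>dunkl_borel \<alpha>) + ennreal (m / 2) * ennreal ?V"
      using t[OF x] \<alpha> by (intro add_left_mono mult_left_mono emeasure_ball_le_dunkl_vol) auto
    finally have less: "ennreal (m * ?V) < (\<integral>\<^sup>+z. G z * indicator (ball x (t x)) z \<partial>dunkl_borel \<alpha>) + ennreal (m / 2) * ennreal ?V" .
    show ?thesis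
    proof (cases "\<integral>\<^sup>+z. G z * indicator (ball x (t x)) z \<partial>dunkl_borel \<alpha>")
      case (real a)
      have "ennreal (m * ?V) < ennreal (a + m / 2 * ?V)"
        using less real lam V by (simp add: ennreal_plus ennreal_mult'[symmetric])
      then have "m * ?V < a + m / 2 * ?V" using lam V by (subst (asm) ennreal_less_iff) auto
      then have "?V \<le> 2 / m * a" using lam by (simp add: field_simps)
      then show ?thesis using real lam by (simp add: ennreal_mult'[symmetric] ennreal_leI)
    next
      case top
      then show ?thesis using lam by (simp add: ennreal_mult_top)
    qed
  qed
  obtain C where C: "countable C" "C \<subseteq> E"
    and disj: "pairwise (\<lambda>i j. disjnt (cball i (t i)) (cball j (t j))) C"
    and cov: "\<And>i. i \<in> E \<Longrightarrow> \<exists>j. j \<in> C \<and> \<not> disjnt (cball i (t i)) (cball j (t j)) \<and> cball i (t i) \<subseteq> ball j (5 * t j)"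
    by (rule Vitali_covering_lemma_cballs_balls[of E t R "\<lambda>x. x"]) (use t in blast, rule that, assumption+)
  have "emeasure (dunkl_borel \<alpha>) E = (\<integral>\<^sup>+x. indicator E x \<partial>dunkl_borel \<alpha>)" using E by simp
  also have "\<dots> \<le> (\<integral>\<^sup>+x. (\<integral>\<^sup>+j. indicator (ball j (5 * t j)) x \<partial>count_space C) \<partial>dunkl_borel \<alpha>)"
  proof (rule nn_integral_mono)
    fix x :: real
    show "indicator E x \<le> (\<integral>\<^sup>+j. indicator (ball j (5 * t j)) x \<partial>count_space C)"
    proof (cases "x \<in> E")
      case True
      then obtain j where j: "j \<in> C" "cball x (t x) \<subseteq> ball j (5 * t j)" using cov by blast
      then have "x \<in> ball j (5 * t j)" using t[OF True] by (auto simp: subset_eq)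
      then show ?thesis using nn_integral_ge_point[OF j(1), of "\<lambda>j. indicator (ball j (5 * t j)) x"] True by simp
    qed simp
  qed
  also have "\<dots> = (\<integral>\<^sup>+j. (\<integral>\<^sup>+x. indicator (ball j (5 * t j)) x \<partial>dunkl_borel \<alpha>) \<partial>count_space C)"
    by (rule nn_integral_count_space_nn_integral[OF C(1)]) simp
  also have "\<dots> \<le> (\<integral>\<^sup>+j. ennreal (2 * 5 powr (2 * \<alpha> + 2) / m) * (\<integral>\<^sup>+z. G z * indicator (ball j (t j)) z \<partial>dunkl_borel \<alpha>) \<partial>count_space C)"
  proof (rule nn_integral_mono)
    fix j assume "j \<in> space (count_space C)"
    then have j: "j \<in> E" using C by auto
    have "(\<integral>\<^sup>+x. indicator (ball j (5 * t j)) x \<partial>dunkl_borel \<alpha>) = emeasure (dunkl_borel \<alpha>) (ball j (5 * t j))" by simp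
    also have "\<dots> \<le> ennreal (dunkl_vol \<alpha> j (5 * t j))" using t[OF j] by (intro emeasure_ball_le_dunkl_vol \<alpha>) auto
    also have "\<dots> \<le> ennreal (5 powr (2 * \<alpha> + 2) * dunkl_vol \<alpha> j (t j))"
      using t[OF j] by (intro ennreal_leI dunkl_vol_dilate \<alpha>) auto
    also have "\<dots> = ennreal (5 powr (2 * \<alpha> + 2)) * ennreal (dunkl_vol \<alpha> j (t j))"
      by (rule ennreal_mult') simp
    also have "\<dots> \<le> ennreal (5 powr (2 * \<alpha> + 2)) * (ennreal (2 / m) * (\<integral>\<^sup>+z. G z * indicator (ball j (t j)) z \<partial>dunkl_borel \<alpha>))"
      by (intro mult_left_mono vol j) auto
    also have "\<dots> = ennreal (5 powr (2 * \<alpha> + 2) * (2 / m)) * (\<integral>\<^sup>+z. G z * indicator (ball j (t j)) z \<partial>dunkl_borel \<alpha>)"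
      by (subst ennreal_mult'[of "5 powr (2 * \<alpha> + 2)"]) (auto simp: mult.assoc)
    finally show "(\<integral>\<^sup>+x. indicator (ball j (5 * t j)) x \<partial>dunkl_borel \<alpha>)
      \<le> ennreal (2 * 5 powr (2 * \<alpha> + 2) / m) * (\<integral>\<^sup>+z. G z * indicator (ball j (t j)) z \<partial>dunkl_borel \<alpha>)"
      by (simp add: mult.commute)
  qed
  also have "\<dots> = ennreal (2 * 5 powr (2 * \<alpha> + 2) / m) * (\<integral>\<^sup>+j. (\<integral>\<^sup>+z. G z * indicator (ball j (t j)) z \<partial>dunkl_borel \<alpha>) \<partial>count_space C)"
    by (rule nn_integral_cmult) simp
  also have "(\<integral>\<^sup>+j. (\<integral>\<^sup>+z. G z * indicator (ball j (t j)) z \<partial>dunkl_borel \<alpha>) \<partial>count_space C)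
    = (\<integral>\<^sup>+j. emeasure (density (dunkl_borel \<alpha>) G) (ball j (t j)) \<partial>count_space C)"
    by (intro nn_integral_cong) (simp add: emeasure_density)
  also have "\<dots> = emeasure (density (dunkl_borel \<alpha>) G) (\<Union>j\<in>C. ball j (t j))"
  proof (rule emeasure_UN_countable[symmetric])
    show "disjoint_family_on (\<lambda>j. ball j (t j)) C"
      unfolding disjoint_family_on_def
    proof (intro ballI impI)
      fix i j assume "i \<in> C" "j \<in> C" "i \<noteq> j"
      then have "disjnt (cball i (t i)) (cball j (t j))" using disj by (auto simp: pairwise_def)
      then show "ball i (t i) \<inter> ball j (t j) = {}"
        using ball_subset_cball[of i "t i"] ball_subset_cball[of j "t j"] unfolding disjnt_def by blast
    qed
  qed (use C in auto)
  also have "\<dots> \<le> emeasure (density (dunkl_borel \<alpha>) G) UNIV"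
    by (intro emeasure_mono) auto
  also have "\<dots> = (\<integral>\<^sup>+z. G z \<partial>dunkl_borel \<alpha>)" by (simp add: emeasure_density)
  finally show ?thesis unfolding G_def by (simp add: mult_left_mono)
qed

section \<open>From weak type to strong type\<close>

lemma nn_integral_powr_Icc:
  assumes "0 < a" "a \<le> b" "s \<noteq> 0"
  shows "(\<integral>\<^sup>+t. ennreal (t powr (s - 1)) * indicator {a..b} t \<partial>lborel) = ennreal ((b powr s - a powr s) / s)"
proof -
  have "(\<integral>\<^sup>+t. ennreal (t powr (s - 1)) * indicator {a..b} t \<partial>lborel) = ennreal (b powr s / s - a powr s / s)"
    using assms by (intro nn_integral_FTC_Icc) (auto intro!: derivative_eq_intros)
  then show ?thesis by (simp add: diff_divide_distrib)
qed

text \<open>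
Marcinkiewicz interpolation between the weak bound at \<open>1\<close> and the trivial one at \<open>\<infinity>\<close>: integrate the
weak bound against \<open>p m\<^bsup>p - 1\<^esup>\<close> and exchange the integrals. The weak bound is only available above the
level \<open>l0\<close>; below it the trivial estimate \<open>w \<le> l0\<close> accounts for the first summand.
\<close>

lemma weak_type_imp_strong_type:
  fixes w F :: "'a \<Rightarrow> real"
  assumes M: "sigma_finite_measure M" and [measurable]: "w \<in> borel_measurable M" "F \<in> borel_measurable M" "B \<in> sets M"
    and nn: "\<And>x. w x \<ge> 0" "\<And>x. F x \<ge> 0" and p: "p > 1" and l0p: "l0 > 0" and C: "C \<ge> 0"
    and weak: "\<And>m. m > l0 \<Longrightarrow> emeasure M {x \<in> space M. x \<in> B \<and> m < w x}
       \<le> ennreal (C / m) * (\<integral>\<^sup>+z. ennreal (F z) * indicator {z. m / 2 < F z} z \<partial>M)"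
  shows "(\<integral>\<^sup>+x. ennreal (w x powr p) * indicator B x \<partial>M)
    \<le> ennreal (l0 powr p) * emeasure M B + ennreal (C * p * 2 powr (p - 1) / (p - 1)) * (\<integral>\<^sup>+z. ennreal (F z powr p) \<partial>M)"
proof -
  interpret M: sigma_finite_measure M by (rule M)
  interpret P: pair_sigma_finite M lborel ..
  have joint: "(\<lambda>(x, t). ennreal (p * t powr (p - 1)) * indicator {l0<..} t * (indicator B x * indicator {t<..} (w x))) \<in> borel_measurable (M \<Otimes>\<^sub>M lborel)"
  proof -
    have "(\<lambda>q. indicator {snd q<..} (w (fst q)) :: ennreal) = (\<lambda>q. indicator {q. snd q < w (fst q)} q)"
      by (auto split: split_indicator)
    moreover have "{q \<in> space (M \<Otimes>\<^sub>M lborel). snd q < w (fst q)} \<in> sets (M \<Otimes>\<^sub>M lborel)" by measurable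
    then have "(\<lambda>q. indicator {q. snd q < w (fst q)} q :: ennreal) \<in> borel_measurable (M \<Otimes>\<^sub>M lborel)"
      by (intro borel_measurable_indicator') simp
    ultimately have [measurable]: "(\<lambda>q. indicator {snd q<..} (w (fst q)) :: ennreal) \<in> borel_measurable (M \<Otimes>\<^sub>M lborel)" by simp
    show ?thesis unfolding case_prod_beta' by measurable
  qed
  have "(\<integral>\<^sup>+x. ennreal (w x powr p) * indicator B x \<partial>M)
    \<le> (\<integral>\<^sup>+x. ennreal (l0 powr p) * indicator B x
        + (\<integral>\<^sup>+t. ennreal (p * t powr (p - 1)) * indicator {l0<..} t * (indicator B x * indicator {t<..} (w x)) \<partial>lborel) \<partial>M)"
  proof (rule nn_integral_mono)
    fix x
    show "ennreal (w x powr p) * indicator B x \<le> ennreal (l0 powr p) * indicator B x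
        + (\<integral>\<^sup>+t. ennreal (p * t powr (p - 1)) * indicator {l0<..} t * (indicator B x * indicator {t<..} (w x)) \<partial>lborel)"
    proof (cases "x \<in> B")
      case True
      show ?thesis
      proof (cases "w x \<le> l0")
        case True
        then have "ennreal (w x powr p) \<le> ennreal (l0 powr p)"
          using p nn by (intro ennreal_leI powr_mono2) auto
        then show ?thesis using \<open>x \<in> B\<close> by (simp add: add_increasing2)
      next
        case False
        have "ennreal (w x powr p) = ennreal (l0 powr p) + ennreal (p * ((w x powr p - l0 powr p) / p))"
          using False l0p p by (subst ennreal_plus[symmetric]) (auto intro!: powr_mono2)
        also have "ennreal (p * ((w x powr p - l0 powr p) / p)) = ennreal p * (\<integral>\<^sup>+t. ennreal (t powr (p - 1)) * indicator {l0..w x} t \<partial>lborel)"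
          using p False l0p by (subst nn_integral_powr_Icc) (auto simp: ennreal_mult'[symmetric])
        also have "\<dots> = (\<integral>\<^sup>+t. ennreal p * (ennreal (t powr (p - 1)) * indicator {l0..w x} t) \<partial>lborel)"
          by (rule nn_integral_cmult[symmetric]) measurable
        also have "\<dots> = (\<integral>\<^sup>+t. ennreal (p * t powr (p - 1)) * indicator {l0<..} t * (indicator B x * indicator {t<..} (w x)) \<partial>lborel)"
        proof (rule nn_integral_cong_AE)
          have "AE t in lborel. t \<noteq> l0 \<and> t \<noteq> w x" by (auto intro: AE_lborel_singleton)
          then show "AE t in lborel. ennreal p * (ennreal (t powr (p - 1)) * indicator {l0..w x} t)
            = ennreal (p * t powr (p - 1)) * indicator {l0<..} t * (indicator B x * indicator {t<..} (w x))"
            by eventually_elim (use p \<open>x \<in> B\<close> in \<open>auto simp: ennreal_mult' split: split_indicator\<close>)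
        qed
        finally show ?thesis using \<open>x \<in> B\<close> by simp
      qed
    qed simp
  qed
  also have "\<dots> = ennreal (l0 powr p) * emeasure M B
    + (\<integral>\<^sup>+x. (\<integral>\<^sup>+t. ennreal (p * t powr (p - 1)) * indicator {l0<..} t * (indicator B x * indicator {t<..} (w x)) \<partial>lborel) \<partial>M)"
    using lborel.borel_measurable_nn_integral[OF joint] by (subst nn_integral_add) (auto simp: nn_integral_cmult)
  also have "(\<integral>\<^sup>+x. (\<integral>\<^sup>+t. ennreal (p * t powr (p - 1)) * indicator {l0<..} t * (indicator B x * indicator {t<..} (w x)) \<partial>lborel) \<partial>M)
    = (\<integral>\<^sup>+t. (\<integral>\<^sup>+x. ennreal (p * t powr (p - 1)) * indicator {l0<..} t * (indicator B x * indicator {t<..} (w x)) \<partial>M) \<partial>lborel)"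
    using P.Fubini'[OF joint] by simp
  also have "\<dots> \<le> (\<integral>\<^sup>+t. (\<integral>\<^sup>+z. ennreal (C * p) * (ennreal (t powr (p - 1 - 1)) * indicator {l0<..} t) * (ennreal (F z) * indicator {z. t / 2 < F z} z) \<partial>M) \<partial>lborel)"
  proof (rule nn_integral_mono)
    fix t :: real
    show "(\<integral>\<^sup>+x. ennreal (p * t powr (p - 1)) * indicator {l0<..} t * (indicator B x * indicator {t<..} (w x)) \<partial>M)
      \<le> (\<integral>\<^sup>+z. ennreal (C * p) * (ennreal (t powr (p - 1 - 1)) * indicator {l0<..} t) * (ennreal (F z) * indicator {z. t / 2 < F z} z) \<partial>M)"
    proof (cases "t > l0")
      case True
      have "(\<integral>\<^sup>+x. indicator B x * indicator {t<..} (w x) \<partial>M) = (\<integral>\<^sup>+x. indicator {x \<in> space M. x \<in> B \<and> t < w x} x \<partial>M)"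
        by (intro nn_integral_cong) (auto split: split_indicator)
      also have "\<dots> = emeasure M {x \<in> space M. x \<in> B \<and> t < w x}" by (rule nn_integral_indicator) measurable
      finally have e: "(\<integral>\<^sup>+x. indicator B x * indicator {t<..} (w x) \<partial>M) = emeasure M {x \<in> space M. x \<in> B \<and> t < w x}" .
      have "(\<integral>\<^sup>+x. ennreal (p * t powr (p - 1)) * indicator {l0<..} t * (indicator B x * indicator {t<..} (w x)) \<partial>M)
        = ennreal (p * t powr (p - 1)) * (\<integral>\<^sup>+x. indicator B x * indicator {t<..} (w x) \<partial>M)"
        using True by (simp add: nn_integral_cmult)
      also have "\<dots> \<le> ennreal (p * t powr (p - 1)) * (ennreal (C / t) * (\<integral>\<^sup>+z. ennreal (F z) * indicator {z. t / 2 < F z} z \<partial>M))"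
        unfolding e by (intro mult_left_mono weak True) auto
      also have "\<dots> = ennreal (p * t powr (p - 1) * (C / t)) * (\<integral>\<^sup>+z. ennreal (F z) * indicator {z. t / 2 < F z} z \<partial>M)"
        using p by (subst ennreal_mult') (auto simp: mult.assoc)
      also have "p * t powr (p - 1) * (C / t) = C * p * t powr (p - 1 - 1)"
        using True l0p powr_diff[of t "p - 1" 1] by simp
      also have "ennreal (C * p * t powr (p - 1 - 1)) * (\<integral>\<^sup>+z. ennreal (F z) * indicator {z. t / 2 < F z} z \<partial>M)
        = (\<integral>\<^sup>+z. ennreal (C * p) * (ennreal (t powr (p - 1 - 1)) * indicator {l0<..} t) * (ennreal (F z) * indicator {z. t / 2 < F z} z) \<partial>M)"
        using True C p by (subst nn_integral_cmult) (auto simp: ennreal_mult')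
      finally show ?thesis .
    qed simp
  qed
  also have "\<dots> = (\<integral>\<^sup>+z. (\<integral>\<^sup>+t. ennreal (C * p) * (ennreal (t powr (p - 1 - 1)) * indicator {l0<..} t) * (ennreal (F z) * indicator {z. t / 2 < F z} z) \<partial>lborel) \<partial>M)"
  proof -
    have "(\<lambda>(z, t). ennreal (C * p) * (ennreal (t powr (p - 1 - 1)) * indicator {l0<..} t) * (ennreal (F z) * indicator {z. t / 2 < F z} z)) \<in> borel_measurable (M \<Otimes>\<^sub>M lborel)"
    proof -
      have "(\<lambda>q. indicator {z. snd q / 2 < F z} (fst q) :: ennreal) = (\<lambda>q. indicator {q. snd q / 2 < F (fst q)} q)"
        by (auto split: split_indicator)
      moreover have "{q \<in> space (M \<Otimes>\<^sub>M lborel). snd q / 2 < F (fst q)} \<in> sets (M \<Otimes>\<^sub>M lborel)" by measurable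
      then have "(\<lambda>q. indicator {q. snd q / 2 < F (fst q)} q :: ennreal) \<in> borel_measurable (M \<Otimes>\<^sub>M lborel)"
        by (intro borel_measurable_indicator') simp
      ultimately have [measurable]: "(\<lambda>q. indicator {z. snd q / 2 < F z} (fst q) :: ennreal) \<in> borel_measurable (M \<Otimes>\<^sub>M lborel)" by simp
      show ?thesis unfolding case_prod_beta' by measurable
    qed
    from P.Fubini'[OF this] show ?thesis by simp
  qed
  also have "\<dots> \<le> (\<integral>\<^sup>+z. ennreal (C * p * 2 powr (p - 1) / (p - 1)) * ennreal (F z powr p) \<partial>M)"
  proof (rule nn_integral_mono)
    fix z
    show "(\<integral>\<^sup>+t. ennreal (C * p) * (ennreal (t powr (p - 1 - 1)) * indicator {l0<..} t) * (ennreal (F z) * indicator {z. t / 2 < F z} z) \<partial>lborel)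
      \<le> ennreal (C * p * 2 powr (p - 1) / (p - 1)) * ennreal (F z powr p)"
    proof (cases "l0 \<le> 2 * F z")
      case True
      then have Fz: "F z > 0" using l0p by linarith
      have "(\<integral>\<^sup>+t. ennreal (C * p) * (ennreal (t powr (p - 1 - 1)) * indicator {l0<..} t) * (ennreal (F z) * indicator {z. t / 2 < F z} z) \<partial>lborel)
        \<le> (\<integral>\<^sup>+t. ennreal (C * p * F z) * (ennreal (t powr (p - 1 - 1)) * indicator {l0..2 * F z} t) \<partial>lborel)"
        using C p nn by (intro nn_integral_mono) (auto split: split_indicator simp: ennreal_mult mult_ac)
      also have "\<dots> = ennreal (C * p * F z) * ennreal (((2 * F z) powr (p - 1) - l0 powr (p - 1)) / (p - 1))"
        using True l0p p by (subst nn_integral_cmult, measurable) (subst nn_integral_powr_Icc, auto)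
      also have "\<dots> \<le> ennreal (C * p * F z) * ennreal ((2 * F z) powr (p - 1) / (p - 1))"
        using p by (intro mult_left_mono ennreal_leI divide_right_mono) auto
      also have "\<dots> = ennreal (C * p * F z * ((2 * F z) powr (p - 1) / (p - 1)))"
        using C p nn by (subst ennreal_mult) auto
      also have "C * p * F z * ((2 * F z) powr (p - 1) / (p - 1)) = C * p * 2 powr (p - 1) / (p - 1) * F z powr p"
      proof -
        have "F z * (F z powr (p - 1)) = F z powr p" using powr_add[of "F z" 1 "p - 1"] Fz by simp
        then show ?thesis using Fz by (simp add: powr_mult mult_ac)
      qed
      also have "ennreal (C * p * 2 powr (p - 1) / (p - 1) * F z powr p)
        = ennreal (C * p * 2 powr (p - 1) / (p - 1)) * ennreal (F z powr p)"
        by (rule ennreal_mult) (use C p in auto)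
      finally show ?thesis .
    next
      case False
      then have "ennreal (C * p) * (ennreal (t powr (p - 1 - 1)) * indicator {l0<..} t) * (ennreal (F z) * indicator {z. t / 2 < F z} z) = 0" for t
        by (auto split: split_indicator)
      then show ?thesis by (simp only: nn_integral_const) simp
    qed
  qed
  also have "\<dots> = ennreal (C * p * 2 powr (p - 1) / (p - 1)) * (\<integral>\<^sup>+z. ennreal (F z powr p) \<partial>M)"
    by (rule nn_integral_cmult) measurable
  finally show ?thesis by (simp add: add_left_mono)
qed

section \<open>The pointwise bound for the potential\<close>

lemma even_translation_cmult:
  assumes [measurable]: "h \<in> borel_measurable borel"
  shows "even_translation \<alpha> x (\<lambda>t. c * h t) y = c * even_translation \<alpha> x h y"
proof -
  have "(\<integral>\<^sup>+\<theta>. c * h (dunkl_polar x y \<theta>) * ennreal (1 - cos \<theta>) \<partial>angle_measure \<alpha>)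
    = c * (\<integral>\<^sup>+\<theta>. h (dunkl_polar x y \<theta>) * ennreal (1 - cos \<theta>) \<partial>angle_measure \<alpha>)"
    unfolding mult.assoc by (rule nn_integral_cmult) measurable
  then show ?thesis unfolding even_translation_def by (simp add: mult.left_commute)
qed

lemma indicator_less_measurable [measurable]:
  fixes f g :: "'a \<Rightarrow> real"
  assumes [measurable]: "f \<in> borel_measurable M" "g \<in> borel_measurable M"
  shows "(\<lambda>w. indicator {..<f w} (g w) :: ennreal) \<in> borel_measurable M"
proof -
  have "{w \<in> space M. g w < f w} \<in> sets M" by measurable
  then have "(\<lambda>w. indicator {w. g w < f w} w :: ennreal) \<in> borel_measurable M"
    by (intro borel_measurable_indicator') simp
  moreover have "(\<lambda>w. indicator {..<f w} (g w) :: ennreal) = (\<lambda>w. indicator {w. g w < f w} w)"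
    by (auto split: split_indicator)
  ultimately show ?thesis by simp
qed

lemma nn_integral_powr_atLeast:
  fixes s :: real
  assumes "a > 0" "s < 0"
  shows "(\<integral>\<^sup>+t. ennreal (t powr (s - 1)) * indicator {a..} t \<partial>lborel) = ennreal (a powr s / (- s))"
proof -
  have "(\<integral>\<^sup>+t. ennreal (t powr (s - 1)) * indicator {a..} t \<partial>lborel) = ennreal (0 - a powr s / s)"
  proof (rule nn_integral_FTC_atLeast)
    show "((\<lambda>t. t powr s / s) has_real_derivative t powr (s - 1)) (at t)" if "a \<le> t" for t
      using that assms by (auto intro!: derivative_eq_intros)
    have "((\<lambda>t. t powr s) \<longlongrightarrow> 0) at_top" by (rule tendsto_neg_powr[OF assms(2) filterlim_ident])
    then show "((\<lambda>t. t powr s / s) \<longlongrightarrow> 0) at_top" by (rule tendsto_divide_zero)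
  qed auto
  then show ?thesis by simp
qed

lemma nn_integral_powr_0:
  fixes s :: real
  assumes "a > 0" "s > 0"
  shows "(\<integral>\<^sup>+t. ennreal (t powr (s - 1)) * indicator {0..a} t \<partial>lborel) = ennreal (a powr s / s)"
proof (rule nn_integral_has_integral_lebesgue')
  have "((\<lambda>t. t powr (s - 1)) has_integral (a powr s / s - 0 powr s / s)) {0..a}"
  proof (rule fundamental_theorem_of_calculus_interior)
    show "continuous_on {0..a} (\<lambda>t. t powr s / s)"
      using assms by (intro continuous_intros continuous_on_powr') auto
    fix t assume "t \<in> {0<..<a}"
    then show "((\<lambda>t. t powr s / s) has_vector_derivative t powr (s - 1)) (at t)"
      unfolding has_real_derivative_iff_has_vector_derivative[symmetric]
      using assms by (auto intro!: derivative_eq_intros)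
  qed (use assms in simp)
  then show "((\<lambda>t. t powr (s - 1)) has_integral (a powr s / s)) {0..a}" using assms by simp
qed simp

text \<open>
The primitive of \<open>s\<^bsup>\<beta> - d - 1\<^esup>\<close> on \<open>(t, \<infinity>)\<close> writes \<open>t\<^bsup>\<beta> - d\<^esup>\<close> as a superposition of
indicators of balls. The factor \<open>(1 + t)\<^bsup>- \<gamma>\<^esup> \<le> 1\<close> is dropped.
\<close>

lemma bessel_riesz_kernel_le_balls:
  assumes \<beta>: "\<beta> < dunkl_dim \<alpha>" and \<gamma>: "\<gamma> > 0" and t: "t \<ge> 0"
  shows "ennreal (bessel_riesz_kernel \<alpha> \<beta> \<gamma> t)
    \<le> (\<integral>\<^sup>+s. ennreal ((dunkl_dim \<alpha> - \<beta>) * s powr (\<beta> - dunkl_dim \<alpha> - 1)) * indicator {0<..} s * indicator {..<s} t \<partial>lborel)"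
proof (cases "t = 0")
  case True then show ?thesis by (simp add: bessel_riesz_kernel_def)
next
  case False
  then have t: "t > 0" using t by simp
  define e where "e = \<beta> - dunkl_dim \<alpha>"
  have e: "e < 0" using \<beta> by (simp add: e_def)
  have "t powr e / (1 + t) powr \<gamma> \<le> t powr e / 1"
    using t \<gamma> ge_one_powr_ge_zero[of "1 + t" \<gamma>] by (intro divide_left_mono) auto
  then have "bessel_riesz_kernel \<alpha> \<beta> \<gamma> t \<le> - e * (t powr e / - e)"
    using t e by (simp add: bessel_riesz_kernel_def e_def[symmetric])
  then have "ennreal (bessel_riesz_kernel \<alpha> \<beta> \<gamma> t) \<le> ennreal (- e * (t powr e / - e))" by (rule ennreal_leI)
  also have "\<dots> = ennreal (- e) * (\<integral>\<^sup>+s. ennreal (s powr (e - 1)) * indicator {t..} s \<partial>lborel)"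
    using e by (subst nn_integral_powr_atLeast[OF t e], subst ennreal_mult'[symmetric]) auto
  also have "\<dots> = (\<integral>\<^sup>+s. ennreal (- e) * (ennreal (s powr (e - 1)) * indicator {t..} s) \<partial>lborel)"
    by (rule nn_integral_cmult[symmetric]) measurable
  also have "\<dots> = (\<integral>\<^sup>+s. ennreal (- e * s powr (e - 1)) * indicator {0<..} s * indicator {..<s} t \<partial>lborel)"
  proof (rule nn_integral_cong_AE)
    show "AE s in lborel. ennreal (- e) * (ennreal (s powr (e - 1)) * indicator {t..} s)
      = ennreal (- e * s powr (e - 1)) * indicator {0<..} s * indicator {..<s} t"
      using AE_lborel_singleton[of t]
    proof eventually_elim
      fix s assume "s \<noteq> t"
      moreover have "ennreal (- e * s powr (e - 1)) = ennreal (- e) * ennreal (s powr (e - 1))"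
        using e by (intro ennreal_mult) auto
      ultimately show "ennreal (- e) * (ennreal (s powr (e - 1)) * indicator {t..} s)
        = ennreal (- e * s powr (e - 1)) * indicator {0<..} s * indicator {..<s} t"
        using t by (auto split: split_indicator)
    qed
  qed
  finally show ?thesis by (simp add: e_def)
qed

lemma even_translation_kernel_le:
  assumes \<beta>: "\<beta> < dunkl_dim \<alpha>" and \<gamma>: "\<gamma> > 0"
  shows "even_translation \<alpha> x (\<lambda>t. ennreal (bessel_riesz_kernel \<alpha> \<beta> \<gamma> t)) y
    \<le> (\<integral>\<^sup>+s. ennreal ((dunkl_dim \<alpha> - \<beta>) * s powr (\<beta> - dunkl_dim \<alpha> - 1)) * indicator {0<..} s * ball_translation \<alpha> x s y \<partial>lborel)"
proof -
  let ?c = "\<lambda>s. ennreal ((dunkl_dim \<alpha> - \<beta>) * s powr (\<beta> - dunkl_dim \<alpha> - 1)) * indicator {0<..} s"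
  have "even_translation \<alpha> x (\<lambda>t. ennreal (bessel_riesz_kernel \<alpha> \<beta> \<gamma> t)) y
    \<le> even_translation \<alpha> x (\<lambda>t. \<integral>\<^sup>+s. ?c s * indicator {..<s} t \<partial>lborel) y"
    by (rule even_translation_mono) (rule bessel_riesz_kernel_le_balls[OF \<beta> \<gamma>])
  also have "\<dots> = (\<integral>\<^sup>+s. even_translation \<alpha> x (\<lambda>t. ?c s * indicator {..<s} t) y \<partial>lborel)"
  proof (rule even_translation_nn_integral)
    show "(\<lambda>(s, t). ?c s * indicator {..<s} t) \<in> borel_measurable (lborel \<Otimes>\<^sub>M borel)"
      unfolding case_prod_beta' by measurable
  qed (rule lborel.sigma_finite_measure_axioms)
  also have "\<dots> = (\<integral>\<^sup>+s. ?c s * ball_translation \<alpha> x s y \<partial>lborel)"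
    by (intro nn_integral_cong even_translation_cmult) measurable
  finally show ?thesis .
qed

lemma ball_translation_measurable:
  assumes [measurable]: "f \<in> borel_measurable M" "g \<in> borel_measurable M" "h \<in> borel_measurable M"
  shows "(\<lambda>w. ball_translation \<alpha> (f w) (g w) (h w)) \<in> borel_measurable M"
proof (rule even_translation_measurable)
  show "(\<lambda>(w, t). indicator {..<g w} t :: ennreal) \<in> borel_measurable (M \<Otimes>\<^sub>M borel)"
    unfolding case_prod_beta' by measurable
qed measurable

text \<open>
The potential of \<open>g \<ge> 0\<close> as an integral with values in \<open>[0, \<infinity>]\<close>; for \<open>g = \<bar>f\<bar>\<close> it bounds the potential
of \<open>f\<close> and decides whether that integral converges.
\<close>

definition riesz_majorant :: "real \<Rightarrow> real \<Rightarrow> real \<Rightarrow> (real \<Rightarrow> real) \<Rightarrow> real \<Rightarrow> ennreal" where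
  "riesz_majorant \<alpha> \<beta> \<gamma> g x =
     (\<integral>\<^sup>+y. ennreal (g y) * even_translation \<alpha> x (\<lambda>t. ennreal (bessel_riesz_kernel \<alpha> \<beta> \<gamma> t)) y \<partial>dunkl_borel \<alpha>)"

lemma bessel_riesz_kernel_measurable [measurable]: "bessel_riesz_kernel \<alpha> \<beta> \<gamma> \<in> borel_measurable borel"
  unfolding bessel_riesz_kernel_def by measurable

lemma riesz_majorant_measurable [measurable]:
  assumes [measurable]: "g \<in> borel_measurable borel"
  shows "riesz_majorant \<alpha> \<beta> \<gamma> g \<in> borel_measurable borel"
proof -
  interpret D: sigma_finite_measure "dunkl_borel \<alpha>" by (rule sigma_finite_dunkl_borel)
  have [measurable]: "(\<lambda>q. even_translation \<alpha> (fst q) (\<lambda>t. ennreal (bessel_riesz_kernel \<alpha> \<beta> \<gamma> t)) (snd q)) \<in> borel_measurable (borel \<Otimes>\<^sub>M dunkl_borel \<alpha>)"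
    by (rule even_translation_measurable) (unfold case_prod_beta', measurable)
  have "(\<lambda>(x, y). ennreal (g y) * even_translation \<alpha> x (\<lambda>t. ennreal (bessel_riesz_kernel \<alpha> \<beta> \<gamma> t)) y) \<in> borel_measurable (borel \<Otimes>\<^sub>M dunkl_borel \<alpha>)"
    unfolding case_prod_beta' by measurable
  from D.borel_measurable_nn_integral[OF this] show ?thesis
    unfolding riesz_majorant_def by simp
qed

text \<open>
The translate of a ball lives near \<open>x\<close> and near \<open>- x\<close>. Replacing \<open>g(y)\<close> by \<open>g(y) + g(- y)\<close> moves
the second part to the first, so that only the ball around \<open>x\<close> remains.
\<close>

lemma nn_integral_ball_translation_le:
  assumes \<alpha>: "\<alpha> \<ge> -1/2"
  obtains C where "C > 0"
    "\<And>g x s A. g \<in> borel_measurable borel \<Longrightarrow> (\<And>y. g y \<ge> (0::real)) \<Longrightarrow> s > 0 \<Longrightarrow> A \<ge> 0 \<Longrightarrow>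
       ball_integral \<alpha> (\<lambda>y. g y + g (- y)) x s \<le> ennreal (A * dunkl_vol \<alpha> x s) \<Longrightarrow>
       (\<integral>\<^sup>+y. ennreal (g y) * ball_translation \<alpha> x s y \<partial>dunkl_borel \<alpha>) \<le> ennreal (C * s powr dunkl_dim \<alpha> * A)"
proof -
  obtain CT where CT: "CT > 0" and T: "\<And>x r y. r > 0 \<Longrightarrow> ball_translation \<alpha> x r y
     \<le> ennreal (CT * (r / (\<bar>x\<bar> + r)) powr (2 * \<alpha> + 1)) * indicator {y. \<bar>\<bar>x\<bar> - \<bar>y\<bar>\<bar> < r} y"
    by (rule ball_translation_upper[OF \<alpha>]) (rule that, assumption+)
  define C where "C = CT * (2 * dunkl_weight \<alpha> 1)"
  have C: "C > 0" using CT dunkl_weight_1_pos[OF \<alpha>] by (simp add: C_def)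
  show thesis
  proof (rule that[OF C])
    fix g :: "real \<Rightarrow> real" and x s A :: real
    assume [measurable]: "g \<in> borel_measurable borel" and g: "\<And>y. g y \<ge> 0" and s: "s > 0" and A: "A \<ge> 0"
      and le: "ball_integral \<alpha> (\<lambda>y. g y + g (- y)) x s \<le> ennreal (A * dunkl_vol \<alpha> x s)"
    let ?e = "CT * (s / (\<bar>x\<bar> + s)) powr (2 * \<alpha> + 1)"
    have "(\<integral>\<^sup>+y. ennreal (g y) * ball_translation \<alpha> x s y \<partial>dunkl_borel \<alpha>)
      \<le> (\<integral>\<^sup>+y. ennreal ?e * (ennreal (g y) * indicator (ball x s) y + ennreal (g y) * indicator (ball x s) (- y)) \<partial>dunkl_borel \<alpha>)"
    proof (rule nn_integral_mono)
      fix y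
      have "indicator {y. \<bar>\<bar>x\<bar> - \<bar>y\<bar>\<bar> < s} y \<le> indicator (ball x s) y + (indicator (ball x s) (- y) :: ennreal)"
        by (auto split: split_indicator simp: dist_real_def)
      then have "ball_translation \<alpha> x s y \<le> ennreal ?e * (indicator (ball x s) y + indicator (ball x s) (- y))"
        by (rule order_trans[OF T[OF s] mult_left_mono]) simp
      then have "ennreal (g y) * ball_translation \<alpha> x s y \<le> ennreal (g y) * (ennreal ?e * (indicator (ball x s) y + indicator (ball x s) (- y)))"
        by (rule mult_left_mono) simp
      then show "ennreal (g y) * ball_translation \<alpha> x s y
        \<le> ennreal ?e * (ennreal (g y) * indicator (ball x s) y + ennreal (g y) * indicator (ball x s) (- y))"
        by (simp only: distrib_left mult.left_commute)
    qed
    also have "\<dots> = ennreal ?e * (ball_integral \<alpha> g x s + (\<integral>\<^sup>+y. ennreal (g y) * indicator (ball x s) (- y) \<partial>dunkl_borel \<alpha>))"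
      by (subst nn_integral_cmult) (auto intro!: arg_cong2[where f="(*)"] nn_integral_add)
    also have "(\<integral>\<^sup>+y. ennreal (g y) * indicator (ball x s) (- y) \<partial>dunkl_borel \<alpha>) = ball_integral \<alpha> (\<lambda>y. g (- y)) x s"
    proof -
      have "(\<integral>\<^sup>+y. ennreal (g (- (- y))) * indicator (ball x s) (- y) \<partial>dunkl_borel \<alpha>) = ball_integral \<alpha> (\<lambda>y. g (- y)) x s"
        by (rule nn_integral_dunkl_borel_reflect) measurable
      then show ?thesis by simp
    qed
    also have "ball_integral \<alpha> g x s + ball_integral \<alpha> (\<lambda>y. g (- y)) x s
      = ball_integral \<alpha> (\<lambda>y. g y + g (- y)) x s"
      using g by (subst nn_integral_add[symmetric]) (auto simp: ennreal_plus distrib_right)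
    also have "ennreal ?e * \<dots> \<le> ennreal ?e * ennreal (A * dunkl_vol \<alpha> x s)"
      by (intro mult_left_mono le) simp
    also have "\<dots> = ennreal (?e * (A * dunkl_vol \<alpha> x s))"
      using CT by (intro ennreal_mult'[symmetric]) simp
    also have "?e * (A * dunkl_vol \<alpha> x s) = C * s powr dunkl_dim \<alpha> * A"
      using powr_eq_dunkl_vol[OF s \<alpha>, of x] unfolding C_def by (simp add: mult_ac) 
    finally show "(\<integral>\<^sup>+y. ennreal (g y) * ball_translation \<alpha> x s y \<partial>dunkl_borel \<alpha>) \<le> ennreal (C * s powr dunkl_dim \<alpha> * A)" .
  qed
qed

text \<open>
The average over a ball of radius \<open>s\<close> enters with the weight \<open>s\<^bsup>\<beta> - 1\<^esup>\<close>. The bound \<open>m\<close> is used for radii up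
to \<open>R\<close> and the bound \<open>C2 N s\<^sup>\<nu>\<close> beyond; the second integral converges because \<open>\<beta> + \<nu> < 0\<close>. With
\<open>R = (m / N)\<^bsup>1 / \<nu>\<^esup>\<close> both parts have the same size.
\<close>

lemma riesz_majorant_hedberg:
  assumes \<alpha>: "\<alpha> \<ge> -1/2" and \<beta>: "0 < \<beta>" "\<beta> < dunkl_dim \<alpha>" and \<gamma>: "\<gamma> > 0" and \<nu>: "\<nu> < - \<beta>" and C2: "C2 \<ge> 0"
  obtains C where "C > 0"
    "\<And>g x m N. g \<in> borel_measurable borel \<Longrightarrow> (\<And>y. g y \<ge> (0::real)) \<Longrightarrow> m > 0 \<Longrightarrow> N > 0 \<Longrightarrow>
       (\<And>s. s > 0 \<Longrightarrow> ball_integral \<alpha> (\<lambda>y. g y + g (- y)) x s \<le> ennreal (m * dunkl_vol \<alpha> x s)) \<Longrightarrow>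
       (\<And>s. s > 0 \<Longrightarrow> ball_integral \<alpha> (\<lambda>y. g y + g (- y)) x s \<le> ennreal (C2 * N * s powr \<nu> * dunkl_vol \<alpha> x s)) \<Longrightarrow>
       riesz_majorant \<alpha> \<beta> \<gamma> g x \<le> ennreal (C * m powr (1 + \<beta> / \<nu>) * N powr (- \<beta> / \<nu>))"
proof -
  define d where "d = dunkl_dim \<alpha>"
  obtain CA where CA: "CA > 0" and avg: "\<And>g x s A. g \<in> borel_measurable borel \<Longrightarrow> (\<And>y. g y \<ge> (0::real)) \<Longrightarrow> s > 0 \<Longrightarrow> A \<ge> 0 \<Longrightarrow>
       ball_integral \<alpha> (\<lambda>y. g y + g (- y)) x s \<le> ennreal (A * dunkl_vol \<alpha> x s) \<Longrightarrow>
       (\<integral>\<^sup>+y. ennreal (g y) * ball_translation \<alpha> x s y \<partial>dunkl_borel \<alpha>) \<le> ennreal (CA * s powr d * A)"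
    unfolding d_def by (rule nn_integral_ball_translation_le[OF \<alpha>]) (rule that[unfolded d_def], assumption, blast)
  define c1 where "c1 = (d - \<beta>) * CA"
  have c1: "c1 > 0" using CA \<beta> by (simp add: c1_def d_def)
  define C where "C = c1 * (1 / \<beta> + C2 / (- (\<beta> + \<nu>)))"
  have "C2 / (- (\<beta> + \<nu>)) \<ge> 0" using C2 \<nu> by (intro divide_nonneg_pos) auto
  then have C: "C > 0" unfolding C_def using c1 \<beta> by (intro mult_pos_pos add_pos_nonneg) auto
  show thesis
  proof (rule that[OF C])
    fix g :: "real \<Rightarrow> real" and x m N :: real
    assume [measurable]: "g \<in> borel_measurable borel" and g: "\<And>y. g y \<ge> 0" and m: "m > 0" and N: "N > 0"
      and small: "\<And>s. s > 0 \<Longrightarrow> ball_integral \<alpha> (\<lambda>y. g y + g (- y)) x s \<le> ennreal (m * dunkl_vol \<alpha> x s)"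
      and large: "\<And>s. s > 0 \<Longrightarrow> ball_integral \<alpha> (\<lambda>y. g y + g (- y)) x s \<le> ennreal (C2 * N * s powr \<nu> * dunkl_vol \<alpha> x s)"
    interpret D: sigma_finite_measure "dunkl_borel \<alpha>" by (rule sigma_finite_dunkl_borel)
    interpret P: pair_sigma_finite "dunkl_borel \<alpha>" lborel ..
    define R where "R = (m / N) powr (1 / \<nu>)"
    have R: "R > 0" using m N by (simp add: R_def)
    let ?c = "\<lambda>s. ennreal ((d - \<beta>) * s powr (\<beta> - d - 1)) * indicator {0<..} s"
    have [measurable]: "(\<lambda>q. ball_translation \<alpha> x (snd q) (fst q)) \<in> borel_measurable (dunkl_borel \<alpha> \<Otimes>\<^sub>M lborel)"
      by (rule ball_translation_measurable) measurable
    have [measurable]: "(\<lambda>y. ball_translation \<alpha> x s y) \<in> borel_measurable borel" for s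
      by (rule ball_translation_measurable) measurable
    have [measurable]: "(\<lambda>s. ball_translation \<alpha> x s y) \<in> borel_measurable borel" for y
      by (rule ball_translation_measurable) measurable
    have "riesz_majorant \<alpha> \<beta> \<gamma> g x \<le> (\<integral>\<^sup>+y. ennreal (g y) * (\<integral>\<^sup>+s. ?c s * ball_translation \<alpha> x s y \<partial>lborel) \<partial>dunkl_borel \<alpha>)"
      unfolding riesz_majorant_def d_def
      by (intro nn_integral_mono mult_left_mono even_translation_kernel_le \<beta> \<gamma>) simp
    also have "\<dots> = (\<integral>\<^sup>+y. (\<integral>\<^sup>+s. ennreal (g y) * (?c s * ball_translation \<alpha> x s y) \<partial>lborel) \<partial>dunkl_borel \<alpha>)"
      by (intro nn_integral_cong nn_integral_cmult[symmetric]) measurable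
    also have "\<dots> = (\<integral>\<^sup>+s. (\<integral>\<^sup>+y. ennreal (g y) * (?c s * ball_translation \<alpha> x s y) \<partial>dunkl_borel \<alpha>) \<partial>lborel)"
      by (rule P.Fubini'[symmetric]) (unfold case_prod_beta', measurable)
    also have "\<dots> = (\<integral>\<^sup>+s. ?c s * (\<integral>\<^sup>+y. ennreal (g y) * ball_translation \<alpha> x s y \<partial>dunkl_borel \<alpha>) \<partial>lborel)"
    proof (rule nn_integral_cong)
      fix s
      have "(\<integral>\<^sup>+y. ennreal (g y) * (?c s * ball_translation \<alpha> x s y) \<partial>dunkl_borel \<alpha>)
        = (\<integral>\<^sup>+y. ?c s * (ennreal (g y) * ball_translation \<alpha> x s y) \<partial>dunkl_borel \<alpha>)"
        by (simp only: mult.left_commute)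
      also have "\<dots> = ?c s * (\<integral>\<^sup>+y. ennreal (g y) * ball_translation \<alpha> x s y \<partial>dunkl_borel \<alpha>)"
        by (rule nn_integral_cmult) measurable
      finally show "(\<integral>\<^sup>+y. ennreal (g y) * (?c s * ball_translation \<alpha> x s y) \<partial>dunkl_borel \<alpha>)
        = ?c s * (\<integral>\<^sup>+y. ennreal (g y) * ball_translation \<alpha> x s y \<partial>dunkl_borel \<alpha>)" .
    qed
    also have "\<dots> \<le> (\<integral>\<^sup>+s. ennreal (c1 * m) * (ennreal (s powr (\<beta> - 1)) * indicator {0..R} s)
         + ennreal (c1 * (C2 * N)) * (ennreal (s powr (\<beta> + \<nu> - 1)) * indicator {R..} s) \<partial>lborel)"
    proof (rule nn_integral_mono)
      fix s :: real
      have step: "?c s * (\<integral>\<^sup>+y. ennreal (g y) * ball_translation \<alpha> x s y \<partial>dunkl_borel \<alpha>) \<le> ennreal (c1 * (s powr (\<beta> - 1) * A))"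
        if s: "s > 0" and A: "A \<ge> 0" and le: "ball_integral \<alpha> (\<lambda>y. g y + g (- y)) x s \<le> ennreal (A * dunkl_vol \<alpha> x s)" for A
      proof -
        have "?c s * (\<integral>\<^sup>+y. ennreal (g y) * ball_translation \<alpha> x s y \<partial>dunkl_borel \<alpha>)
          \<le> ennreal ((d - \<beta>) * s powr (\<beta> - d - 1)) * ennreal (CA * s powr d * A)"
          using s by (simp add: mult_left_mono avg[OF _ g s A le])
        also have "\<dots> = ennreal ((d - \<beta>) * s powr (\<beta> - d - 1) * (CA * s powr d * A))"
          using \<beta> by (intro ennreal_mult'[symmetric]) (simp add: d_def)
        also have "(d - \<beta>) * s powr (\<beta> - d - 1) * (CA * s powr d * A) = c1 * (s powr (\<beta> - 1) * A)"
        proof -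
          have "s powr (\<beta> - d - 1) * s powr d = s powr (\<beta> - 1)" by (simp flip: powr_add)
          then have "(d - \<beta>) * CA * ((s powr (\<beta> - d - 1) * s powr d) * A) = (d - \<beta>) * CA * (s powr (\<beta> - 1) * A)"
            by (rule arg_cong)
          then show ?thesis unfolding c1_def by (simp only: mult_ac)
        qed
        finally show ?thesis .
      qed
      consider "s \<le> 0" | "0 < s" "s \<le> R" | "R < s" by linarith
      then show "?c s * (\<integral>\<^sup>+y. ennreal (g y) * ball_translation \<alpha> x s y \<partial>dunkl_borel \<alpha>)
        \<le> ennreal (c1 * m) * (ennreal (s powr (\<beta> - 1)) * indicator {0..R} s)
         + ennreal (c1 * (C2 * N)) * (ennreal (s powr (\<beta> + \<nu> - 1)) * indicator {R..} s)"
      proof cases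
        case 1 then show ?thesis by simp
      next
        case 2
        have "?c s * (\<integral>\<^sup>+y. ennreal (g y) * ball_translation \<alpha> x s y \<partial>dunkl_borel \<alpha>) \<le> ennreal (c1 * (s powr (\<beta> - 1) * m))"
          by (rule step) (use 2 m small in auto)
        also have "c1 * (s powr (\<beta> - 1) * m) = c1 * m * s powr (\<beta> - 1)" by simp
        also have "ennreal (c1 * m * s powr (\<beta> - 1)) = ennreal (c1 * m) * ennreal (s powr (\<beta> - 1))"
          using c1 m by (intro ennreal_mult) auto
        finally show ?thesis using 2 by (simp add: add_increasing2)
      next
        case 3
        have "?c s * (\<integral>\<^sup>+y. ennreal (g y) * ball_translation \<alpha> x s y \<partial>dunkl_borel \<alpha>) \<le> ennreal (c1 * (s powr (\<beta> - 1) * (C2 * N * s powr \<nu>)))"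
          by (rule step) (use 3 R C2 N large in auto)
        also have "c1 * (s powr (\<beta> - 1) * (C2 * N * s powr \<nu>)) = c1 * (C2 * N) * s powr (\<beta> + \<nu> - 1)"
        proof -
          have "s powr (\<beta> - 1) * s powr \<nu> = s powr (\<beta> + \<nu> - 1)" by (simp add: algebra_simps flip: powr_add)
          then have "c1 * (C2 * N) * (s powr (\<beta> - 1) * s powr \<nu>) = c1 * (C2 * N) * s powr (\<beta> + \<nu> - 1)"
            by (rule arg_cong)
          then show ?thesis by (simp only: mult_ac)
        qed
        also have "ennreal (c1 * (C2 * N) * s powr (\<beta> + \<nu> - 1)) = ennreal (c1 * (C2 * N)) * ennreal (s powr (\<beta> + \<nu> - 1))"
          using c1 C2 N by (intro ennreal_mult) auto
        finally show ?thesis using 3 R by simp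
      qed
    qed
    also have "\<dots> = ennreal (c1 * m) * ennreal (R powr \<beta> / \<beta>) + ennreal (c1 * (C2 * N)) * ennreal (R powr (\<beta> + \<nu>) / (- (\<beta> + \<nu>)))"
      using \<beta> \<nu> R by (subst nn_integral_add) (auto simp: nn_integral_cmult nn_integral_powr_0 nn_integral_powr_atLeast)
    also have "\<dots> = ennreal (c1 * m * (R powr \<beta> / \<beta>) + c1 * (C2 * N) * (R powr (\<beta> + \<nu>) / (- (\<beta> + \<nu>))))"
      using c1 m N C2 \<beta> \<nu> by (simp add: ennreal_mult[symmetric] ennreal_plus[symmetric] divide_nonneg_pos del: ennreal_plus)
    also have "c1 * m * (R powr \<beta> / \<beta>) + c1 * (C2 * N) * (R powr (\<beta> + \<nu>) / (- (\<beta> + \<nu>)))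
      = c1 * ((m * R powr \<beta>) / \<beta> + C2 / (- (\<beta> + \<nu>)) * (N * R powr (\<beta> + \<nu>)))"
      by (simp add: algebra_simps)
    also have "m * R powr \<beta> = m powr (1 + \<beta> / \<nu>) * N powr (- \<beta> / \<nu>)"
    proof -
      have "R powr \<beta> = m powr (\<beta> / \<nu>) * N powr (- \<beta> / \<nu>)"
      proof -
        have "R powr \<beta> = (m / N) powr (\<beta> / \<nu>)" unfolding R_def by (simp add: powr_powr)
        also have "\<dots> = m powr (\<beta> / \<nu>) / N powr (\<beta> / \<nu>)" using m N by (simp add: powr_divide)
        finally show ?thesis by (simp add: powr_minus_divide)
      qed
      then show ?thesis using m by (simp add: powr_add)
    qed
    also have "N * R powr (\<beta> + \<nu>) = m powr (1 + \<beta> / \<nu>) * N powr (- \<beta> / \<nu>)"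
    proof -
      have "(\<beta> + \<nu>) / \<nu> = 1 + \<beta> / \<nu>" using \<nu> \<beta> by (simp add: field_simps)
      then have "R powr (\<beta> + \<nu>) = (m / N) powr (1 + \<beta> / \<nu>)"
        unfolding R_def by (simp add: powr_powr)
      also have "\<dots> = m powr (1 + \<beta> / \<nu>) / N powr (1 + \<beta> / \<nu>)" using m N by (simp add: powr_divide)
      also have "N powr (1 + \<beta> / \<nu>) = N * N powr (\<beta> / \<nu>)" using N by (simp add: powr_add)
      finally show ?thesis using N by (simp add: powr_minus field_simps)
    qed
    also have "c1 * (m powr (1 + \<beta> / \<nu>) * N powr (- \<beta> / \<nu>) / \<beta> + C2 / (- (\<beta> + \<nu>)) * (m powr (1 + \<beta> / \<nu>) * N powr (- \<beta> / \<nu>)))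
      = C * m powr (1 + \<beta> / \<nu>) * N powr (- \<beta> / \<nu>)"
      unfolding C_def by (simp add: algebra_simps)
    finally show "riesz_majorant \<alpha> \<beta> \<gamma> g x \<le> ennreal (C * m powr (1 + \<beta> / \<nu>) * N powr (- \<beta> / \<nu>))" .
  qed
qed

section \<open>The potential on a ball\<close>

lemma powr_add_le:
  assumes "(a::real) \<ge> 0" "b \<ge> 0" "p \<ge> 0"
  shows "(a + b) powr p \<le> 2 powr p * (a powr p + b powr p)"
proof -
  have "(a + b) powr p \<le> (2 * max a b) powr p" using assms by (intro powr_mono2) auto
  also have "\<dots> = 2 powr p * (max a b) powr p" by (simp add: powr_mult)
  also have "\<dots> \<le> 2 powr p * (a powr p + b powr p)" by (intro mult_left_mono) (auto simp: max_def)
  finally show ?thesis .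
qed

text \<open>
A substitute for Hoelder's inequality: with \<open>l = \<phi>(r) N\<close> it turns the Morrey bound for the \<open>p\<close>-th power
into one for the function itself.
\<close>

lemma le_add_powr:
  assumes "(l::real) > 0" "a \<ge> 0" "p > 1"
  shows "a \<le> l + l powr (1 - p) * a powr p"
proof (cases "a \<le> l")
  case True then show ?thesis by (simp add: add_increasing2)
next
  case False
  then have "1 \<le> (a / l) powr (p - 1)" using assms by (intro ge_one_powr_ge_zero) auto
  then have "a * 1 \<le> a * (a / l) powr (p - 1)" using assms by (intro mult_left_mono) auto
  also have "\<dots> = l powr (1 - p) * a powr p"
  proof -
    have "a * a powr (p - 1) = a powr p" using powr_add[of a 1 "p - 1"] False assms by simp
    moreover have "l powr (1 - p) = 1 / l powr (p - 1)" using powr_minus_divide[of l "p - 1"] by simp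
    ultimately show ?thesis using False assms by (simp add: powr_divide)
  qed
  finally show ?thesis using assms by simp
qed

text \<open>
By the pointwise bound, the level set of the potential at height \<open>c m\<^bsup>1 + \<beta> / \<nu>\<^esup>\<close> consists of points where
some average of \<open>F(y) = g(y) + g(- y)\<close> exceeds \<open>m\<close>. On the ball of radius \<open>r\<close>, averages with radius \<open>s \<ge> r\<close>
are at most a multiple of \<open>\<phi>(s) N\<close>, hence of \<open>\<phi>(r) N\<close>, as \<open>\<phi>\<close> is almost decreasing. So above
this level the weak type inequality only involves \<open>F\<close> on the ball of radius \<open>2 r\<close>, and the passage to the
strong type gives the bound for \<open>w\<close>, the power of the potential that is comparable to \<open>m\<close>.
\<close>

lemma riesz_majorant_local_bound:
  assumes \<alpha>: "\<alpha> \<ge> -1/2" and \<beta>: "0 < \<beta>" "\<beta> < dunkl_dim \<alpha>" and \<gamma>: "\<gamma> > 0" and p: "1 < p" and \<nu>: "\<nu> < - \<beta>"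
    and C0: "C0 > 0" and \<phi>pos: "\<And>r. r > 0 \<Longrightarrow> \<phi> r > 0" and \<phi>le: "\<And>r. r > 0 \<Longrightarrow> \<phi> r \<le> C0 * r powr \<nu>"
    and ad: "almost_decreasing \<phi>" and q: "q * (1 + \<beta> / \<nu>) = p"
  obtains C where "C > 0"
    "\<And>g N. g \<in> borel_measurable borel \<Longrightarrow> (\<And>y. g y \<ge> (0::real)) \<Longrightarrow> N > 0 \<Longrightarrow>
       ball_morrey_bound \<alpha> p \<phi> g N \<Longrightarrow>
       (AE x in dunkl_borel \<alpha>. riesz_majorant \<alpha> \<beta> \<gamma> g x < \<infinity>) \<and>
       ball_morrey_bound \<alpha> q (\<lambda>r. \<phi> r powr (p / q)) (\<lambda>y. enn2real (riesz_majorant \<alpha> \<beta> \<gamma> g y)) (C * N)"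
proof -
  define \<theta> where "\<theta> = 1 + \<beta> / \<nu>"
  have \<theta>: "0 < \<theta>" using \<nu> \<beta> by (simp add: \<theta>_def field_simps)
  have q\<theta>: "q * \<theta> = p" using q by (simp add: \<theta>_def)
  have qpos: "q > 0" using q\<theta> \<theta> p by (metis less_trans zero_less_mult_pos2 zero_less_one)
  define K1 :: real where "K1 = 2 powr (p + 1)"
  have K1: "K1 > 0" by (simp add: K1_def)
  define C2 where "C2 = 1 + K1"
  have C2: "C2 > 0" using K1 by (simp add: C2_def)
  obtain Ca where Ca: "Ca > 0" "\<And>r s. r > 0 \<Longrightarrow> r \<le> s \<Longrightarrow> \<phi> r \<ge> Ca * \<phi> s"
    using ad unfolding almost_decreasing_def by blast
  \<comment> \<open>\<open>cb \<ge> 1\<close> is the constant in \<open>\<phi>(s) \<le> cb \<phi>(r)\<close> for \<open>s \<ge> r\<close>.\<close>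
  define cb where "cb = max 1 (1 / Ca)"
  have cb: "cb \<ge> 1" by (simp add: cb_def)
  have dec: "\<phi> s \<le> cb * \<phi> r" if "r > 0" "r \<le> s" for r s
  proof -
    have "\<phi> s \<le> 1 / Ca * \<phi> r" using Ca(2)[OF that] Ca(1) by (simp add: field_simps)
    also have "\<dots> \<le> cb * \<phi> r" using \<phi>pos[OF that(1)] by (intro mult_right_mono) (auto simp: cb_def)
    finally show ?thesis .
  qed
  obtain CH where CH: "CH > 0" and hedberg: "\<And>g x m N. g \<in> borel_measurable borel \<Longrightarrow> (\<And>y. g y \<ge> (0::real)) \<Longrightarrow> m > 0 \<Longrightarrow> N > 0 \<Longrightarrow>
       (\<And>s. s > 0 \<Longrightarrow> ball_integral \<alpha> (\<lambda>y. g y + g (- y)) x s \<le> ennreal (m * dunkl_vol \<alpha> x s)) \<Longrightarrow>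
       (\<And>s. s > 0 \<Longrightarrow> ball_integral \<alpha> (\<lambda>y. g y + g (- y)) x s \<le> ennreal (C2 * C0 * N * s powr \<nu> * dunkl_vol \<alpha> x s)) \<Longrightarrow>
       riesz_majorant \<alpha> \<beta> \<gamma> g x \<le> ennreal (CH * m powr \<theta> * N powr (- \<beta> / \<nu>))"
    unfolding \<theta>_def
    by (rule riesz_majorant_hedberg[OF \<alpha> \<beta> \<gamma> \<nu>, of "C2 * C0"]) (use C2 C0 in simp, rule that[unfolded \<theta>_def], assumption, blast)
  define D where "D = 2 * 5 powr (2 * \<alpha> + 2)"
  have D: "D > 0" by (simp add: D_def)
  define CS where "CS = D * p * 2 powr (p - 1) / (p - 1)"
  have CS: "CS > 0" using D p by (simp add: CS_def)
  define Ct where "Ct = (C2 * cb) powr p + CS * (K1 * 2 powr (2 * \<alpha> + 2) * cb powr p)"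
  have Ct: "Ct > 0" unfolding Ct_def using C2 cb CS K1 by (intro add_pos_pos) auto
  define C where "C = CH * Ct powr (1 / q)"
  have C: "C > 0" using CH Ct by (simp add: C_def)
  show thesis
  proof (rule that[OF C])
    fix g :: "real \<Rightarrow> real" and N :: real
    assume [measurable]: "g \<in> borel_measurable borel" and g: "\<And>y. g y \<ge> 0" and N: "N > 0"
      and "ball_morrey_bound \<alpha> p \<phi> g N"
    then have mor: "\<And>x r. r > 0 \<Longrightarrow> ball_integral \<alpha> (\<lambda>y. g y powr p) x r \<le> ennreal (dunkl_vol \<alpha> x r * (\<phi> r * N) powr p)"
      by (simp add: ball_morrey_bound_def)
    define F where "F y = g y + g (- y)" for y
    have F: "F y \<ge> 0" for y using g by (simp add: F_def)
    have [measurable]: "F \<in> borel_measurable borel" unfolding F_def by measurable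
    let ?J = "riesz_majorant \<alpha> \<beta> \<gamma> g"
    have vol: "dunkl_vol \<alpha> x r > 0" if "r > 0" for x r using that by (rule dunkl_vol_pos[OF \<alpha>])
    have Fp: "ball_integral \<alpha> (\<lambda>y. F y powr p) x r \<le> ennreal (K1 * dunkl_vol \<alpha> x r * (\<phi> r * N) powr p)"
      if r: "r > 0" for x r
    proof -
      have "ball_integral \<alpha> (\<lambda>y. F y powr p) x r
        \<le> (\<integral>\<^sup>+y. ennreal (2 powr p) * (ennreal (g y powr p) * indicator (ball x r) y + ennreal (g (- y) powr p) * indicator (ball (- x) r) (- y)) \<partial>dunkl_borel \<alpha>)"
      proof (rule nn_integral_mono)
        fix y
        have "ennreal (F y powr p) \<le> ennreal (2 powr p * (g y powr p + g (- y) powr p))"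
          unfolding F_def using g p by (intro ennreal_leI powr_add_le) auto
        also have "\<dots> = ennreal (2 powr p) * (ennreal (g y powr p) + ennreal (g (- y) powr p))"
          by (simp add: ennreal_mult ennreal_plus[symmetric] del: ennreal_plus)
        finally show "ennreal (F y powr p) * indicator (ball x r) y
          \<le> ennreal (2 powr p) * (ennreal (g y powr p) * indicator (ball x r) y + ennreal (g (- y) powr p) * indicator (ball (- x) r) (- y))"
          by (auto split: split_indicator simp: dist_real_def)
      qed
      also have "\<dots> = ennreal (2 powr p) * (ball_integral \<alpha> (\<lambda>y. g y powr p) x r + (\<integral>\<^sup>+y. ennreal (g (- y) powr p) * indicator (ball (- x) r) (- y) \<partial>dunkl_borel \<alpha>))"
        by (subst nn_integral_cmult) (auto intro!: arg_cong2[where f="(*)"] nn_integral_add)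
      also have "(\<integral>\<^sup>+y. ennreal (g (- y) powr p) * indicator (ball (- x) r) (- y) \<partial>dunkl_borel \<alpha>) = ball_integral \<alpha> (\<lambda>y. g y powr p) (- x) r"
        by (rule nn_integral_dunkl_borel_reflect) measurable
      also have "ennreal (2 powr p) * (ball_integral \<alpha> (\<lambda>y. g y powr p) x r + \<dots>)
        \<le> ennreal (2 powr p) * (ennreal (dunkl_vol \<alpha> x r * (\<phi> r * N) powr p) + ennreal (dunkl_vol \<alpha> x r * (\<phi> r * N) powr p))"
        using mor[OF r, of x] mor[OF r, of "- x"] by (intro mult_left_mono add_mono) auto
      also have "\<dots> = ennreal (2 powr p * (dunkl_vol \<alpha> x r * (\<phi> r * N) powr p + dunkl_vol \<alpha> x r * (\<phi> r * N) powr p))"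
      proof -
        have a: "dunkl_vol \<alpha> x r * (\<phi> r * N) powr p \<ge> 0" using vol[OF r, of x] by simp
        show ?thesis unfolding ennreal_plus[OF a a, symmetric] by (rule ennreal_mult'[symmetric]) simp
      qed
      also have "2 powr p * (dunkl_vol \<alpha> x r * (\<phi> r * N) powr p + dunkl_vol \<alpha> x r * (\<phi> r * N) powr p) = K1 * dunkl_vol \<alpha> x r * (\<phi> r * N) powr p"
        by (simp add: K1_def powr_add)
      finally show ?thesis .
    qed
    have F1: "ball_integral \<alpha> F x r \<le> ennreal (C2 * \<phi> r * N * dunkl_vol \<alpha> x r)"
      if r: "r > 0" for x r
    proof -
      define l where "l = \<phi> r * N"
      have l: "l > 0" using \<phi>pos[OF r] N by (simp add: l_def)
      have "ball_integral \<alpha> F x r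
        \<le> (\<integral>\<^sup>+y. ennreal l * indicator (ball x r) y + ennreal (l powr (1 - p)) * (ennreal (F y powr p) * indicator (ball x r) y) \<partial>dunkl_borel \<alpha>)"
      proof (rule nn_integral_mono)
        fix y
        have "ennreal (F y) \<le> ennreal (l + l powr (1 - p) * F y powr p)" using le_add_powr[OF l F p] by (rule ennreal_leI)
        also have "\<dots> = ennreal l + ennreal (l powr (1 - p)) * ennreal (F y powr p)" using l by (simp add: ennreal_mult)
        finally show "ennreal (F y) * indicator (ball x r) y \<le> ennreal l * indicator (ball x r) y + ennreal (l powr (1 - p)) * (ennreal (F y powr p) * indicator (ball x r) y)"
          by (auto split: split_indicator)
      qed
      also have "\<dots> = ennreal l * emeasure (dunkl_borel \<alpha>) (ball x r) + ennreal (l powr (1 - p)) * ball_integral \<alpha> (\<lambda>y. F y powr p) x r"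
        by (simp add: nn_integral_add nn_integral_cmult)
      also have "\<dots> \<le> ennreal l * ennreal (dunkl_vol \<alpha> x r) + ennreal (l powr (1 - p)) * ennreal (K1 * dunkl_vol \<alpha> x r * l powr p)"
        using Fp[OF r, of x] by (intro add_mono mult_left_mono emeasure_ball_le_dunkl_vol \<alpha> r) (auto simp: l_def)
      also have "\<dots> = ennreal (l * dunkl_vol \<alpha> x r + l powr (1 - p) * (K1 * dunkl_vol \<alpha> x r * l powr p))"
        using l vol[OF r, of x] K1 by (simp add: ennreal_mult[symmetric] ennreal_plus[symmetric] del: ennreal_plus)
      also have "l * dunkl_vol \<alpha> x r + l powr (1 - p) * (K1 * dunkl_vol \<alpha> x r * l powr p) = C2 * \<phi> r * N * dunkl_vol \<alpha> x r"
      proof -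
        have "l powr (1 - p) * l powr p = l" using l by (simp flip: powr_add)
        then have "K1 * dunkl_vol \<alpha> x r * (l powr (1 - p) * l powr p) = K1 * dunkl_vol \<alpha> x r * l" by (rule arg_cong)
        then show ?thesis by (simp add: C2_def l_def algebra_simps)
      qed
      finally show ?thesis .
    qed
    have F\<nu>: "ball_integral \<alpha> F x s \<le> ennreal (C2 * C0 * N * s powr \<nu> * dunkl_vol \<alpha> x s)"
      if s: "s > 0" for x s
    proof -
      have "C2 * N * dunkl_vol \<alpha> x s * \<phi> s \<le> C2 * N * dunkl_vol \<alpha> x s * (C0 * s powr \<nu>)"
        using C2 N vol[OF s, of x] by (intro mult_left_mono \<phi>le s) auto
      then have "ennreal (C2 * \<phi> s * N * dunkl_vol \<alpha> x s) \<le> ennreal (C2 * C0 * N * s powr \<nu> * dunkl_vol \<alpha> x s)"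
        by (intro ennreal_leI) (simp add: mult_ac)
      then show ?thesis using F1[OF s, of x] by (rule order_trans[rotated])
    qed
    define c where "c = CH * N powr (- \<beta> / \<nu>)"
    have c: "c > 0" using CH N by (simp add: c_def)
    have weak: "emeasure (dunkl_borel \<alpha>) E \<le> ennreal (D / m) *
         (\<integral>\<^sup>+z. ennreal (F z * indicator (ball x0 (2 * r)) z) * indicator {z. m / 2 < F z * indicator (ball x0 (2 * r)) z} z \<partial>dunkl_borel \<alpha>)"
      if r: "r > 0" and m: "m > C2 * cb * \<phi> r * N" and E: "E \<in> sets borel" "\<And>x. x \<in> E \<Longrightarrow> x \<in> ball x0 r \<and> ennreal (c * m powr \<theta>) < ?J x"
      for x0 r m E
      unfolding D_def
    proof (rule dunkl_weak_type[OF \<alpha>, where R = r])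
      have l0: "C2 * cb * \<phi> r * N > 0" using C2 cb \<phi>pos[OF r] N by (intro mult_pos_pos) auto
      show mpos: "m > 0" using m l0 by linarith
      fix x assume x: "x \<in> E"
      show "\<exists>t. 0 < t \<and> t \<le> r \<and> ennreal (m * dunkl_vol \<alpha> x t) < ball_integral \<alpha> (\<lambda>z. F z * indicator (ball x0 (2 * r)) z) x t"
      proof (rule ccontr)
        assume no: "\<not> ?thesis"
        have "ball_integral \<alpha> (\<lambda>y. g y + g (- y)) x s \<le> ennreal (m * dunkl_vol \<alpha> x s)" if s: "s > 0" for s
        proof (cases "s \<le> r")
          case True
          have "ball_integral \<alpha> (\<lambda>y. g y + g (- y)) x s
            = ball_integral \<alpha> (\<lambda>z. F z * indicator (ball x0 (2 * r)) z) x s"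
          proof (rule nn_integral_cong)
            fix z :: real
            have "z \<in> ball x0 (2 * r)" if "z \<in> ball x s"
              using that True E(2)[OF x] dist_triangle[of x0 z x] by auto
            then show "ennreal (g z + g (- z)) * indicator (ball x s) z = ennreal (F z * indicator (ball x0 (2 * r)) z) * indicator (ball x s) z"
              by (auto simp: F_def split: split_indicator)
          qed
          also have "\<dots> \<le> ennreal (m * dunkl_vol \<alpha> x s)" using no s True by (meson not_le)
          finally show ?thesis .
        next
          case False
          have "C2 * \<phi> s * N * dunkl_vol \<alpha> x s \<le> m * dunkl_vol \<alpha> x s"
          proof (rule mult_right_mono)
            have "C2 * N * \<phi> s \<le> C2 * N * (cb * \<phi> r)" using False C2 N by (intro mult_left_mono dec r) auto
            then show "C2 * \<phi> s * N \<le> m" using m by (simp add: mult_ac)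
          qed (use vol[OF s, of x] in simp)
          then show ?thesis using F1[OF s, of x] unfolding F_def by (meson ennreal_leI order_trans)
        qed
        then have "?J x \<le> ennreal (CH * m powr \<theta> * N powr (- \<beta> / \<nu>))"
          using F\<nu> unfolding F_def by (intro hedberg mpos N g) auto
        also have "CH * m powr \<theta> * N powr (- \<beta> / \<nu>) = c * m powr \<theta>" by (simp add: c_def)
        finally show False using E(2)[OF x] by (simp add: not_le[symmetric])
      qed
    qed (use F E in \<open>auto intro!: mult_nonneg_nonneg\<close>)
    \<comment> \<open>The points with infinite potential lie in all level sets at once, and the weak type bound tends
      to \<open>0\<close> as the level grows.\<close>
    have finJ: "AE x in dunkl_borel \<alpha>. ?J x < \<infinity>"
    proof -
      have null: "emeasure (dunkl_borel \<alpha>) {x \<in> ball 0 r. ?J x = \<infinity>} = 0" if r: "r > 0" for r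
      proof -
        define l0 where "l0 = C2 * cb * \<phi> r * N"
        have l0: "l0 > 0" unfolding l0_def using C2 cb \<phi>pos[OF r] N by (intro mult_pos_pos) auto
        have E: "{x \<in> ball 0 r. ?J x = \<infinity>} \<in> sets borel"
        proof -
          have "{x \<in> space borel. x \<in> ball 0 r \<and> ?J x = \<infinity>} \<in> sets borel" by measurable
          then show ?thesis by simp
        qed
        define i where "i = C2 * \<phi> (2 * r) * N * dunkl_vol \<alpha> 0 (2 * r)"
        have le: "emeasure (dunkl_borel \<alpha>) {x \<in> ball 0 r. ?J x = \<infinity>} \<le> ennreal (D / (l0 + 1 + real n) * i)" for n
        proof -
          have "emeasure (dunkl_borel \<alpha>) {x \<in> ball 0 r. ?J x = \<infinity>} \<le> ennreal (D / (l0 + 1 + real n)) *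
            (\<integral>\<^sup>+z. ennreal (F z * indicator (ball 0 (2 * r)) z) * indicator {z. (l0 + 1 + real n) / 2 < F z * indicator (ball 0 (2 * r)) z} z \<partial>dunkl_borel \<alpha>)"
            by (rule weak[OF r _ E]) (auto simp: l0_def)
          also have "\<dots> \<le> ennreal (D / (l0 + 1 + real n)) * ball_integral \<alpha> F 0 (2 * r)"
            by (intro mult_left_mono nn_integral_mono) (auto split: split_indicator)
          also have "\<dots> \<le> ennreal (D / (l0 + 1 + real n)) * ennreal i"
            unfolding i_def using r by (intro mult_left_mono F1) auto
          also have "\<dots> = ennreal (D / (l0 + 1 + real n) * i)"
            using D l0 by (intro ennreal_mult'[symmetric]) auto
          finally show ?thesis .
        qed
        have "(\<lambda>n. D / (l0 + 1 + real n) * i) \<longlonglongrightarrow> 0" by real_asymp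
        then have "(\<lambda>n. ennreal (D / (l0 + 1 + real n) * i)) \<longlonglongrightarrow> ennreal 0" by (rule tendsto_ennrealI)
        then have "emeasure (dunkl_borel \<alpha>) {x \<in> ball 0 r. ?J x = \<infinity>} \<le> ennreal 0"
          by (rule LIMSEQ_le_const) (use le in auto)
        then show ?thesis by simp
      qed
      have "AE x in dunkl_borel \<alpha>. x \<notin> {x \<in> ball 0 (real (Suc n)). ?J x = \<infinity>}" for n
      proof (rule AE_not_in)
        have "{x \<in> space borel. x \<in> ball 0 (real (Suc n)) \<and> ?J x = \<infinity>} \<in> sets borel" by measurable
        then show "{x \<in> ball 0 (real (Suc n)). ?J x = \<infinity>} \<in> null_sets (dunkl_borel \<alpha>)"
          using null[of "real (Suc n)"] by (auto intro!: null_setsI)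
      qed
      then have "AE x in dunkl_borel \<alpha>. \<forall>n. x \<notin> {x \<in> ball 0 (real (Suc n)). ?J x = \<infinity>}"
        by (subst AE_all_countable) blast
      then show ?thesis
      proof eventually_elim
        fix x assume a: "\<forall>n. x \<notin> {x \<in> ball 0 (real (Suc n)). ?J x = \<infinity>}"
        obtain n where "\<bar>x\<bar> < real n" using reals_Archimedean2 by blast
        then have "x \<in> ball 0 (real (Suc n))" by simp
        then show "?J x < \<infinity>" using a by (auto simp: less_top)
      qed
    qed
    have "ball_integral \<alpha> (\<lambda>y. enn2real (?J y) powr q) x0 r
          \<le> ennreal (dunkl_vol \<alpha> x0 r * (\<phi> r powr (p / q) * (C * N)) powr q)" if r: "r > 0" for x0 r
    proof -
      define l0 where "l0 = C2 * cb * \<phi> r * N"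
      have l0: "l0 > 0" unfolding l0_def using C2 cb \<phi>pos[OF r] N by (intro mult_pos_pos) auto
      define w where "w x = (enn2real (?J x) / c) powr (1 / \<theta>)" for x
      have [measurable]: "w \<in> borel_measurable borel" unfolding w_def by measurable
      define f1 where "f1 z = F z * indicator (ball x0 (2 * r)) z" for z
      have [measurable]: "f1 \<in> borel_measurable borel" unfolding f1_def by measurable
      have f1: "f1 z \<ge> 0" for z using F by (simp add: f1_def)
      have "ball_integral \<alpha> (\<lambda>x. w x powr p) x0 r
         \<le> ennreal (l0 powr p) * emeasure (dunkl_borel \<alpha>) (ball x0 r) + ennreal (D * p * 2 powr (p - 1) / (p - 1)) * (\<integral>\<^sup>+z. ennreal (f1 z powr p) \<partial>dunkl_borel \<alpha>)"
      proof (rule weak_type_imp_strong_type[OF sigma_finite_dunkl_borel _ _ _ _ f1 p l0])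
        fix m assume m: "m > l0"
        show "emeasure (dunkl_borel \<alpha>) {x \<in> space (dunkl_borel \<alpha>). x \<in> ball x0 r \<and> m < w x}
           \<le> ennreal (D / m) * (\<integral>\<^sup>+z. ennreal (f1 z) * indicator {z. m / 2 < f1 z} z \<partial>dunkl_borel \<alpha>)"
          unfolding f1_def
        proof (rule weak[OF r])
          show "C2 * cb * \<phi> r * N < m" using m by (simp add: l0_def)
          have "{x \<in> space borel. x \<in> ball x0 r \<and> m < w x} \<in> sets borel" by measurable
          then show "{x \<in> space (dunkl_borel \<alpha>). x \<in> ball x0 r \<and> m < w x} \<in> sets borel" by simp
          fix x assume x: "x \<in> {x \<in> space (dunkl_borel \<alpha>). x \<in> ball x0 r \<and> m < w x}"
          have mpos: "m > 0" using m l0 by linarith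
          have "m powr \<theta> < w x powr \<theta>" using x mpos \<theta> by (intro powr_less_mono2) auto
          also have "\<dots> = enn2real (?J x) / c"
            using \<theta> c unfolding w_def by (simp add: powr_powr)
          finally have "c * m powr \<theta> < enn2real (?J x)" using c by (simp add: field_simps)
          then have "ennreal (c * m powr \<theta>) < ennreal (enn2real (?J x))"
            using c by (intro ennreal_lessI) (auto intro: le_less_trans[rotated])
          also have "\<dots> \<le> ?J x" by (cases "?J x") auto
          finally show "x \<in> ball x0 r \<and> ennreal (c * m powr \<theta>) < ?J x" using x by simp
        qed
      qed (use D in \<open>auto simp: w_def\<close>)
      also have "(\<integral>\<^sup>+z. ennreal (f1 z powr p) \<partial>dunkl_borel \<alpha>) = ball_integral \<alpha> (\<lambda>z. F z powr p) x0 (2 * r)"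
        by (intro nn_integral_cong) (auto simp: f1_def split: split_indicator)
      also have "ennreal (l0 powr p) * emeasure (dunkl_borel \<alpha>) (ball x0 r) + ennreal (D * p * 2 powr (p - 1) / (p - 1)) * \<dots>
        \<le> ennreal (l0 powr p) * ennreal (dunkl_vol \<alpha> x0 r) + ennreal CS * ennreal (K1 * dunkl_vol \<alpha> x0 (2 * r) * (\<phi> (2 * r) * N) powr p)"
        unfolding CS_def using r by (intro add_mono mult_left_mono emeasure_ball_le_dunkl_vol \<alpha> Fp) auto
      also have "\<dots> = ennreal (l0 powr p * dunkl_vol \<alpha> x0 r + CS * (K1 * dunkl_vol \<alpha> x0 (2 * r) * (\<phi> (2 * r) * N) powr p))"
        using CS K1 vol[OF r, of x0] vol[of "2 * r" x0] r by (simp add: ennreal_mult[symmetric] ennreal_plus[symmetric] del: ennreal_plus)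
      also have "\<dots> \<le> ennreal (Ct * dunkl_vol \<alpha> x0 r * (\<phi> r * N) powr p)"
      proof (rule ennreal_leI)
        have e1: "l0 powr p * dunkl_vol \<alpha> x0 r = (C2 * cb) powr p * (dunkl_vol \<alpha> x0 r * (\<phi> r * N) powr p)"
          using powr_mult[of "C2 * cb" "\<phi> r * N" p] by (simp add: l0_def mult_ac)
        have "(\<phi> (2 * r) * N) powr p \<le> (cb * \<phi> r * N) powr p"
          using dec[OF r, of "2 * r"] \<phi>pos[of "2 * r"] r N p by (intro powr_mono2 mult_right_mono) auto
        also have "\<dots> = cb powr p * (\<phi> r * N) powr p" using powr_mult[of cb "\<phi> r * N" p] by (simp add: mult_ac)
        finally have "(K1 * dunkl_vol \<alpha> x0 (2 * r)) * (\<phi> (2 * r) * N) powr p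
          \<le> (K1 * (2 powr (2 * \<alpha> + 2) * dunkl_vol \<alpha> x0 r)) * (cb powr p * (\<phi> r * N) powr p)"
          using K1 dunkl_vol_dilate[OF \<alpha> r, of 2 x0] vol[OF r, of x0] by (intro mult_mono mult_left_mono) auto
        then have "CS * (K1 * dunkl_vol \<alpha> x0 (2 * r) * (\<phi> (2 * r) * N) powr p)
          \<le> CS * ((K1 * (2 powr (2 * \<alpha> + 2) * dunkl_vol \<alpha> x0 r)) * (cb powr p * (\<phi> r * N) powr p))"
          using CS by (intro mult_left_mono) auto
        then show "l0 powr p * dunkl_vol \<alpha> x0 r + CS * (K1 * dunkl_vol \<alpha> x0 (2 * r) * (\<phi> (2 * r) * N) powr p)
          \<le> Ct * dunkl_vol \<alpha> x0 r * (\<phi> r * N) powr p"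
          unfolding e1 Ct_def by (simp add: algebra_simps)
      qed
      finally have W: "ball_integral \<alpha> (\<lambda>x. w x powr p) x0 r \<le> ennreal (Ct * dunkl_vol \<alpha> x0 r * (\<phi> r * N) powr p)" .
      have jw: "enn2real (?J y) powr q = c powr q * w y powr p" for y
      proof -
        have "w y powr p = (enn2real (?J y) / c) powr q"
        proof -
          have "1 / \<theta> * p = q" using \<theta> q\<theta> by (simp add: field_simps)
          then show ?thesis unfolding w_def powr_powr by simp
        qed
        also have "\<dots> = enn2real (?J y) powr q / c powr q" using c by (simp add: powr_divide)
        finally show ?thesis using c by simp
      qed
      have "ball_integral \<alpha> (\<lambda>y. enn2real (?J y) powr q) x0 r
        = (\<integral>\<^sup>+y. ennreal (c powr q) * (ennreal (w y powr p) * indicator (ball x0 r) y) \<partial>dunkl_borel \<alpha>)"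
        unfolding jw by (simp add: ennreal_mult mult.assoc)
      also have "\<dots> = ennreal (c powr q) * ball_integral \<alpha> (\<lambda>y. w y powr p) x0 r"
        by (rule nn_integral_cmult) measurable
      also have "\<dots> \<le> ennreal (c powr q) * ennreal (Ct * dunkl_vol \<alpha> x0 r * (\<phi> r * N) powr p)"
        by (intro mult_left_mono W) simp
      also have "\<dots> = ennreal (c powr q * (Ct * dunkl_vol \<alpha> x0 r * (\<phi> r * N) powr p))"
        by (rule ennreal_mult'[symmetric]) simp
      also have "c powr q * (Ct * dunkl_vol \<alpha> x0 r * (\<phi> r * N) powr p) = dunkl_vol \<alpha> x0 r * (\<phi> r powr (p / q) * (C * N)) powr q"
      proof -
        have "- \<beta> / \<nu> * q + p = q" using q by (simp add: algebra_simps)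
        then have e: "N powr q = N powr (- \<beta> / \<nu> * q) * N powr p" by (simp flip: powr_add)
        have "c powr q = CH powr q * N powr (- \<beta> / \<nu> * q)" unfolding c_def powr_mult powr_powr ..
        moreover have "C powr q = CH powr q * Ct" unfolding C_def powr_mult powr_powr using qpos Ct by simp
        moreover have "(\<phi> r powr (p / q)) powr q = \<phi> r powr p" unfolding powr_powr using qpos by simp
        ultimately show ?thesis unfolding powr_mult e by (simp only: mult_ac)
      qed
      finally show ?thesis .
    qed
    then show "(AE x in dunkl_borel \<alpha>. ?J x < \<infinity>) \<and>
       ball_morrey_bound \<alpha> q (\<lambda>r. \<phi> r powr (p / q)) (\<lambda>y. enn2real (?J y)) (C * N)"
      using finJ unfolding ball_morrey_bound_def by blast
  qed
qed

section \<open>Comparison of the Dunkl-Morrey norm with bounds on balls\<close>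

lemma sets_dunkl_measure: "sets (dunkl_measure \<alpha>) = sets lebesgue"
  by (simp add: dunkl_measure_def)

text \<open>
The weight vanishes at most at the origin.
\<close>

lemma dunkl_borel_AE_lborel:
  assumes \<alpha>: "\<alpha> \<ge> -1/2" and ae: "AE x in dunkl_borel \<alpha>. P x"
  shows "AE x in lborel. P x"
proof -
  have "AE x in lborel. dunkl_weight \<alpha> x > 0 \<longrightarrow> P x"
    using ae unfolding dunkl_borel_def by (subst (asm) AE_density) auto
  then show ?thesis
    using AE_lborel_singleton[of 0]
  proof eventually_elim
    fix x :: real assume "dunkl_weight \<alpha> x > 0 \<longrightarrow> P x" "x \<noteq> 0"
    moreover have "dunkl_weight \<alpha> x > 0" using \<open>x \<noteq> 0\<close> dunkl_weight_1_pos[OF \<alpha>] by (simp add: dunkl_weight_def)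
    ultimately show "P x" by simp
  qed
qed

lemma nn_integral_dunkl_measure_cong_AE:
  fixes h :: "real \<Rightarrow> ennreal"
  assumes [measurable]: "h \<in> borel_measurable borel" and "AE x in lborel. h0 x = h x"
  shows "(\<integral>\<^sup>+x. h0 x \<partial>dunkl_measure \<alpha>) = (\<integral>\<^sup>+x. h x \<partial>dunkl_borel \<alpha>)"
  using nn_integral_cong_AE[OF AE_dunkl_measure(1)[OF assms(2)]] nn_integral_dunkl_measure_eq[OF assms(1)] by simp

lemma lebesgue_measurable_eq_borel_AE:
  fixes f :: "real \<Rightarrow> complex"
  assumes "f \<in> borel_measurable lebesgue"
  obtains f' where "f' \<in> borel_measurable borel" "AE x in lborel. f x = f' x"
proof -
  have "(\<lambda>x. Re (f x)) \<in> borel_measurable (completion lborel)" "(\<lambda>x. Im (f x)) \<in> borel_measurable (completion lborel)"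
    using assms by auto
  from this[THEN completion_ex_borel_measurable_real]
  obtain a b where ab: "a \<in> borel_measurable lborel" "b \<in> borel_measurable lborel"
    "AE x in lborel. Re (f x) = a x" "AE x in lborel. Im (f x) = b x" by blast
  show thesis
  proof (rule that)
    show "(\<lambda>x. Complex (a x) (b x)) \<in> borel_measurable borel"
      using ab(1,2) by (auto simp: borel_measurable_complex_iff)
    show "AE x in lborel. f x = Complex (a x) (b x)"
      using ab(3,4) by eventually_elim (simp add: complex_eq_iff)
  qed
qed

lemma dunkl_morrey_norm_ge:
  assumes "r > 0"
  shows "ennreal (1 / \<phi> r * (1 / r powr dunkl_dim \<alpha> *
            (LINT y:ball 0 r|dunkl_measure \<alpha>. dunkl_translation \<alpha> x (\<lambda>z. norm (f z) powr p) y)) powr (1 / p))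
    \<le> dunkl_morrey_norm \<alpha> p \<phi> f"
  unfolding dunkl_morrey_norm_def
  by (rule SUP_upper2[of "(r, x)"]) (use assms in auto)

lemma dunkl_locally_integrable_iff:
  fixes f :: "real \<Rightarrow> complex"
  assumes f': "f' \<in> borel_measurable borel" and eq: "AE x in lborel. f x = f' x" and \<alpha>: "\<alpha> \<ge> -1/2"
  shows "dunkl_locally_integrable \<alpha> p f \<longleftrightarrow> f \<in> borel_measurable lebesgue \<and>
    (\<forall>R. ball_integral \<alpha> (\<lambda>z. norm (f' z) powr p) 0 R < \<infinity>)"
proof -
  note [measurable] = f'
  have fm: "f \<in> borel_measurable lebesgue"
    by (rule borel_measurable_AE[of f']) (use eq in \<open>auto intro: measurable_completion AE_completion elim!: eventually_mono\<close>)
  have bound: "(\<integral>\<^sup>+z. ennreal (norm (indicator S z *\<^sub>R norm (f z) powr p)) \<partial>dunkl_measure \<alpha>)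
     = (\<integral>\<^sup>+z. ennreal (norm (f' z) powr p) * indicator S z \<partial>dunkl_borel \<alpha>)" if S: "S \<in> sets borel" for S
  proof (rule nn_integral_dunkl_measure_cong_AE)
    show "(\<lambda>z. ennreal (norm (f' z) powr p) * indicator S z) \<in> borel_measurable borel" using S by measurable
    show "AE z in lborel. ennreal (norm (indicator S z *\<^sub>R norm (f z) powr p)) = ennreal (norm (f' z) powr p) * indicator S z"
      using eq by eventually_elim (auto split: split_indicator)
  qed
  have set: "set_integrable (dunkl_measure \<alpha>) S (\<lambda>x. norm (f x) powr p) \<longleftrightarrow>
     (\<integral>\<^sup>+z. ennreal (norm (f' z) powr p) * indicator S z \<partial>dunkl_borel \<alpha>) < \<infinity>" if S: "S \<in> sets borel" for S
  proof -
    have "(\<lambda>x. indicator S x *\<^sub>R norm (f x) powr p) \<in> borel_measurable (dunkl_measure \<alpha>)"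
    proof -
      have "(\<lambda>x. indicator S x *\<^sub>R norm (f x) powr p) \<in> borel_measurable lebesgue"
        using fm S by (intro borel_measurable_scaleR borel_measurable_indicator) auto
      then show ?thesis by (simp add: dunkl_measure_def)
    qed
    then show ?thesis
      unfolding set_integrable_def integrable_iff_bounded bound[OF S] by simp
  qed
  show ?thesis
    unfolding dunkl_locally_integrable_def
  proof (intro conj_cong refl iffI allI impI)
    fix R assume "\<forall>S. compact S \<longrightarrow> set_integrable (dunkl_measure \<alpha>) S (\<lambda>x. norm (f x) powr p)"
    then have "set_integrable (dunkl_measure \<alpha>) (cball 0 R) (\<lambda>x. norm (f x) powr p)" by simp
    then have "(\<integral>\<^sup>+z. ennreal (norm (f' z) powr p) * indicator (cball 0 R) z \<partial>dunkl_borel \<alpha>) < \<infinity>"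
      by (subst (asm) set) auto
    then show "ball_integral \<alpha> (\<lambda>z. norm (f' z) powr p) 0 R < \<infinity>"
      by (rule le_less_trans[rotated]) (auto intro!: nn_integral_mono split: split_indicator)
  next
    fix S :: "real set" assume fin: "\<forall>R. ball_integral \<alpha> (\<lambda>z. norm (f' z) powr p) 0 R < \<infinity>" and S: "compact S"
    obtain R where "S \<subseteq> ball 0 R" using bounded_subset_ballD[OF compact_imp_bounded[OF S], of 0] by blast
    then have "(\<integral>\<^sup>+z. ennreal (norm (f' z) powr p) * indicator S z \<partial>dunkl_borel \<alpha>)
      \<le> ball_integral \<alpha> (\<lambda>z. norm (f' z) powr p) 0 R"
      by (intro nn_integral_mono) (auto split: split_indicator)
    also have "\<dots> < \<infinity>" using fin by blast
    finally show "set_integrable (dunkl_measure \<alpha>) S (\<lambda>x. norm (f x) powr p)"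
      by (subst set) (use S in \<open>auto intro: borel_compact\<close>)
  qed
qed

lemma morrey_integral_eq:
  fixes f f' :: "real \<Rightarrow> complex"
  assumes [measurable]: "f' \<in> borel_measurable borel" and eq: "AE x in lborel. f x = f' x" and \<alpha>: "\<alpha> \<ge> -1/2"
    and loc: "\<And>R. ball_integral \<alpha> (\<lambda>z. norm (f' z) powr p) 0 R < \<infinity>"
  shows "(LINT y:ball 0 r|dunkl_measure \<alpha>. dunkl_translation \<alpha> x (\<lambda>z. norm (f z) powr p) y)
    = enn2real (\<integral>\<^sup>+z. ennreal (norm (f' z) powr p) * ball_translation \<alpha> (- x) r z \<partial>dunkl_borel \<alpha>)"
proof (rule integral_ball_dunkl_translation[OF _ \<alpha>])
  show "AE z in lborel. norm (f z) powr p = norm (f' z) powr p" using eq by eventually_elim simp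
qed (use loc in auto)

text \<open>
The translate by \<open>- x\<close> of the ball of radius \<open>2 r\<close> is bounded below on the ball of radius \<open>r\<close> around \<open>x\<close>. The passage
from radius \<open>2 r\<close> back to \<open>r\<close> uses that \<open>dunkl_vol\<close> is doubling and that \<open>\<phi>\<close> is almost decreasing.
\<close>

lemma dunkl_morrey_norm_imp_ball_bound:
  assumes \<alpha>: "\<alpha> \<ge> -1/2" and p: "p \<ge> 1" and \<phi>pos: "\<And>r. r > 0 \<Longrightarrow> \<phi> r > 0" and ad: "almost_decreasing \<phi>"
  obtains C where "C > 0"
    "\<And>(f :: real \<Rightarrow> complex) f' N. f' \<in> borel_measurable borel \<Longrightarrow> AE x in lborel. f x = f' x \<Longrightarrow>
       dunkl_locally_integrable \<alpha> p f \<Longrightarrow> N > 0 \<Longrightarrow> dunkl_morrey_norm \<alpha> p \<phi> f \<le> ennreal N \<Longrightarrow>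
       ball_morrey_bound \<alpha> p \<phi> (\<lambda>y. norm (f' y)) (C * N)"
proof -
  obtain cT where cT: "cT > 0" "\<And>x r y. r > 0 \<Longrightarrow> \<bar>x - y\<bar> < r / 2 \<Longrightarrow>
     ennreal (cT * (r / (\<bar>x\<bar> + r)) powr (2 * \<alpha> + 1)) \<le> ball_translation \<alpha> (- x) r y"
    by (rule ball_translation_lower[OF \<alpha>]) (rule that, assumption, blast)
  obtain Ca where Ca: "Ca > 0" "\<And>r s. r > 0 \<Longrightarrow> r \<le> s \<Longrightarrow> \<phi> r \<ge> Ca * \<phi> s"
    using ad unfolding almost_decreasing_def by blast
  define w where "w = 2 * dunkl_weight \<alpha> 1"
  have w: "w > 0" using dunkl_weight_1_pos[OF \<alpha>] by (simp add: w_def)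
  define K where "K = 2 powr (2 * \<alpha> + 2) / (cT * w)"
  have K: "K > 0" using cT w by (simp add: K_def)
  define C where "C = K powr (1 / p) / Ca"
  have C: "C > 0" using K Ca by (simp add: C_def)
  show thesis
  proof (rule that[OF C])
    fix f f' :: "real \<Rightarrow> complex" and N :: real
    assume [measurable]: "f' \<in> borel_measurable borel" and eq: "AE x in lborel. f x = f' x"
      and li: "dunkl_locally_integrable \<alpha> p f" and N: "N > 0" and le: "dunkl_morrey_norm \<alpha> p \<phi> f \<le> ennreal N"
    have loc: "ball_integral \<alpha> (\<lambda>z. norm (f' z) powr p) 0 R < \<infinity>" for R
      using li dunkl_locally_integrable_iff[of f' f \<alpha> p] eq \<alpha> by simp
    show "ball_morrey_bound \<alpha> p \<phi> (\<lambda>y. norm (f' y)) (C * N)"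
      unfolding ball_morrey_bound_def
    proof (intro allI impI)
      fix x r :: real assume r: "r > 0"
      define \<rho> where "\<rho> = 2 * r"
      have \<rho>: "\<rho> > 0" using r by (simp add: \<rho>_def)
      let ?I = "\<integral>\<^sup>+z. ennreal (norm (f' z) powr p) * ball_translation \<alpha> (- x) \<rho> z \<partial>dunkl_borel \<alpha>"
      let ?L = "LINT y:ball 0 \<rho>|dunkl_measure \<alpha>. dunkl_translation \<alpha> x (\<lambda>z. norm (f z) powr p) y"
      have L: "?L = enn2real ?I" by (rule morrey_integral_eq[OF _ eq \<alpha> loc]) measurable
      have Ifin: "?I < \<infinity>"
      proof -
        have "?I \<le> (\<integral>\<^sup>+z. 2 * (ennreal (norm (f' z) powr p) * indicator (ball 0 (\<bar>x\<bar> + \<rho>)) z) \<partial>dunkl_borel \<alpha>)"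
        proof (rule nn_integral_mono)
          fix z
          show "ennreal (norm (f' z) powr p) * ball_translation \<alpha> (- x) \<rho> z \<le> 2 * (ennreal (norm (f' z) powr p) * indicator (ball 0 (\<bar>x\<bar> + \<rho>)) z)"
          proof (cases "z \<in> ball 0 (\<bar>x\<bar> + \<rho>)")
            case True
            have "ennreal (norm (f' z) powr p) * ball_translation \<alpha> (- x) \<rho> z \<le> ennreal (norm (f' z) powr p) * 2"
              by (intro mult_left_mono ball_translation_le_2 \<alpha>) simp
            then show ?thesis using True by (simp add: mult.commute)
          next
            case False
            then have "\<rho> \<le> \<bar>\<bar>- x\<bar> - \<bar>z\<bar>\<bar>" by simp
            then show ?thesis by (simp add: ball_translation_eq_0)
          qed
        qed
        also have "\<dots> = 2 * ball_integral \<alpha> (\<lambda>z. norm (f' z) powr p) 0 (\<bar>x\<bar> + \<rho>)"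
          by (rule nn_integral_cmult) measurable
        also have "\<dots> < \<infinity>" using loc by (simp add: ennreal_mult_less_top)
        finally show ?thesis .
      qed
      have Lnn: "?L \<ge> 0" unfolding L by simp
      have "ennreal (1 / \<phi> \<rho> * (1 / \<rho> powr dunkl_dim \<alpha> * ?L) powr (1 / p)) \<le> ennreal N"
        by (rule order_trans[OF dunkl_morrey_norm_ge[OF \<rho>] le])
      then have "1 / \<phi> \<rho> * (1 / \<rho> powr dunkl_dim \<alpha> * ?L) powr (1 / p) \<le> N" using N by simp
      then have "(1 / \<rho> powr dunkl_dim \<alpha> * ?L) powr (1 / p) \<le> \<phi> \<rho> * N" using \<phi>pos[OF \<rho>] by (simp add: field_simps)
      then have "((1 / \<rho> powr dunkl_dim \<alpha> * ?L) powr (1 / p)) powr p \<le> (\<phi> \<rho> * N) powr p"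
        using p by (intro powr_mono2) auto
      moreover have "((1 / \<rho> powr dunkl_dim \<alpha> * ?L) powr (1 / p)) powr p = 1 / \<rho> powr dunkl_dim \<alpha> * ?L"
        using p Lnn by (simp add: powr_powr)
      ultimately have "1 / \<rho> powr dunkl_dim \<alpha> * ?L \<le> (\<phi> \<rho> * N) powr p" by simp
      then have Lle: "?L \<le> \<rho> powr dunkl_dim \<alpha> * (\<phi> \<rho> * N) powr p" using \<rho> by (simp add: field_simps)
      have Ile: "?I \<le> ennreal (\<rho> powr dunkl_dim \<alpha> * (\<phi> \<rho> * N) powr p)"
      proof -
        have "?I = ennreal (enn2real ?I)" using Ifin by (simp add: less_top)
        also have "\<dots> \<le> ennreal (\<rho> powr dunkl_dim \<alpha> * (\<phi> \<rho> * N) powr p)" using Lle unfolding L by (rule ennreal_leI)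
        finally show ?thesis .
      qed
      define e where "e = cT * (\<rho> / (\<bar>x\<bar> + \<rho>)) powr (2 * \<alpha> + 1)"
      have e: "e > 0" unfolding e_def using cT \<rho> by (intro mult_pos_pos) auto
      have "ennreal e * ball_integral \<alpha> (\<lambda>y. norm (f' y) powr p) x r
        = (\<integral>\<^sup>+y. ennreal e * (ennreal (norm (f' y) powr p) * indicator (ball x r) y) \<partial>dunkl_borel \<alpha>)"
        by (rule nn_integral_cmult[symmetric]) measurable
      also have "\<dots> \<le> ?I"
      proof (rule nn_integral_mono)
        fix y
        show "ennreal e * (ennreal (norm (f' y) powr p) * indicator (ball x r) y) \<le> ennreal (norm (f' y) powr p) * ball_translation \<alpha> (- x) \<rho> y"
        proof (cases "y \<in> ball x r")
          case True
          then have "ennreal e \<le> ball_translation \<alpha> (- x) \<rho> y"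
            unfolding e_def by (intro cT(2) \<rho>) (auto simp: \<rho>_def dist_real_def)
          then have "ennreal (norm (f' y) powr p) * ennreal e \<le> ennreal (norm (f' y) powr p) * ball_translation \<alpha> (- x) \<rho> y"
            by (rule mult_left_mono) simp
          then show ?thesis using True by (simp add: mult.commute)
        qed simp
      qed
      finally have "ennreal e * ball_integral \<alpha> (\<lambda>y. norm (f' y) powr p) x r \<le> ennreal (\<rho> powr dunkl_dim \<alpha> * (\<phi> \<rho> * N) powr p)"
        using Ile by (rule order_trans)
      then have "ennreal (1 / e) * (ennreal e * ball_integral \<alpha> (\<lambda>y. norm (f' y) powr p) x r) \<le> ennreal (1 / e) * ennreal (\<rho> powr dunkl_dim \<alpha> * (\<phi> \<rho> * N) powr p)"
        by (rule mult_left_mono) simp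
      moreover have "ennreal (1 / e) * (ennreal e * X) = X" for X
        using e by (simp add: mult.assoc[symmetric] ennreal_mult[symmetric])
      moreover have "ennreal (1 / e) * ennreal (\<rho> powr dunkl_dim \<alpha> * (\<phi> \<rho> * N) powr p) = ennreal (1 / e * (\<rho> powr dunkl_dim \<alpha> * (\<phi> \<rho> * N) powr p))"
        using e by (intro ennreal_mult'[symmetric]) simp
      ultimately have main: "ball_integral \<alpha> (\<lambda>y. norm (f' y) powr p) x r \<le> ennreal (1 / e * (\<rho> powr dunkl_dim \<alpha> * (\<phi> \<rho> * N) powr p))"
        by simp
      have "1 / e * (\<rho> powr dunkl_dim \<alpha> * (\<phi> \<rho> * N) powr p) \<le> dunkl_vol \<alpha> x r * (\<phi> r * (C * N)) powr p"
      proof -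
        have V: "e * dunkl_vol \<alpha> x \<rho> = cT * w * \<rho> powr dunkl_dim \<alpha>"
          using powr_eq_dunkl_vol[OF \<rho> \<alpha>, of x] by (simp add: e_def w_def)
        then have "1 / e * \<rho> powr dunkl_dim \<alpha> = dunkl_vol \<alpha> x \<rho> / (cT * w)"
          using e cT w by (simp add: field_simps)
        also have "\<dots> \<le> 2 powr (2 * \<alpha> + 2) * dunkl_vol \<alpha> x r / (cT * w)"
          unfolding \<rho>_def using cT w by (intro divide_right_mono dunkl_vol_dilate \<alpha> r) auto
        also have "\<dots> = K * dunkl_vol \<alpha> x r" by (simp add: K_def)
        finally have 1: "1 / e * \<rho> powr dunkl_dim \<alpha> \<le> K * dunkl_vol \<alpha> x r" .
        have "\<phi> \<rho> \<le> \<phi> r / Ca" using Ca(2)[of r \<rho>] r Ca(1) by (simp add: \<rho>_def field_simps)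
        then have "(\<phi> \<rho> * N) powr p \<le> (\<phi> r / Ca * N) powr p"
          using N p \<phi>pos[OF \<rho>] by (intro powr_mono2 mult_right_mono) auto
        then have "(1 / e * \<rho> powr dunkl_dim \<alpha>) * (\<phi> \<rho> * N) powr p \<le> (K * dunkl_vol \<alpha> x r) * (\<phi> r / Ca * N) powr p"
          using K dunkl_vol_pos[OF \<alpha> r, of x] by (intro mult_mono[OF 1]) auto
        also have "\<dots> = dunkl_vol \<alpha> x r * (\<phi> r * (C * N)) powr p"
        proof -
          have "\<phi> r * (C * N) = K powr (1 / p) * (\<phi> r / Ca * N)" by (simp add: C_def)
          also have "(K powr (1 / p) * (\<phi> r / Ca * N)) powr p = K * (\<phi> r / Ca * N) powr p"
            unfolding powr_mult powr_powr using p K by simp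
          finally show ?thesis by simp
        qed
        finally show ?thesis by (simp add: mult.assoc)
      qed
      then show "ball_integral \<alpha> (\<lambda>y. norm (f' y) powr p) x r \<le> ennreal (dunkl_vol \<alpha> x r * (\<phi> r * (C * N)) powr p)"
        by (rule order_trans[OF main ennreal_leI])
    qed
  qed
qed

lemma ball_morrey_bound_mono_AE:
  assumes "ball_morrey_bound \<alpha> q \<psi> g N" and "AE y in dunkl_borel \<alpha>. h y \<le> g y" and "\<And>y. h y \<ge> 0" and "q > 0"
  shows "ball_morrey_bound \<alpha> q \<psi> h N"
  unfolding ball_morrey_bound_def
proof (intro allI impI)
  fix x r :: real assume r: "r > 0"
  have "ball_integral \<alpha> (\<lambda>y. h y powr q) x r \<le> ball_integral \<alpha> (\<lambda>y. g y powr q) x r"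
  proof (rule nn_integral_mono_AE)
    show "AE y in dunkl_borel \<alpha>. ennreal (h y powr q) * indicator (ball x r) y \<le> ennreal (g y powr q) * indicator (ball x r) y"
      using assms(2)
    proof eventually_elim
      fix y assume "h y \<le> g y"
      then have "h y powr q \<le> g y powr q" using assms(3,4) by (intro powr_mono2) auto
      then show "ennreal (h y powr q) * indicator (ball x r) y \<le> ennreal (g y powr q) * indicator (ball x r) y"
        by (intro mult_right_mono ennreal_leI) auto
    qed
  qed
  then show "ball_integral \<alpha> (\<lambda>y. h y powr q) x r \<le> ennreal (dunkl_vol \<alpha> x r * (\<psi> r * N) powr q)"
    using assms(1) r unfolding ball_morrey_bound_def by (meson order_trans)
qed

text \<open>
The translate by \<open>- x\<close> of a ball is supported in two balls, around \<open>x\<close> and \<open>- x\<close>, on which its size is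
known. The hypothesis applies to both of them because it is uniform in the centre.
\<close>

lemma ball_bound_imp_dunkl_morrey_norm:
  assumes \<alpha>: "\<alpha> \<ge> -1/2" and q: "q > 0" and \<psi>pos: "\<And>r. r > 0 \<Longrightarrow> \<psi> r > 0"
  obtains C where "C > 0"
    "\<And>(f :: real \<Rightarrow> complex) f' N. f' \<in> borel_measurable borel \<Longrightarrow> AE x in lborel. f x = f' x \<Longrightarrow> N > 0 \<Longrightarrow>
       ball_morrey_bound \<alpha> q \<psi> (\<lambda>y. norm (f' y)) N \<Longrightarrow>
       dunkl_locally_integrable \<alpha> q f \<and> dunkl_morrey_norm \<alpha> q \<psi> f \<le> ennreal (C * N)"
proof -
  obtain CT where CT: "CT > 0" and T: "\<And>x r y. r > 0 \<Longrightarrow> ball_translation \<alpha> x r y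
     \<le> ennreal (CT * (r / (\<bar>x\<bar> + r)) powr (2 * \<alpha> + 1)) * indicator {y. \<bar>\<bar>x\<bar> - \<bar>y\<bar>\<bar> < r} y"
    by (rule ball_translation_upper[OF \<alpha>]) (rule that, assumption+)
  define w where "w = 2 * dunkl_weight \<alpha> 1"
  have w: "w > 0" using dunkl_weight_1_pos[OF \<alpha>] by (simp add: w_def)
  define K where "K = 2 * CT * w"
  have K: "K > 0" using CT w by (simp add: K_def)
  have C: "K powr (1 / q) > 0" using K by simp
  show thesis
  proof (rule that[OF C])
    fix f f' :: "real \<Rightarrow> complex" and N :: real
    assume [measurable]: "f' \<in> borel_measurable borel" and eq: "AE x in lborel. f x = f' x" and N: "N > 0"
      and "ball_morrey_bound \<alpha> q \<psi> (\<lambda>y. norm (f' y)) N"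
    then have ball: "\<And>x r. r > 0 \<Longrightarrow> ball_integral \<alpha> (\<lambda>y. norm (f' y) powr q) x r \<le> ennreal (dunkl_vol \<alpha> x r * (\<psi> r * N) powr q)"
      by (simp add: ball_morrey_bound_def)
    have loc: "ball_integral \<alpha> (\<lambda>z. norm (f' z) powr q) 0 R < \<infinity>" for R
    proof (cases "R > 0")
      case True then show ?thesis using ball[OF True, of 0] by (auto intro: le_less_trans)
    qed (simp add: ball_empty)
    have fm: "f \<in> borel_measurable lebesgue"
      by (rule borel_measurable_AE[of f']) (use eq in \<open>auto intro: measurable_completion AE_completion elim!: eventually_mono\<close>)
    have li: "dunkl_locally_integrable \<alpha> q f"
      using dunkl_locally_integrable_iff[of f' f \<alpha> q] eq \<alpha> loc fm by simp
    have "dunkl_morrey_norm \<alpha> q \<psi> f \<le> ennreal (K powr (1 / q) * N)"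
      unfolding dunkl_morrey_norm_def
    proof (rule SUP_least, clarify)
      fix r x :: real assume r: "r > 0"
      let ?I = "\<integral>\<^sup>+z. ennreal (norm (f' z) powr q) * ball_translation \<alpha> (- x) r z \<partial>dunkl_borel \<alpha>"
      let ?L = "LINT y:ball 0 r|dunkl_measure \<alpha>. dunkl_translation \<alpha> x (\<lambda>z. norm (f z) powr q) y"
      have L: "?L = enn2real ?I" by (rule morrey_integral_eq[OF _ eq \<alpha> loc]) measurable
      define e where "e = CT * (r / (\<bar>x\<bar> + r)) powr (2 * \<alpha> + 1)"
      have e: "e > 0" unfolding e_def using CT r by (intro mult_pos_pos) auto
      let ?A = "dunkl_vol \<alpha> x r * (\<psi> r * N) powr q"
      have A: "?A \<ge> 0" using dunkl_vol_pos[OF \<alpha> r, of x] by simp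
      have "?I \<le> (\<integral>\<^sup>+z. ennreal e * (ennreal (norm (f' z) powr q) * indicator (ball x r) z + ennreal (norm (f' z) powr q) * indicator (ball (- x) r) z) \<partial>dunkl_borel \<alpha>)"
      proof (rule nn_integral_mono)
        fix z
        have "indicator {y. \<bar>\<bar>- x\<bar> - \<bar>y\<bar>\<bar> < r} z \<le> indicator (ball x r) z + (indicator (ball (- x) r) z :: ennreal)"
          by (auto split: split_indicator simp: dist_real_def)
        then have "ball_translation \<alpha> (- x) r z \<le> ennreal e * (indicator (ball x r) z + indicator (ball (- x) r) z)"
          using order_trans[OF T[OF r, of "- x" z] mult_left_mono] by (simp add: e_def)
        then have "ennreal (norm (f' z) powr q) * ball_translation \<alpha> (- x) r z \<le> ennreal (norm (f' z) powr q) * (ennreal e * (indicator (ball x r) z + indicator (ball (- x) r) z))"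
          by (rule mult_left_mono) simp
        then show "ennreal (norm (f' z) powr q) * ball_translation \<alpha> (- x) r z
          \<le> ennreal e * (ennreal (norm (f' z) powr q) * indicator (ball x r) z + ennreal (norm (f' z) powr q) * indicator (ball (- x) r) z)"
          by (simp only: distrib_left mult.left_commute)
      qed
      also have "\<dots> = ennreal e * (ball_integral \<alpha> (\<lambda>z. norm (f' z) powr q) x r + ball_integral \<alpha> (\<lambda>z. norm (f' z) powr q) (- x) r)"
        by (subst nn_integral_cmult) (auto intro!: arg_cong2[where f="(*)"] nn_integral_add)
      also have "\<dots> \<le> ennreal e * (ennreal ?A + ennreal ?A)"
        using ball[OF r, of x] ball[OF r, of "- x"] by (intro mult_left_mono add_mono) auto
      also have "\<dots> = ennreal (e * (?A + ?A))"
        unfolding ennreal_plus[OF A A, symmetric] using e by (intro ennreal_mult'[symmetric]) simp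
      also have "e * (?A + ?A) = r powr dunkl_dim \<alpha> * (K * (\<psi> r * N) powr q)"
      proof -
        have V: "e * dunkl_vol \<alpha> x r = CT * w * r powr dunkl_dim \<alpha>"
          using powr_eq_dunkl_vol[OF r \<alpha>, of x] by (simp add: e_def w_def)
        have "e * (?A + ?A) = 2 * (e * dunkl_vol \<alpha> x r) * (\<psi> r * N) powr q" by simp
        then show ?thesis unfolding V by (simp add: K_def mult_ac)
      qed
      finally have I: "?I \<le> ennreal (r powr dunkl_dim \<alpha> * (K * (\<psi> r * N) powr q))" .
      have "?L \<le> r powr dunkl_dim \<alpha> * (K * (\<psi> r * N) powr q)"
        unfolding L using K by (intro enn2real_leI I) auto
      then have "1 / r powr dunkl_dim \<alpha> * ?L \<le> K * (\<psi> r * N) powr q" using r by (simp add: field_simps)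
      moreover have "0 \<le> 1 / r powr dunkl_dim \<alpha> * ?L" unfolding L by simp
      ultimately have "(1 / r powr dunkl_dim \<alpha> * ?L) powr (1 / q) \<le> (K * (\<psi> r * N) powr q) powr (1 / q)"
        using q by (intro powr_mono2) auto
      also have "\<dots> = K powr (1 / q) * (\<psi> r * N)"
        unfolding powr_mult powr_powr using q \<psi>pos[OF r] N by simp
      finally have "1 / \<psi> r * (1 / r powr dunkl_dim \<alpha> * ?L) powr (1 / q) \<le> 1 / \<psi> r * (K powr (1 / q) * (\<psi> r * N))"
        using \<psi>pos[OF r] by (intro mult_left_mono) auto
      also have "\<dots> = K powr (1 / q) * N" using \<psi>pos[OF r] by simp
      finally show "ennreal (1 / \<psi> r * (1 / r powr dunkl_dim \<alpha> * ?L) powr (1 / q)) \<le> ennreal (K powr (1 / q) * N)"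
        by (rule ennreal_leI)
    qed
    then show "dunkl_locally_integrable \<alpha> q f \<and> dunkl_morrey_norm \<alpha> q \<psi> f \<le> ennreal (K powr (1 / q) * N)"
      using li by blast
  qed
qed

section \<open>The potential operator and the norm of its kernel\<close>

lemma bessel_riesz_kernel_nonneg: "bessel_riesz_kernel \<alpha> \<beta> \<gamma> x \<ge> 0"
  and bessel_riesz_kernel_even: "bessel_riesz_kernel \<alpha> \<beta> \<gamma> (- x) = bessel_riesz_kernel \<alpha> \<beta> \<gamma> x"
  by (simp_all add: bessel_riesz_kernel_def)

text \<open>
The translated kernel is nonnegative, as the kernel is even and nonnegative, and at most its translate in
\<open>[0, \<infinity>]\<close>. The two differ where the latter is infinite, since the Bochner integral is \<open>0\<close> there.
\<close>

lemma bessel_riesz_le_majorant: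
  fixes f f' :: "real \<Rightarrow> complex" and \<beta> \<gamma> :: real
  assumes \<alpha>: "\<alpha> \<ge> -1/2" and f': "f' \<in> borel_measurable borel" and eq: "AE x in lborel. f x = f' x"
  defines "h \<equiv> \<lambda>x. LINT y|dunkl_borel \<alpha>. bessel_riesz_integrand \<alpha> \<beta> \<gamma> f' x y"
  shows "h \<in> borel_measurable borel" "bessel_riesz \<alpha> \<beta> \<gamma> f = h"
    "riesz_majorant \<alpha> \<beta> \<gamma> (\<lambda>y. norm (f' y)) x < \<infinity> \<Longrightarrow> integrable (dunkl_measure \<alpha>) (bessel_riesz_integrand \<alpha> \<beta> \<gamma> f x)"
    "riesz_majorant \<alpha> \<beta> \<gamma> (\<lambda>y. norm (f' y)) x < \<infinity> \<Longrightarrow> norm (h x) \<le> enn2real (riesz_majorant \<alpha> \<beta> \<gamma> (\<lambda>y. norm (f' y)) x)"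
proof -
  note [measurable] = f'
  interpret D: sigma_finite_measure "dunkl_borel \<alpha>" by (rule sigma_finite_dunkl_borel)
  have [measurable]: "(\<lambda>q. dunkl_translation \<alpha> (fst q) (bessel_riesz_kernel \<alpha> \<beta> \<gamma>) (snd q)) \<in> borel_measurable (borel \<Otimes>\<^sub>M dunkl_borel \<alpha>)"
    by (rule dunkl_translation_measurable) measurable
  have "(\<lambda>(x, y). bessel_riesz_integrand \<alpha> \<beta> \<gamma> f' x y) \<in> borel_measurable (borel \<Otimes>\<^sub>M dunkl_borel \<alpha>)"
    unfolding bessel_riesz_integrand_def case_prod_beta' by measurable
  from D.borel_measurable_lebesgue_integral[OF this] show "h \<in> borel_measurable borel"
    unfolding h_def by simp
  have [measurable]: "(\<lambda>y. dunkl_translation \<alpha> x (bessel_riesz_kernel \<alpha> \<beta> \<gamma>) y) \<in> borel_measurable borel" for x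
    by (rule dunkl_translation_measurable) measurable
  have m'[measurable]: "bessel_riesz_integrand \<alpha> \<beta> \<gamma> f' x \<in> borel_measurable borel" for x
    unfolding bessel_riesz_integrand_def by measurable
  have ae: "AE y in lborel. bessel_riesz_integrand \<alpha> \<beta> \<gamma> f' x y = bessel_riesz_integrand \<alpha> \<beta> \<gamma> f x y" for x
    using eq by eventually_elim (simp add: bessel_riesz_integrand_def)
  have ae2: "AE y in dunkl_measure \<alpha>. bessel_riesz_integrand \<alpha> \<beta> \<gamma> f x y = bessel_riesz_integrand \<alpha> \<beta> \<gamma> f' x y" for x
    using AE_dunkl_measure(1)[OF ae[of x]] by eventually_elim simp
  have m1: "bessel_riesz_integrand \<alpha> \<beta> \<gamma> f' x \<in> borel_measurable lebesgue" for x
    using m' by (auto intro: measurable_completion)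
  have m2: "bessel_riesz_integrand \<alpha> \<beta> \<gamma> f x \<in> borel_measurable lebesgue" for x
    by (rule borel_measurable_AE[OF m1 AE_completion[OF ae]])
  have sd: "borel_measurable (dunkl_measure \<alpha>) = (borel_measurable lebesgue :: (real \<Rightarrow> complex) set)"
    by (intro measurable_cong_sets) (auto simp: sets_dunkl_measure)
  show "bessel_riesz \<alpha> \<beta> \<gamma> f = h"
  proof
    fix x
    have "bessel_riesz \<alpha> \<beta> \<gamma> f x = (LINT y|dunkl_measure \<alpha>. bessel_riesz_integrand \<alpha> \<beta> \<gamma> f' x y)"
      unfolding bessel_riesz_def
      by (rule integral_cong_AE) (use m1[of x] m2[of x] sd ae2[of x] in auto)
    also have "\<dots> = h x" unfolding h_def by (rule integral_dunkl_measure_eq(1)) (use \<alpha> in auto)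
    finally show "bessel_riesz \<alpha> \<beta> \<gamma> f x = h x" .
  qed
  let ?J = "riesz_majorant \<alpha> \<beta> \<gamma> (\<lambda>y. norm (f' y)) x"
  have le: "(\<integral>\<^sup>+y. ennreal (norm (bessel_riesz_integrand \<alpha> \<beta> \<gamma> f' x y)) \<partial>dunkl_borel \<alpha>) \<le> ?J"
    unfolding riesz_majorant_def
  proof (rule nn_integral_mono)
    fix y
    have t: "0 \<le> dunkl_translation \<alpha> x (bessel_riesz_kernel \<alpha> \<beta> \<gamma>) y"
      "ennreal (dunkl_translation \<alpha> x (bessel_riesz_kernel \<alpha> \<beta> \<gamma>) y) \<le> even_translation \<alpha> x (\<lambda>t. ennreal (bessel_riesz_kernel \<alpha> \<beta> \<gamma> t)) y"
      by (rule dunkl_translation_even_le[OF bessel_riesz_kernel_measurable \<alpha>], rule bessel_riesz_kernel_nonneg, rule bessel_riesz_kernel_even)+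
    have "ennreal (norm (bessel_riesz_integrand \<alpha> \<beta> \<gamma> f' x y)) = ennreal (norm (f' y)) * ennreal (dunkl_translation \<alpha> x (bessel_riesz_kernel \<alpha> \<beta> \<gamma>) y)"
      using t(1) by (simp add: bessel_riesz_integrand_def ennreal_mult mult.commute)
    also have "\<dots> \<le> ennreal (norm (f' y)) * even_translation \<alpha> x (\<lambda>t. ennreal (bessel_riesz_kernel \<alpha> \<beta> \<gamma> t)) y"
      by (intro mult_left_mono t(2)) simp
    finally show "ennreal (norm (bessel_riesz_integrand \<alpha> \<beta> \<gamma> f' x y)) \<le> ennreal (norm (f' y)) * even_translation \<alpha> x (\<lambda>t. ennreal (bessel_riesz_kernel \<alpha> \<beta> \<gamma> t)) y" .
  qed
  assume fin: "?J < \<infinity>"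
  have int: "integrable (dunkl_borel \<alpha>) (bessel_riesz_integrand \<alpha> \<beta> \<gamma> f' x)"
    by (rule integrableI_bounded) (use le fin in \<open>auto intro: le_less_trans\<close>)
  then have "integrable (dunkl_measure \<alpha>) (bessel_riesz_integrand \<alpha> \<beta> \<gamma> f' x)"
    by (subst integral_dunkl_measure_eq(2)) (use \<alpha> in auto)
  then show "integrable (dunkl_measure \<alpha>) (bessel_riesz_integrand \<alpha> \<beta> \<gamma> f x)"
    by (rule integrable_cong_AE_imp) (use m2[of x] sd AE_dunkl_measure(1)[OF ae[of x]] in auto)
  have "ennreal (norm (h x)) \<le> (\<integral>\<^sup>+y. ennreal (norm (bessel_riesz_integrand \<alpha> \<beta> \<gamma> f' x y)) \<partial>dunkl_borel \<alpha>)"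
    unfolding h_def by (rule integral_norm_bound_ennreal[OF int])
  then have "ennreal (norm (h x)) \<le> ?J" using le by (rule order_trans)
  then have "ennreal (norm (h x)) \<le> ennreal (enn2real ?J)" using fin by (simp add: less_top)
  then show "norm (h x) \<le> enn2real ?J" by (simp add: enn2real_nonneg)
qed

text \<open>
The term of the supremum with \<open>x = 0\<close> and \<open>r = 1\<close> is already positive. The upper bound on \<open>s\<close> makes
the \<open>s\<close>-th power of the kernel integrable at \<open>0\<close>; without this the Bochner integrals in the norm
could be \<open>0\<close> by convention.
\<close>

lemma dunkl_morrey_norm_kernel_pos:
  assumes \<alpha>: "\<alpha> \<ge> -1/2" and \<gamma>: "\<gamma> > 0" and \<beta>: "\<beta> < dunkl_dim \<alpha>" and s: "1 \<le> s"
    and s2: "s < dunkl_dim \<alpha> / (dunkl_dim \<alpha> - \<beta>)" and \<omega>: "\<omega> 1 > 0"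
  shows "dunkl_morrey_norm \<alpha> s \<omega> (bessel_riesz_kernel \<alpha> \<beta> \<gamma>) > 0"
proof -
  let ?K = "bessel_riesz_kernel \<alpha> \<beta> \<gamma>"
  define g where "g z = norm (?K z) powr s" for z
  have [measurable]: "g \<in> borel_measurable borel" unfolding g_def by measurable
  define e where "e = (\<beta> - dunkl_dim \<alpha>) * s + dunkl_dim \<alpha>"
  have e: "e > 0" using s2 \<beta> by (simp add: e_def field_simps)
  have geven: "g (- z) = g z" for z by (simp add: g_def bessel_riesz_kernel_even)
  have gle: "g z \<le> z powr ((\<beta> - dunkl_dim \<alpha>) * s)" if "z > 0" for z
  proof -
    have "?K z = z powr (\<beta> - dunkl_dim \<alpha>) / (1 + z) powr \<gamma>"
      using that by (simp add: bessel_riesz_kernel_def)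
    also have "\<dots> \<le> z powr (\<beta> - dunkl_dim \<alpha>) / 1"
      using that \<gamma> ge_one_powr_ge_zero[of "1 + z" \<gamma>] by (intro divide_left_mono) auto
    finally have "?K z \<le> z powr (\<beta> - dunkl_dim \<alpha>)" by simp
    then have "?K z powr s \<le> (z powr (\<beta> - dunkl_dim \<alpha>)) powr s"
      using s bessel_riesz_kernel_nonneg by (intro powr_mono2) auto
    then show ?thesis by (simp add: g_def powr_powr bessel_riesz_kernel_nonneg)
  qed
  have loc: "ball_integral \<alpha> g 0 R < \<infinity>" for R
  proof (cases "R > 0")
    case R: True
    have "ball_integral \<alpha> g 0 R
      = (\<integral>\<^sup>+z. (ennreal (g z) * indicator (ball 0 R) z + ennreal (g (- z)) * indicator (ball 0 R) (- z)) * indicator {0<..} z \<partial>dunkl_borel \<alpha>)"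
      by (rule nn_integral_dunkl_borel_fold) measurable
    also have "\<dots> = (\<integral>\<^sup>+z. ennreal (dunkl_weight \<alpha> z) * ((ennreal (g z) * indicator (ball 0 R) z + ennreal (g (- z)) * indicator (ball 0 R) (- z)) * indicator {0<..} z) \<partial>lborel)"
      by (rule nn_integral_dunkl_borel) measurable
    also have "\<dots> \<le> (\<integral>\<^sup>+z. ennreal (2 * dunkl_weight \<alpha> 1) * (ennreal (z powr (e - 1)) * indicator {0..R} z) \<partial>lborel)"
    proof (rule nn_integral_mono)
      fix z :: real
      show "ennreal (dunkl_weight \<alpha> z) * ((ennreal (g z) * indicator (ball 0 R) z + ennreal (g (- z)) * indicator (ball 0 R) (- z)) * indicator {0<..} z)
        \<le> ennreal (2 * dunkl_weight \<alpha> 1) * (ennreal (z powr (e - 1)) * indicator {0..R} z)"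
      proof (cases "0 < z \<and> z < R")
        case True
        have g0: "g z \<ge> 0" by (simp add: g_def)
        have "dunkl_weight \<alpha> z * (g z + g z) \<le> dunkl_weight \<alpha> z * (2 * z powr ((\<beta> - dunkl_dim \<alpha>) * s))"
          using gle[of z] True dunkl_weight_nonneg[OF \<alpha>, of z] by (intro mult_left_mono) auto
        also have "\<dots> = 2 * dunkl_weight \<alpha> 1 * z powr (e - 1)"
        proof -
          have "z powr (2 * \<alpha> + 1) * z powr ((\<beta> - dunkl_dim \<alpha>) * s) = z powr (e - 1)"
            by (simp add: e_def dunkl_dim_def algebra_simps flip: powr_add)
          then show ?thesis using True by (simp add: dunkl_weight_def)
        qed
        finally have "ennreal (dunkl_weight \<alpha> z * (g z + g z)) \<le> ennreal (2 * dunkl_weight \<alpha> 1 * z powr (e - 1))"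
          by (rule ennreal_leI)
        moreover have "ennreal (dunkl_weight \<alpha> z * (g z + g z)) = ennreal (dunkl_weight \<alpha> z) * (ennreal (g z) + ennreal (g z))"
          unfolding ennreal_plus[OF g0 g0, symmetric] by (rule ennreal_mult'[OF dunkl_weight_nonneg[OF \<alpha>]])
        moreover have "ennreal (2 * dunkl_weight \<alpha> 1 * z powr (e - 1)) = ennreal (2 * dunkl_weight \<alpha> 1) * ennreal (z powr (e - 1))"
          using dunkl_weight_nonneg[OF \<alpha>, of 1] by (intro ennreal_mult') simp
        ultimately show ?thesis using True by (simp add: geven)
      qed (auto split: split_indicator)
    qed
    also have "\<dots> = ennreal (2 * dunkl_weight \<alpha> 1) * ennreal (R powr e / e)"
      by (subst nn_integral_cmult) (auto simp: nn_integral_powr_0[OF R e])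
    also have "\<dots> < \<infinity>" by (simp add: ennreal_mult_less_top)
    finally show ?thesis .
  qed (simp add: ball_empty)
  let ?I = "\<integral>\<^sup>+z. ennreal (g z) * ball_translation \<alpha> 0 1 z \<partial>dunkl_borel \<alpha>"
  have Tm[measurable]: "(\<lambda>z. ball_translation \<alpha> 0 1 z) \<in> borel_measurable borel"
    by (rule ball_translation_measurable) measurable
  have L: "(LINT y:ball 0 1|dunkl_measure \<alpha>. dunkl_translation \<alpha> 0 (\<lambda>z. norm (?K z) powr s) y) = enn2real ?I"
    using integral_ball_dunkl_translation[of g \<alpha> g 1 0] \<alpha> loc by (simp add: g_def[abs_def])
  have "?I \<le> (\<integral>\<^sup>+z. 2 * (ennreal (g z) * indicator (ball 0 1) z) \<partial>dunkl_borel \<alpha>)"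
  proof (rule nn_integral_mono)
    fix z :: real
    show "ennreal (g z) * ball_translation \<alpha> 0 1 z \<le> 2 * (ennreal (g z) * indicator (ball 0 1) z)"
    proof (cases "z \<in> ball 0 1")
      case True
      have "ennreal (g z) * ball_translation \<alpha> 0 1 z \<le> ennreal (g z) * 2"
        by (intro mult_left_mono ball_translation_le_2 \<alpha>) simp
      then show ?thesis using True by (simp add: mult.commute)
    qed (simp add: ball_translation_eq_0)
  qed
  also have "\<dots> = 2 * ball_integral \<alpha> g 0 1"
    by (rule nn_integral_cmult) measurable
  also have "\<dots> < \<infinity>" using loc by (simp add: ennreal_mult_less_top)
  finally have fin: "?I < \<infinity>" .
  have pos: "?I \<noteq> 0"
  proof
    assume "?I = 0"
    then have "AE z in dunkl_borel \<alpha>. ennreal (g z) * ball_translation \<alpha> 0 1 z = 0"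
      by (subst (asm) nn_integral_0_iff_AE) auto
    then have "AE z in lborel. ennreal (g z) * ball_translation \<alpha> 0 1 z = 0"
      by (rule dunkl_borel_AE_lborel[OF \<alpha>])
    then have "AE z in lborel. z \<notin> {0<..<1/2::real}"
    proof eventually_elim
      fix z :: real assume z: "ennreal (g z) * ball_translation \<alpha> 0 1 z = 0"
      show "z \<notin> {0<..<1/2}"
      proof
        assume zz: "z \<in> {0<..<1/2}"
        obtain c where c: "c > 0" "\<And>x r y. r > 0 \<Longrightarrow> \<bar>x - y\<bar> < r / 2 \<Longrightarrow>
          ennreal (c * (r / (\<bar>x\<bar> + r)) powr (2 * \<alpha> + 1)) \<le> ball_translation \<alpha> (- x) r y"
          by (rule ball_translation_lower[OF \<alpha>]) (rule that, assumption, blast)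
        have "ennreal c \<le> ball_translation \<alpha> 0 1 z" using c(2)[of 1 0 z] zz by simp
        then have "ball_translation \<alpha> 0 1 z \<noteq> 0" using c(1) by auto
        moreover have "g z > 0" using zz by (simp add: g_def bessel_riesz_kernel_def)
        ultimately show False using z by simp
      qed
    qed
    then have "emeasure lborel {0<..<1/2::real} = 0"
      by (subst (asm) AE_iff_measurable[of "{0<..<1/2}"]) auto
    then show False by simp
  qed
  have "enn2real ?I > 0" using fin pos by (simp add: enn2real_positive_iff less_top zero_less_iff_neq_zero)
  then have "0 < ennreal (1 / \<omega> 1 * (1 / 1 powr dunkl_dim \<alpha> *
            (LINT y:ball 0 1|dunkl_measure \<alpha>. dunkl_translation \<alpha> 0 (\<lambda>z. norm (?K z) powr s) y)) powr (1 / s))"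
    unfolding L using \<omega> by simp
  also have "\<dots> \<le> dunkl_morrey_norm \<alpha> s \<omega> ?K" by (rule dunkl_morrey_norm_ge) simp
  finally show ?thesis .
qed

theorem theorem4p3:
  fixes \<alpha> \<beta> \<gamma> p q s \<nu> C\<^sub>0 C' C'' :: real and \<omega> \<phi> \<psi> :: "real \<Rightarrow> real"
  assumes "\<alpha> \<ge> - 1 / 2" and "\<gamma> > 0" and "0 < \<beta>" and "\<beta> < dunkl_dim \<alpha>" and "1 < p"
    and "1 \<le> s"
    and "dunkl_dim \<alpha> / (dunkl_dim \<alpha> + \<gamma> - \<beta>) < s"
    and "s < dunkl_dim \<alpha> / (dunkl_dim \<alpha> - \<beta>)"
    and "\<forall>r>0. \<omega> r > 0" and "doubling \<omega>"
    and "C' > 0" and "C'' > 0"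
    and "\<forall>r>0. C' * r powr (\<beta> - dunkl_dim \<alpha>) \<le> \<omega> r \<and> \<omega> r \<le> C'' * r powr (- \<beta>)"
    and "\<forall>r>0. \<phi> r > 0" and "\<phi> \<in> borel_measurable (lebesgue_on {0<..})"
    and "almost_decreasing \<phi>"
    and "almost_increasing (\<lambda>r. r powr (dunkl_dim \<alpha> / p) * \<phi> r)"
    and "C\<^sub>0 > 0" and "\<forall>r>0. \<phi> r \<le> C\<^sub>0 * r powr \<nu>"
    and "\<nu> < - \<beta>" and "- \<beta> < - dunkl_dim \<alpha> - \<nu>"
    and "q = \<nu> * p / (\<nu> + dunkl_dim \<alpha> - \<beta>)"
    and "\<psi> = (\<lambda>r. \<phi> r powr (p / q))"
  shows "\<exists>C>0. \<forall>f :: real \<Rightarrow> complex. f \<in> dunkl_morrey_space \<alpha> p \<phi> \<longrightarrow>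
    (AE x in dunkl_measure \<alpha>.
       integrable (dunkl_measure \<alpha>) (bessel_riesz_integrand \<alpha> \<beta> \<gamma> f x)) \<and>
    bessel_riesz \<alpha> \<beta> \<gamma> f \<in> dunkl_morrey_space \<alpha> q \<psi> \<and>
    dunkl_morrey_norm \<alpha> q \<psi> (bessel_riesz \<alpha> \<beta> \<gamma> f)
      \<le> ennreal C * dunkl_morrey_norm \<alpha> s \<omega> (bessel_riesz_kernel \<alpha> \<beta> \<gamma>)
          * dunkl_morrey_norm \<alpha> p \<phi> f"
proof -
  have \<alpha>: "\<alpha> \<ge> -1/2" by fact
  have \<phi>pos: "\<phi> r > 0" if "r > 0" for r using assms(14) that by blast
  have \<phi>le: "\<phi> r \<le> C\<^sub>0 * r powr \<nu>" if "r > 0" for r using assms(19) that by blast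
  have half: "dunkl_dim \<alpha> = 2 * \<beta>"
  proof (rule ccontr)
    define e where "e = 2 * \<beta> - dunkl_dim \<alpha>"
    assume "dunkl_dim \<alpha> \<noteq> 2 * \<beta>"
    then have e: "e \<noteq> 0" by (simp add: e_def)
    \<comment> \<open>The two bounds on \<open>\<omega>\<close> give \<open>C' r\<^sup>e \<le> C''\<close>; this \<open>r\<close> violates it for either sign of \<open>e\<close>.\<close>
    define r where "r = (C'' / C' + 1) powr (1 / e)"
    have pos: "C'' / C' + 1 > 0" using assms(11,12) by (simp add: add_pos_pos)
    have r: "r > 0" using pos by (simp add: r_def)
    have "r powr e = C'' / C' + 1" using pos e by (simp add: r_def powr_powr)
    moreover have "C' * r powr (\<beta> - dunkl_dim \<alpha>) \<le> C'' * r powr (- \<beta>)" using assms(13) r by force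
    then have "C' * r powr (\<beta> - dunkl_dim \<alpha>) * r powr \<beta> \<le> C'' * r powr (- \<beta>) * r powr \<beta>"
      by (rule mult_right_mono) simp
    then have "C' * (r powr (\<beta> - dunkl_dim \<alpha>) * r powr \<beta>) \<le> C'' * (r powr (- \<beta>) * r powr \<beta>)" by (simp only: mult.assoc)
    moreover have "r powr (- \<beta>) * r powr \<beta> = 1" using r by (simp flip: powr_add)
    moreover have "r powr (\<beta> - dunkl_dim \<alpha>) * r powr \<beta> = r powr e" by (simp add: e_def algebra_simps flip: powr_add)
    ultimately have "C' * (C'' / C' + 1) \<le> C''" by simp
    moreover have "C' * (C'' / C' + 1) = C'' + C'" using assms(11) by (simp add: field_simps)
    ultimately show False using assms(11) by linarith
  qed
  define \<theta> where "\<theta> = 1 + \<beta> / \<nu>"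
  have \<nu>: "\<nu> < 0" using assms(3,20) by linarith
  have \<theta>: "\<theta> > 0" using \<nu> assms(20) by (simp add: \<theta>_def field_simps)
  have q\<theta>: "q * (1 + \<beta> / \<nu>) = p"
  proof -
    have "q = \<nu> * p / (\<nu> + \<beta>)" using assms(22) by (simp add: half)
    moreover have "1 + \<beta> / \<nu> = (\<nu> + \<beta>) / \<nu>" using \<nu> by (simp add: field_simps)
    moreover have "\<nu> + \<beta> \<noteq> 0" using assms(20) by simp
    ultimately show ?thesis using \<nu> by simp
  qed
  have q: "q > 0" using q\<theta> \<theta> assms(5) unfolding \<theta>_def by (metis less_trans zero_less_mult_pos2 zero_less_one)
  have \<psi>pos: "\<psi> r > 0" if "r > 0" for r using \<phi>pos[OF that] by (simp add: assms(23))
  obtain C1 where C1: "C1 > 0"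
    "\<And>(f :: real \<Rightarrow> complex) f' N. f' \<in> borel_measurable borel \<Longrightarrow> AE x in lborel. f x = f' x \<Longrightarrow>
       dunkl_locally_integrable \<alpha> p f \<Longrightarrow> N > 0 \<Longrightarrow> dunkl_morrey_norm \<alpha> p \<phi> f \<le> ennreal N \<Longrightarrow>
       ball_morrey_bound \<alpha> p \<phi> (\<lambda>y. norm (f' y)) (C1 * N)"
    using dunkl_morrey_norm_imp_ball_bound[OF \<alpha> less_imp_le[OF assms(5)] \<phi>pos assms(16)] by blast
  obtain C2 where C2: "C2 > 0"
    "\<And>g N. g \<in> borel_measurable borel \<Longrightarrow> (\<And>y. g y \<ge> (0::real)) \<Longrightarrow> N > 0 \<Longrightarrow>
       ball_morrey_bound \<alpha> p \<phi> g N \<Longrightarrow>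
       (AE x in dunkl_borel \<alpha>. riesz_majorant \<alpha> \<beta> \<gamma> g x < \<infinity>) \<and>
       ball_morrey_bound \<alpha> q \<psi> (\<lambda>y. enn2real (riesz_majorant \<alpha> \<beta> \<gamma> g y)) (C2 * N)"
    unfolding assms(23)
    by (rule riesz_majorant_local_bound[OF \<alpha> assms(3,4,2,5,20,18) \<phi>pos \<phi>le assms(16) q\<theta>]) (assumption, assumption, rule that[unfolded assms(23)], assumption, blast)
  obtain C3 where C3: "C3 > 0"
    "\<And>(f :: real \<Rightarrow> complex) f' N. f' \<in> borel_measurable borel \<Longrightarrow> AE x in lborel. f x = f' x \<Longrightarrow> N > 0 \<Longrightarrow>
       ball_morrey_bound \<alpha> q \<psi> (\<lambda>y. norm (f' y)) N \<Longrightarrow>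
       dunkl_locally_integrable \<alpha> q f \<and> dunkl_morrey_norm \<alpha> q \<psi> f \<le> ennreal (C3 * N)"
    by (rule ball_bound_imp_dunkl_morrey_norm[OF \<alpha> q \<psi>pos]) (assumption, rule that, assumption, blast)
  define M where "M = C3 * (C2 * C1)"
  have M: "M > 0" using C1 C2 C3 by (simp add: M_def)
  have main: "(AE x in dunkl_measure \<alpha>. integrable (dunkl_measure \<alpha>) (bessel_riesz_integrand \<alpha> \<beta> \<gamma> f x)) \<and>
      dunkl_locally_integrable \<alpha> q (bessel_riesz \<alpha> \<beta> \<gamma> f) \<and>
      dunkl_morrey_norm \<alpha> q \<psi> (bessel_riesz \<alpha> \<beta> \<gamma> f) \<le> ennreal (M * N)"
    if f: "f \<in> dunkl_morrey_space \<alpha> p \<phi>" and N: "N > 0" "dunkl_morrey_norm \<alpha> p \<phi> f \<le> ennreal N" for f :: "real \<Rightarrow> complex" and N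
  proof -
    have li: "dunkl_locally_integrable \<alpha> p f" using f by (simp add: dunkl_morrey_space_def)
    then have "f \<in> borel_measurable lebesgue" by (simp add: dunkl_locally_integrable_def)
    then obtain f' where f'[measurable]: "f' \<in> borel_measurable borel" and eq: "AE x in lborel. f x = f' x"
      by (rule lebesgue_measurable_eq_borel_AE)
    let ?J = "riesz_majorant \<alpha> \<beta> \<gamma> (\<lambda>y. norm (f' y))"
    have J: "(AE x in dunkl_borel \<alpha>. ?J x < \<infinity>) \<and> ball_morrey_bound \<alpha> q \<psi> (\<lambda>y. enn2real (?J y)) (C2 * (C1 * N))"
      by (rule C2(2)) (use C1(1) N C1(2)[OF f' eq li N] in auto)
    have AEL: "AE x in lborel. ?J x < \<infinity>" using J by (intro dunkl_borel_AE_lborel[OF \<alpha>]) blast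
    note b = bessel_riesz_le_majorant[OF \<alpha> f' eq, of \<beta> \<gamma>]
    define h where "h = (\<lambda>x. LINT y|dunkl_borel \<alpha>. bessel_riesz_integrand \<alpha> \<beta> \<gamma> f' x y)"
    have "AE x in dunkl_measure \<alpha>. integrable (dunkl_measure \<alpha>) (bessel_riesz_integrand \<alpha> \<beta> \<gamma> f x)"
      using AE_dunkl_measure(1)[OF AEL] by eventually_elim (rule b(3))
    moreover have "dunkl_locally_integrable \<alpha> q (bessel_riesz \<alpha> \<beta> \<gamma> f) \<and>
      dunkl_morrey_norm \<alpha> q \<psi> (bessel_riesz \<alpha> \<beta> \<gamma> f) \<le> ennreal (C3 * (C2 * (C1 * N)))"
    proof (rule C3(2))
      show "h \<in> borel_measurable borel" unfolding h_def by (rule b(1))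
      show "AE x in lborel. bessel_riesz \<alpha> \<beta> \<gamma> f x = h x" unfolding h_def b(2) by simp
      show "C2 * (C1 * N) > 0" using C1 C2 N by simp
      have "AE y in dunkl_borel \<alpha>. norm (h y) \<le> enn2real (?J y)"
        using AE_dunkl_measure(2)[OF AEL] unfolding h_def by eventually_elim (rule b(4))
      from ball_morrey_bound_mono_AE[OF conjunct2[OF J] this norm_ge_zero q]
      show "ball_morrey_bound \<alpha> q \<psi> (\<lambda>y. norm (h y)) (C2 * (C1 * N))" .
    qed
    ultimately show ?thesis by (simp add: M_def mult.assoc)
  qed
  have bound: "dunkl_morrey_norm \<alpha> q \<psi> (bessel_riesz \<alpha> \<beta> \<gamma> f) \<le> ennreal M * dunkl_morrey_norm \<alpha> p \<phi> f"
    and good: "(AE x in dunkl_measure \<alpha>. integrable (dunkl_measure \<alpha>) (bessel_riesz_integrand \<alpha> \<beta> \<gamma> f x))"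
      "bessel_riesz \<alpha> \<beta> \<gamma> f \<in> dunkl_morrey_space \<alpha> q \<psi>"
    if f: "f \<in> dunkl_morrey_space \<alpha> p \<phi>" for f :: "real \<Rightarrow> complex"
  proof -
    have "dunkl_morrey_norm \<alpha> p \<phi> f < \<infinity>" using f by (simp add: dunkl_morrey_space_def)
    then obtain n where n: "dunkl_morrey_norm \<alpha> p \<phi> f = ennreal n" "n \<ge> 0"
      by (cases "dunkl_morrey_norm \<alpha> p \<phi> f") auto
    \<comment> \<open>The norm of \<open>f\<close> may be \<open>0\<close>, while \<open>main\<close> requires a positive bound \<open>N\<close> for it.\<close>
    have le: "dunkl_morrey_norm \<alpha> q \<psi> (bessel_riesz \<alpha> \<beta> \<gamma> f) \<le> ennreal (M * n) + ennreal e" if "e > 0" for e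
    proof -
      have "dunkl_morrey_norm \<alpha> q \<psi> (bessel_riesz \<alpha> \<beta> \<gamma> f) \<le> ennreal (M * (n + e / M))"
        using main[OF f, of "n + e / M"] n M that by (simp add: add_nonneg_pos ennreal_leI del: ennreal_plus)
      also have "M * (n + e / M) = M * n + e" using M by (simp add: field_simps)
      finally show ?thesis using M n that by simp
    qed
    have "dunkl_morrey_norm \<alpha> q \<psi> (bessel_riesz \<alpha> \<beta> \<gamma> f) \<le> ennreal (M * n)"
      by (rule ennreal_le_epsilon) (rule le)
    then show "dunkl_morrey_norm \<alpha> q \<psi> (bessel_riesz \<alpha> \<beta> \<gamma> f) \<le> ennreal M * dunkl_morrey_norm \<alpha> p \<phi> f"
      using M n by (simp add: ennreal_mult)
    have m: "dunkl_morrey_norm \<alpha> p \<phi> f \<le> ennreal (n + 1)" "n + 1 > 0" using n by (auto intro: ennreal_leI simp del: ennreal_plus)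
    show "(AE x in dunkl_measure \<alpha>. integrable (dunkl_measure \<alpha>) (bessel_riesz_integrand \<alpha> \<beta> \<gamma> f x))"
      using main[OF f m(2,1)] by blast
    show "bessel_riesz \<alpha> \<beta> \<gamma> f \<in> dunkl_morrey_space \<alpha> q \<psi>"
      using main[OF f m(2,1)] by (auto simp: dunkl_morrey_space_def intro: le_less_trans)
  qed
  let ?k = "dunkl_morrey_norm \<alpha> s \<omega> (bessel_riesz_kernel \<alpha> \<beta> \<gamma>)"
  have kpos: "?k > 0"
    by (rule dunkl_morrey_norm_kernel_pos) (use assms in auto)
  \<comment> \<open>If the norm of the kernel is infinite, the right-hand side is infinite unless \<open>t = 0\<close>.\<close>
  have "\<exists>C>0. \<forall>t::ennreal. ennreal M * t \<le> ennreal C * ?k * t"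
  proof (cases "?k = \<infinity>")
    case True
    have "ennreal M * t \<le> ennreal 1 * ?k * t" for t
      unfolding True by (cases "t = 0") (auto simp: ennreal_top_mult)
    then show ?thesis by (intro exI[of _ 1]) auto
  next
    case False
    then obtain k where k: "?k = ennreal k" "k > 0" using kpos by (cases ?k) auto
    have "ennreal M * t = ennreal (M / k) * ?k * t" for t
      unfolding k(1) using k(2) M by (simp add: ennreal_mult[symmetric])
    then show ?thesis using M k(2) by (intro exI[of _ "M / k"]) auto
  qed
  then obtain C where C: "C > 0" "\<And>t::ennreal. ennreal M * t \<le> ennreal C * ?k * t" by blast
  show ?thesis
    using C bound good by (intro exI[of _ C]) (blast intro: order_trans)
qed

end
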